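(* Let $n\ge 3$. There is an isomorphism of representations of $\mathfrak S_n$ \[ S_{\mathcal A^\perp,-2}(\mathrm{top})\cong Wh_n, \qquad Wh_n:=\mathrm{Ind}_{\mathfrak S_{n-1}}^{\mathfrak S_n}(\mathrm{Lie}_{n-1})-\mathrm{Lie}_n, \] where the right side is a priori a virtual representation.
   Context: For $k\ge 1$, $\mathrm{Lie}_k=\mathrm{Ind}_{\langle c_k\rangle}^{\mathfrak S_k}(\zeta_k)$ where $c_k$ is a $k$-cycle and $\zeta_k(c_k)=e^{2\pi i/k}$; $\mathfrak S_{n-1}\subset\mathfrak S_n$ is the stabilizer of $n$. The braid arrangement $\mathcal A\subset\mathbf C^n$ consists of the hyperplanes $x_i=x_j$, $1\le i<j\le n$. Let $\mathbf C^{\mathcal A}$ have basis $h_{ij}$ ($1\le i<j\le n$), $h_{ji}=-h_{ij}$, and $\varphi:\mathbf C^{\mathcal A}\to\mathbf C^n$, $h_{ij}\mapsto e_i-e_j$. $K=\ker\varphi$, and $\mathcal A^\perp$ is the arrangement in $K$ of hyperplanes $\ker(h_{ij}^*|_K)$. $\mathfrak S_n$ acts on $\mathbf C^{\mathcal A}$ by $\pi h_{ij}=h_{\pi(i)\pi(j)}$, $\varphi$ is equivariant, so $\mathfrak S_n$ acts on $K$ and on $S_{\mathcal A^\perp,-2}$. Internal zonotopal algebra: for a finite set $\mathcal B$ of linear hyperplanes in a finite-dimensional complex vector space $U$ and $u\in U$, $\rho_{\mathcal B}(u)$ is the number of hyperplanes not containing $u$; $I_{\mathcal B,-2}$ is the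 ideal of $\mathrm{Sym}(U)$ generated by $u^{\max\{\rho_{\mathcal B}(u)-1,0\}}$; $S_{\mathcal B,-2}=\mathrm{Sym}(U)/I_{\mathcal B,-2}$; "top" denotes its nonzero graded component of largest degree.
   Formalization: The ideal I is generated by powers of nonzero u only (u = 0 would give the generator 0^0 = 1, so S = 0), and hyperplanes are counted with multiplicity, which matters only for n = 3, where all three coincide and counting them as a set would give S = 0. *)

theory Defs
  imports
    Complex_Main
    "HOL-Library.Multiset"
    "HOL-Library.Poly_Mapping"
    "HOL-Algebra.QuotRing"
    "HOL-Algebra.Module"
    "HOL-Algebra.Generated_Groups"
    "HOL-Algebra.Sym_Groups"
begin

hide_const (open) Multiset.mult

section \<open>Complex linear representations\<close>

definition cplx :: "complex ring" where
  "cplx = \<lparr>carrier = UNIV, mult = (*), one = 1, zero = 0, add = (+)\<rparr>"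

text \<open>The fields \<open>mult\<close> and \<open>one\<close>, which the library's modules inherit from rings, play no
  role for representations.\<close>

record ('g, 'v) rep = "(complex, 'v) module" +
  act :: "'g \<Rightarrow> 'v \<Rightarrow> 'v"

definition linear_rep :: "('g, 'm) monoid_scheme \<Rightarrow> ('g, 'v) rep \<Rightarrow> bool" where
  "linear_rep G V \<longleftrightarrow>
     group G \<and> module cplx V \<and>
     (\<forall>g\<in>carrier G. \<forall>x\<in>carrier V. act V g x \<in> carrier V) \<and>
     (\<forall>g\<in>carrier G. \<forall>x\<in>carrier V. \<forall>y\<in>carrier V.
        act V g (x \<oplus>\<^bsub>V\<^esub> y) = act V g x \<oplus>\<^bsub>V\<^esub> act V g y) \<and>
     (\<forall>g\<in>carrier G. \<forall>c. \<forall>x\<in>carrier V. act V g (c \<odot>\<^bsub>V\<^esub> x) = c \<odot>\<^bsub>V\<^esub> act V g x) \<and>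
     (\<forall>x\<in>carrier V. act V \<one>\<^bsub>G\<^esub> x = x) \<and>
     (\<forall>g\<in>carrier G. \<forall>h\<in>carrier G. \<forall>x\<in>carrier V.
        act V (g \<otimes>\<^bsub>G\<^esub> h) x = act V g (act V h x))"

definition rep_iso ::
    "('g, 'm) monoid_scheme \<Rightarrow> ('g, 'v) rep \<Rightarrow> ('g, 'w) rep \<Rightarrow> bool" where
  "rep_iso G V W \<longleftrightarrow>
     linear_rep G V \<and> linear_rep G W \<and>
     (\<exists>f. bij_betw f (carrier V) (carrier W) \<and>
       (\<forall>x\<in>carrier V. \<forall>y\<in>carrier V. f (x \<oplus>\<^bsub>V\<^esub> y) = f x \<oplus>\<^bsub>W\<^esub> f y) \<and>
       (\<forall>c. \<forall>x\<in>carrier V. f (c \<odot>\<^bsub>V\<^esub> x) = c \<odot>\<^bsub>W\<^esub> f x) \<and>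
       (\<forall>g\<in>carrier G. \<forall>x\<in>carrier V. f (act V g x) = act W g (f x)))"

definition rep_sum :: "('g, 'v) rep \<Rightarrow> ('g, 'w) rep \<Rightarrow> ('g, 'v \<times> 'w) rep" where
  "rep_sum V W =
     \<lparr>carrier = carrier V \<times> carrier W, mult = undefined, one = undefined,
      zero = (\<zero>\<^bsub>V\<^esub>, \<zero>\<^bsub>W\<^esub>),
      add = (\<lambda>(x, y) (x', y'). (x \<oplus>\<^bsub>V\<^esub> x', y \<oplus>\<^bsub>W\<^esub> y')),
      smult = (\<lambda>c (x, y). (c \<odot>\<^bsub>V\<^esub> x, c \<odot>\<^bsub>W\<^esub> y)),
      act = (\<lambda>g (x, y). (act V g x, act W g y))\<rparr>"

text \<open>A virtual representation is a formal difference \<open>A - B\<close>, encoded as the pair \<open>(A, B)\<close>.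
  As representations of finite groups over the complex numbers are semisimple, \<open>V\<close> equals
  \<open>A - B\<close> in the representation ring iff \<open>V \<oplus> B \<cong> A\<close>.\<close>

definition rep_iso_virtual ::
    "('g, 'm) monoid_scheme \<Rightarrow> ('g, 'v) rep \<Rightarrow> ('g, 'a) rep \<times> ('g, 'b) rep \<Rightarrow> bool" where
  "rep_iso_virtual G V D \<longleftrightarrow> rep_iso G (rep_sum V (snd D)) (fst D)"

text \<open>A function \<open>f\<close> stands for the element of \<open>\<complex>[G] \<otimes> V\<close>, tensored over \<open>\<complex>[H]\<close>, that is
  the sum of \<open>g \<otimes> f g\<close> over representatives \<open>g\<close> of the cosets \<open>g H\<close>; the condition on \<open>f\<close>
  reflects \<open>g h \<otimes> v = g \<otimes> h v\<close>. For finite \<open>G\<close> every element arises uniquely in this way.\<close>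

definition induced_rep ::
    "('g, 'm) monoid_scheme \<Rightarrow> 'g set \<Rightarrow> ('g, 'v) rep \<Rightarrow> ('g, 'g \<Rightarrow> 'v) rep" where
  "induced_rep G H V =
     \<lparr>carrier = {f \<in> carrier G \<rightarrow>\<^sub>E carrier V.
                  \<forall>g\<in>carrier G. \<forall>h\<in>H. act V h (f (g \<otimes>\<^bsub>G\<^esub> h)) = f g},
      mult = undefined, one = undefined,
      zero = (\<lambda>g\<in>carrier G. \<zero>\<^bsub>V\<^esub>),
      add = (\<lambda>f f'. \<lambda>g\<in>carrier G. f g \<oplus>\<^bsub>V\<^esub> f' g),
      smult = (\<lambda>c f. \<lambda>g\<in>carrier G. c \<odot>\<^bsub>V\<^esub> f g),
      act = (\<lambda>x f. \<lambda>g\<in>carrier G. f (inv\<^bsub>G\<^esub> x \<otimes>\<^bsub>G\<^esub> g))\<rparr>"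

definition character_rep :: "('g \<Rightarrow> complex) \<Rightarrow> ('g, complex) rep" where
  "character_rep chi =
     \<lparr>carrier = UNIV, mult = undefined, one = undefined, zero = 0, add = (+),
      smult = (*), act = (\<lambda>g z. chi g * z)\<rparr>"


section \<open>The representations Lie and the Whitehouse module\<close>

definition std_cycle :: "nat \<Rightarrow> nat \<Rightarrow> nat" where
  "std_cycle k = cycle_of_list [1..<Suc k]"

definition zeta :: "nat \<Rightarrow> (nat \<Rightarrow> nat) \<Rightarrow> complex" where
  "zeta k h = exp (2 * pi * \<i> / k) ^ (LEAST m. h = std_cycle k ^^ m)"

lemma zeta_std_cycle_power:
  assumes "k \<ge> 1"
  shows "zeta k (std_cycle k ^^ m) = exp (2 * pi * \<i> * m / k)"
proof -
  let ?w = "exp (2 * pi * \<i> / k)"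
  have wk: "?w ^ k = 1"
    using assms by (simp add: exp_of_nat_mult [symmetric])
  have wmod: "?w ^ l = ?w ^ (l mod k)" for l
  proof -
    have "?w ^ l = ?w ^ (k * (l div k) + l mod k)"
      by simp
    also have "\<dots> = ?w ^ (l mod k)"
      by (simp only: power_add power_mult wk) simp
    finally show ?thesis .
  qed
  have value_at_1: "(std_cycle k ^^ l) 1 = Suc (l mod k)" for l
  proof -
    have "map (std_cycle k ^^ l) [1..<Suc k] = rotate l [1..<Suc k]"
      unfolding std_cycle_def by (rule cyclic_rotation) simp
    then have "map (std_cycle k ^^ l) [1..<Suc k] ! 0 = rotate l [1..<Suc k] ! 0"
      by simp
    with assms show ?thesis
      by (simp add: nth_rotate del: upt_Suc)
  qed
  let ?l = "LEAST l. std_cycle k ^^ m = std_cycle k ^^ l"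
  have "std_cycle k ^^ m = std_cycle k ^^ ?l"
    by (rule LeastI) (rule refl)
  then have "m mod k = ?l mod k"
    using value_at_1[of m] value_at_1[of ?l] by simp
  then have "zeta k (std_cycle k ^^ m) = ?w ^ m"
    unfolding zeta_def using wmod[of m] wmod[of ?l] by metis
  also have "\<dots> = exp (2 * pi * \<i> * m / k)"
    by (simp add: exp_of_nat_mult [symmetric] mult_ac)
  finally show ?thesis .
qed

definition Lie :: "nat \<Rightarrow> (nat \<Rightarrow> nat, (nat \<Rightarrow> nat) \<Rightarrow> complex) rep" where
  "Lie k = induced_rep (sym_group k) (generate (sym_group k) {std_cycle k})
             (character_rep (zeta k))"

definition point_stabilizer :: "nat \<Rightarrow> (nat \<Rightarrow> nat) set" where
  "point_stabilizer n = {p \<in> carrier (sym_group n). p n = n}"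

text \<open>\<^term>\<open>sym_group (n - 1)\<close>, which acts on \<^term>\<open>Lie (n - 1)\<close>, is the same set of
  functions as the stabilizer.\<close>

lemma point_stabilizer_eq:
  assumes "n \<ge> 1"
  shows "point_stabilizer n = carrier (sym_group (n - 1))"
proof -
  have eq: "insert n {1..n - 1} = {1..n}"
    using assms by auto
  show ?thesis
  proof (rule Set.set_eqI)
    fix p
    show "p \<in> point_stabilizer n \<longleftrightarrow> p \<in> carrier (sym_group (n - 1))"
    proof
      assume "p \<in> point_stabilizer n"
      then have p: "p permutes {1..n}" "p n = n"
        by (auto simp: point_stabilizer_def sym_group_carrier)
      have "p permutes {1..n - 1}"
        by (rule permutes_superset[OF p(1)]) (use p(2) eq in auto)
      then show "p \<in> carrier (sym_group (n - 1))"
        by (simp add: sym_group_carrier)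
    next
      assume "p \<in> carrier (sym_group (n - 1))"
      then have p: "p permutes {1..n - 1}"
        by (simp add: sym_group_carrier)
      have "p permutes {1..n}"
        by (rule permutes_subset[OF p]) auto
      moreover have "p n = n"
        by (rule permutes_not_in[OF p]) (use assms in auto)
      ultimately show "p \<in> point_stabilizer n"
        by (simp add: point_stabilizer_def sym_group_carrier)
    qed
  qed
qed

definition Wh ::
    "nat \<Rightarrow> (nat \<Rightarrow> nat, (nat \<Rightarrow> nat) \<Rightarrow> (nat \<Rightarrow> nat) \<Rightarrow> complex) rep
          \<times> (nat \<Rightarrow> nat, (nat \<Rightarrow> nat) \<Rightarrow> complex) rep" where
  "Wh n = (induced_rep (sym_group n) (point_stabilizer n) (Lie (n - 1)), Lie n)"


section \<open>Symmetric algebras\<close>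

text \<open>Complex polynomials in commuting variables \<open>X\<^sub>u\<close>, \<open>u :: 'u\<close>.\<close>

type_synonym 'u cpoly = "('u \<Rightarrow>\<^sub>0 nat) \<Rightarrow>\<^sub>0 complex"

definition Const :: "complex \<Rightarrow> 'u cpoly" where
  "Const c = Poly_Mapping.single 0 c"

definition Var :: "'u \<Rightarrow> 'u cpoly" where
  "Var u = Poly_Mapping.single (Poly_Mapping.single u 1) 1"

definition poly_algebra :: "'u set \<Rightarrow> (complex, 'u cpoly) module" where
  "poly_algebra X =
     \<lparr>carrier = {p. \<forall>m\<in>Poly_Mapping.keys p. Poly_Mapping.keys m \<subseteq> X},
      mult = (*), one = 1, zero = 0, add = (+), smult = (\<lambda>c p. Const c * p)\<rparr>"

definition rename_vars :: "('u \<Rightarrow> 'u) \<Rightarrow> 'u cpoly \<Rightarrow> 'u cpoly" where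
  "rename_vars f p =
     (\<Sum>m\<in>Poly_Mapping.keys p. Const (Poly_Mapping.lookup p m) * (\<Prod>u\<in>Poly_Mapping.keys m. Var (f u) ^ Poly_Mapping.lookup m u))"

definition homogeneous :: "nat \<Rightarrow> 'u cpoly \<Rightarrow> bool" where
  "homogeneous d p \<longleftrightarrow> (\<forall>m\<in>Poly_Mapping.keys p. (\<Sum>u\<in>Poly_Mapping.keys m. Poly_Mapping.lookup m u) = d)"

definition quot_algebra ::
    "(complex, 'a) module \<Rightarrow> 'a set \<Rightarrow> (complex, 'a set) module" where
  "quot_algebra A I =
     \<lparr>carrier = carrier (A Quot I), mult = mult (A Quot I), one = one (A Quot I),
      zero = zero (A Quot I), add = add (A Quot I),
      smult = (\<lambda>c X. \<Union>x\<in>X. I +>\<^bsub>A\<^esub> (c \<odot>\<^bsub>A\<^esub> x))\<rparr>"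

text \<open>\<open>Sym(U)\<close> is the free commutative algebra on the set \<open>U\<close> modulo the relations making
  \<open>u \<mapsto> X\<^sub>u\<close> linear.\<close>

definition linearity_ideal :: "('g, 'u) rep \<Rightarrow> 'u cpoly set" where
  "linearity_ideal U = genideal (poly_algebra (carrier U))
     ({Var (u \<oplus>\<^bsub>U\<^esub> v) - (Var u + Var v) | u v. u \<in> carrier U \<and> v \<in> carrier U} \<union>
      {Var (c \<odot>\<^bsub>U\<^esub> u) - Const c * Var u | c u. u \<in> carrier U})"

definition Sym :: "('g, 'u) rep \<Rightarrow> (complex, 'u cpoly set) module" where
  "Sym U = quot_algebra (poly_algebra (carrier U)) (linearity_ideal U)"

definition sym_class :: "('g, 'u) rep \<Rightarrow> 'u cpoly \<Rightarrow> 'u cpoly set" where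
  "sym_class U p = linearity_ideal U +>\<^bsub>poly_algebra (carrier U)\<^esub> p"

definition sym_incl :: "('g, 'u) rep \<Rightarrow> 'u \<Rightarrow> 'u cpoly set" where
  "sym_incl U u = sym_class U (Var u)"

definition Sym_component :: "('g, 'u) rep \<Rightarrow> nat \<Rightarrow> 'u cpoly set set" where
  "Sym_component U d =
     sym_class U ` {p \<in> carrier (poly_algebra (carrier U)). homogeneous d p}"


section \<open>Internal zonotopal algebra\<close>

text \<open>Arrangements are multisets: distinct members of a family of hyperplanes may coincide
  as sets, and then count with multiplicity.\<close>

definition rho :: "'u set multiset \<Rightarrow> 'u \<Rightarrow> nat" where
  "rho B u = size (filter_mset (\<lambda>H. u \<notin> H) B)"

text \<open>The subtraction on \<^typ>\<open>nat\<close> is truncated, so the exponent is \<open>max {rho B u - 1, 0}\<close>.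
  The generators range over nonzero \<open>u\<close>: for \<open>u = 0\<close> the exponent is \<open>0\<close>, and
  the ideal would always be the whole algebra.\<close>

definition internal_ideal ::
    "('g, 'u) rep \<Rightarrow> 'u set multiset \<Rightarrow> 'u cpoly set set" where
  "internal_ideal U B = genideal (Sym U)
     {sym_incl U u [^]\<^bsub>Sym U\<^esub> (rho B u - 1) | u. u \<in> carrier U \<and> u \<noteq> \<zero>\<^bsub>U\<^esub>}"

definition internal_algebra ::
    "('g, 'u) rep \<Rightarrow> 'u set multiset \<Rightarrow> (complex, 'u cpoly set set) module" where
  "internal_algebra U B = quot_algebra (Sym U) (internal_ideal U B)"

definition internal_component ::
    "('g, 'u) rep \<Rightarrow> 'u set multiset \<Rightarrow> nat \<Rightarrow> 'u cpoly set set set" where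
  "internal_component U B d =
     (\<lambda>x. internal_ideal U B +>\<^bsub>Sym U\<^esub> x) ` Sym_component U d"

definition top_degree :: "('g, 'u) rep \<Rightarrow> 'u set multiset \<Rightarrow> nat" where
  "top_degree U B =
     (GREATEST d. internal_component U B d \<noteq> {\<zero>\<^bsub>internal_algebra U B\<^esub>})"

text \<open>A group element acts on cosets by taking images, first under the algebra map
  \<open>X\<^sub>u \<mapsto> X\<^bsub>g u\<^esub>\<close> and then, for the second quotient, under the resulting map on \<open>Sym(U)\<close>.\<close>

definition internal_top ::
    "('g, 'u) rep \<Rightarrow> 'u set multiset \<Rightarrow> ('g, 'u cpoly set set) rep" where
  "internal_top U B =
     \<lparr>carrier = internal_component U B (top_degree U B),
      mult = undefined, one = undefined,
      zero = zero (internal_algebra U B),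
      add = add (internal_algebra U B),
      smult = smult (internal_algebra U B),
      act = (\<lambda>g X. (\<lambda>x. rename_vars (act U g) ` x) ` X)\<rparr>"


section \<open>The dual of the braid arrangement\<close>

text \<open>The hyperplane \<open>x\<^sub>i = x\<^sub>j\<close> of the braid arrangement is represented by its index \<open>(i, j)\<close>.\<close>

definition braid_index :: "nat \<Rightarrow> (nat \<times> nat) set" where
  "braid_index n = {(i, j). 1 \<le> i \<and> i < j \<and> j \<le> n}"

definition hvec :: "nat \<Rightarrow> nat \<Rightarrow> nat \<times> nat \<Rightarrow> complex" where
  "hvec i j = (\<lambda>e. of_bool (i < j \<and> e = (i, j)) - of_bool (j < i \<and> e = (j, i)))"

text \<open>The coordinate of \<open>a\<close> at the basis vector \<open>h\<^sub>i\<^sub>j\<close> is \<open>a (i, j)\<close>.\<close>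

definition braid_space :: "nat \<Rightarrow> (nat \<Rightarrow> nat, nat \<times> nat \<Rightarrow> complex) rep" where
  "braid_space n =
     \<lparr>carrier = {a. \<forall>e. e \<notin> braid_index n \<longrightarrow> a e = 0},
      mult = undefined, one = undefined,
      zero = (\<lambda>e. 0),
      add = (\<lambda>a b e. a e + b e),
      smult = (\<lambda>c a e. c * a e),
      act = (\<lambda>p a e. \<Sum>(i, j)\<in>braid_index n. a (i, j) * hvec (p i) (p j) e)\<rparr>"

definition braid_map :: "nat \<Rightarrow> (nat \<times> nat \<Rightarrow> complex) \<Rightarrow> nat \<Rightarrow> complex" where
  "braid_map n a =
     (\<lambda>k. \<Sum>(i, j)\<in>braid_index n. a (i, j) * (of_bool (k = i) - of_bool (k = j)))"

definition braid_kernel :: "nat \<Rightarrow> (nat \<Rightarrow> nat, nat \<times> nat \<Rightarrow> complex) rep" where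
  "braid_kernel n =
     (braid_space n)\<lparr>carrier := {a \<in> carrier (braid_space n). braid_map n a = (\<lambda>k. 0)}\<rparr>"

definition braid_dual :: "nat \<Rightarrow> (nat \<times> nat \<Rightarrow> complex) set multiset" where
  "braid_dual n =
     image_mset (\<lambda>e. {u \<in> carrier (braid_kernel n). u e = 0}) (mset_set (braid_index n))"

end

theory Submission
  imports Defs "HOL-Computational_Algebra.Polynomial" "HOL-Library.Function_Algebras" "HOL-Algebra.Multiplicative_Group"
begin

text \<open>Let \<open>x\<^sub>a\<^sub>b\<close> be the triangle through \<open>a\<close>, \<open>b\<close> and a fixed vertex \<open>j\<close>; these span \<open>K\<close>. Squares of
  triangles lie in the internal ideal, and they generate it: expanding the square of a triangle that
  avoids \<open>j\<close> gives the relation \<open>x\<^sub>a\<^sub>b x\<^sub>b\<^sub>c + x\<^sub>b\<^sub>c x\<^sub>c\<^sub>a + x\<^sub>c\<^sub>a x\<^sub>a\<^sub>b = 0\<close>, with which every monomial on a vertex set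
  \<open>B\<close> reduces to increasing forests, so that it vanishes in degree \<open>card B\<close>, while the support of a
  flow has at least as many edges as vertices. Hence the top degree is at most \<open>n - 2\<close>, where \<open>(n - 2)!\<close> trees
  span. Evaluating polynomials at the functionals attached to cyclic words, and then at Lie
  polynomials, identifies the top component \<open>V\<close> with the span of functions \<open>Q\<^sub>w\<close> on words, of
  dimension \<open>(n - 2)!\<close>, which are invariant under rotation of \<open>w\<close> and satisfy shuffle relations.

  Both \<open>Ind Lie\<^sub>n\<^sub>-\<^sub>1\<close> and \<open>V \<oplus> Lie\<^sub>n\<close> are isomorphic to \<open>V \<otimes> \<complex>\<^sup>n\<close>: the first and the summand \<open>Lie\<^sub>n\<close> map to it by
  sending a function \<open>F\<close> on the group to the sum of \<open>F g Q\<^sub>g \<otimes> e\<^bsub>g n\<^esub>\<close>, and \<open>V\<close> by \<open>v \<mapsto> v \<otimes> (1, \<dots>, 1)\<close>. Surjectivity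
  follows from Klyachko's identity, whose weights transform under rotation by a root of unity and
  which expresses a single word through them modulo shuffles; injectivity then follows by counting
  dimensions.\<close>

section \<open>Words, Lie brackets and the filtration by sign functions\<close>

text \<open>The target V \<otimes> \<complex>^n is dictated by restriction to the point stabilizer:
  there V becomes \<open>Lie (n - 1)\<close>, so the projection formula makes V \<otimes>
  \<complex>^n the induced representation; splitting \<complex>^n into the invariant line and its
  complement gives V and V tensored with the standard representation, which is \<open>Lie n\<close>.
  The obstacle is that independence of the trees and injectivity of the maps cannot be read off
  directly. Only spanning is proved by hand; the rest is the equality (n-2)! + (n-1)! = n (n-2)! =
  n!/(n-1) between upper bounds (trees, orbits of cycles) and the number of functions Q_w \<otimes>
  e_j that are visibly independent, those with w ending in n-1, n. Lie polynomials enter because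
  functions on words are filtered by degree in the signs of pairs of letters, and a Lie polynomial
  in n-1 letters kills all degrees below n-2. Evaluating at it isolates the top degree part, where
  products of signs and indicator functions of words agree up to a power of 2.\<close>

definition words :: "'a set \<Rightarrow> 'a list set" where
  "words A = {l. distinct l \<and> set l = A}"

text \<open>The value of the linear extension of \<open>f\<close> at the Lie bracket \<open>[x\<^sub>1, [x\<^sub>2, \<dots> [x\<^sub>m\<^sub>-\<^sub>1, x\<^sub>m]]]\<close>.\<close>

fun lie :: "'a list \<Rightarrow> ('a list \<Rightarrow> complex) \<Rightarrow> complex" where
  "lie [] f = 0"
| "lie [x] f = f [x]"
| "lie (x # y # ys) f = lie (y # ys) (\<lambda>w. f (x # w) - f (w @ [x]))"

lemma lie_Cons: "xs \<noteq> [] \<Longrightarrow> lie (x # xs) f = lie xs (\<lambda>w. f (x # w) - f (w @ [x]))"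
  by (cases xs) auto

lemma lie_cong:
  "distinct xs \<Longrightarrow> (\<And>w. w \<in> words (set xs) \<Longrightarrow> f w = g w) \<Longrightarrow> lie xs f = lie xs g"
proof (induction xs f arbitrary: g rule: lie.induct)
  case (3 x y ys f)
  have "lie (y # ys) (\<lambda>w. f (x # w) - f (w @ [x])) = lie (y # ys) (\<lambda>w. g (x # w) - g (w @ [x]))"
  proof (rule "3.IH")
    show "distinct (y # ys)" using 3 by simp
    fix w assume w: "w \<in> words (set (y # ys))"
    have "x # w \<in> words (set (x # y # ys))" "w @ [x] \<in> words (set (x # y # ys))"
      using w "3.prems"(1) by (auto simp: words_def)
    then show "f (x # w) - f (w @ [x]) = g (x # w) - g (w @ [x])"
      using "3.prems"(2) by metis
  qed
  then show ?case by simp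
qed (auto simp: words_def)

lemma lie_zero [simp]: "lie xs (\<lambda>w. 0) = 0"
  by (induction xs "\<lambda>w::'a list. 0::complex" rule: lie.induct) auto

lemma lie_add: "lie xs (\<lambda>w. f w + g w) = lie xs f + lie xs g"
proof (induction xs f arbitrary: g rule: lie.induct)
  case (3 x y ys f)
  show ?case
    using "3.IH"[of "\<lambda>w. g (x # w) - g (w @ [x])"] by (simp add: algebra_simps)
qed auto

lemma lie_scale: "lie xs (\<lambda>w. c * f w) = c * lie xs f"
proof (induction xs f rule: lie.induct)
  case (3 x y ys f)
  then show ?case by (simp add: algebra_simps)
qed auto

lemma lie_sum: "lie xs (\<lambda>w. \<Sum>i\<in>I. f i w) = (\<Sum>i\<in>I. lie xs (f i))"
  by (induction I rule: infinite_finite_induct) (auto simp: lie_add)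

lemma lie_map: "lie (map g xs) f = lie xs (\<lambda>w. f (map g w))"
  by (induction xs arbitrary: f rule: induct_list012) (auto)

text \<open>With \<open>z\<close> innermost, a word ending in \<open>z\<close> arises only if every
  outer letter is put in front, so each bracket contributes one of its two terms. Words ending in a
  fixed letter are therefore dual to the brackets with that letter innermost.\<close>

lemma lie_indicator:
  "z \<notin> set xs \<Longrightarrow> lie (xs @ [z]) (\<lambda>w. of_bool (w = ls @ [z])) = of_bool (xs = ls)"
proof (induction xs arbitrary: ls)
  case (Cons x xs)
  show ?case
  proof (cases ls)
    case Nil
    have "(\<lambda>w. of_bool (x # w = ls @ [z]) - of_bool (w @ [x] = ls @ [z]) :: complex) = (\<lambda>w. 0)"
      using Cons.prems Nil by auto
    then show ?thesis using Nil by (simp add: lie_Cons)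
  next
    case (Cons y ls')
    have "(\<lambda>w. of_bool (x # w = ls @ [z]) - of_bool (w @ [x] = ls @ [z]) :: complex)
        = (\<lambda>w. of_bool (x = y) * of_bool (w = ls' @ [z]))"
      using Cons.prems Cons by auto
    then show ?thesis using Cons.prems Cons.IH[of ls'] Cons
      by (simp add: lie_Cons lie_scale)
  qed
qed (auto simp: words_def)

text \<open>Equal to \<open>1\<close> or \<open>- 1\<close> according to which of \<open>a\<close> and \<open>b\<close> is met first in the word.\<close>

primrec sg :: "'a list \<Rightarrow> 'a \<Rightarrow> 'a \<Rightarrow> complex" where
  "sg [] a b = 0"
| "sg (y # ys) a b = (if a = b then 0 else if y = a then 1 else if y = b then - 1 else sg ys a b)"

lemma sg_antisym: "sg l b a = - sg l a b"
  by (induction l) auto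

lemma sg_same [simp]: "sg l a a = 0"
  by (induction l) auto

lemma sg_map: "inj g \<Longrightarrow> sg (map g l) (g a) (g b) = sg l a b"
  by (induction l) (auto dest: injD)

lemma sg_append: "sg (p @ q) a b = (if a \<in> set p \<or> b \<in> set p then sg p a b else sg q a b)"
  by (induction p) auto

lemma sg_notin1: "a \<notin> set l \<Longrightarrow> b \<in> set l \<Longrightarrow> sg l a b = - 1"
  by (induction l) auto

lemma sg_notin2: "a \<in> set l \<Longrightarrow> b \<notin> set l \<Longrightarrow> sg l a b = 1"
  by (induction l) auto

lemma sg_cases: "a \<noteq> b \<Longrightarrow> a \<in> set l \<or> b \<in> set l \<Longrightarrow> sg l a b = 1 \<or> sg l a b = - 1"
  by (induction l) auto

text \<open>A letter missing from the word counts as coming after those present, so transitivity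
  holds without membership hypotheses.\<close>

lemma sg_trans: "sg l a b = 1 \<Longrightarrow> sg l b c = 1 \<Longrightarrow> sg l a c = 1"
  by (induction l) (auto split: if_splits simp: sg_antisym[of _ _ a] sg_antisym[of _ c b])

lemma sg_word_unique:
  "distinct v \<Longrightarrow> distinct w \<Longrightarrow> set v = set w \<Longrightarrow> sorted_wrt (\<lambda>a b. sg v a b = 1) w \<Longrightarrow> v = w"
proof (induction w arbitrary: v)
  case (Cons a w)
  obtain c v' where v: "v = c # v'" using Cons.prems by (cases v) auto
  have ca: "c = a"
  proof (rule ccontr)
    assume "c \<noteq> a"
    then have "c \<in> set w" using Cons.prems v by auto
    then have "sg v a c = 1" using Cons.prems(4) by auto
    then show False using v \<open>c \<noteq> a\<close> by simp
  qed
  have "sorted_wrt (\<lambda>x y. sg v' x y = 1) w"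
  proof (rule sorted_wrt_mono_rel[of w "\<lambda>x y. sg v x y = 1"])
    fix x y assume "x \<in> set w" "y \<in> set w" "sg v x y = 1"
    moreover have "x \<noteq> a" "y \<noteq> a" using Cons.prems(2) calculation by auto
    ultimately show "sg v' x y = 1" using v ca by (auto split: if_splits)
  qed (use Cons.prems in auto)
  moreover have "set v' = set w" using Cons.prems v ca by auto
  ultimately have "v' = w" using Cons.IH[of v'] Cons.prems v by auto
  then show ?case using v ca by simp
qed auto

lemma sorted_sg_self: "distinct w \<Longrightarrow> sorted_wrt (\<lambda>a b. sg w a b = 1) w"
proof (induction w)
  case (Cons a w)
  have "sorted_wrt (\<lambda>x y. sg (a # w) x y = 1) w"
    by (rule sorted_wrt_mono_rel[of w "\<lambda>x y. sg w x y = 1"]) (use Cons in auto)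
  moreover have "\<forall>b\<in>set w. sg (a # w) a b = 1" using Cons.prems by auto
  ultimately show ?case by simp
qed auto

text \<open>By transitivity the consecutive comparisons decide the whole order. Thus the indicator
  function of a word of length m is a product of m - 1 comparisons.\<close>

lemma word_eq_iff_consecutive:
  assumes "v \<in> words A" "w \<in> words A"
  shows "v = w \<longleftrightarrow> (\<forall>i. Suc i < length w \<longrightarrow> sg v (w ! i) (w ! Suc i) = 1)"
proof -
  have "(\<forall>i. Suc i < length w \<longrightarrow> sg v (w ! i) (w ! Suc i) = 1)
      \<longleftrightarrow> successively (\<lambda>a b. sg v a b = 1) w"
    by (simp add: successively_conv_nth)
  also have "\<dots> \<longleftrightarrow> sorted_wrt (\<lambda>a b. sg v a b = 1) w"
    by (rule successively_iff_sorted_wrt_strong) (blast intro: sg_trans)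
  also have "\<dots> \<longleftrightarrow> v = w"
    using assms sg_word_unique[of v w] sorted_sg_self[of w] by (auto simp: words_def)
  finally show ?thesis by simp
qed

text \<open>\<open>Low A d f\<close>: on the words with letter set \<open>A\<close>, \<open>f\<close> agrees with a polynomial of degree
  less than \<open>d\<close> in the sign functions.\<close>

inductive Low :: "'a set \<Rightarrow> nat \<Rightarrow> ('a list \<Rightarrow> complex) \<Rightarrow> bool" for A where
  zero: "Low A 0 (\<lambda>l. 0)"
| const: "Low A (Suc 0) (\<lambda>l. c)"
| sign: "a \<in> A \<Longrightarrow> b \<in> A \<Longrightarrow> Low A (Suc (Suc 0)) (\<lambda>l. sg l a b)"
| add: "Low A d f \<Longrightarrow> Low A d g \<Longrightarrow> Low A d (\<lambda>l. f l + g l)"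
| mult: "Low A (Suc d) f \<Longrightarrow> Low A (Suc e) g \<Longrightarrow> Low A (Suc (d + e)) (\<lambda>l. f l * g l)"
| weaken: "Low A d f \<Longrightarrow> Low A (Suc d) f"
| cong: "Low A d f \<Longrightarrow> \<forall>l\<in>words A. f l = g l \<Longrightarrow> Low A d g"

lemma Low_0: "Low A d f \<Longrightarrow> d = 0 \<Longrightarrow> l \<in> words A \<Longrightarrow> f l = 0"
  by (induction rule: Low.induct) auto

lemma Low_mono: "Low A d f \<Longrightarrow> d \<le> e \<Longrightarrow> Low A e f"
  by (induction e) (auto intro: Low.weaken simp: le_Suc_eq)

lemma Low_zero: "Low A d (\<lambda>l. 0)"
  by (rule Low_mono[OF Low.zero]) simp

lemma Low_const: "d > 0 \<Longrightarrow> Low A d (\<lambda>l. c)"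
  by (rule Low_mono[OF Low.const]) simp

text \<open>The bounds are strict, so a product loses one from their sum. The rule
  \<open>mult\<close> presupposes positive bounds; for \<open>e = 0\<close> the factor
  \<open>g\<close> vanishes on the words.\<close>

lemma Low_mult_0:
  assumes "Low A (Suc d) f" "Low A e g"
  shows "Low A (d + e) (\<lambda>l. f l * g l)"
proof (cases e)
  case 0
  then have "\<forall>l\<in>words A. g l = 0" using assms Low_0 by blast
  then show ?thesis by (intro Low.cong[OF Low_zero]) auto
next
  case (Suc e')
  then show ?thesis using Low.mult[of A d f e' g] assms by simp
qed

lemma Low_scale: "Low A d f \<Longrightarrow> Low A d (\<lambda>l. c * f l)"
  using Low_mult_0[OF Low.const] by fastforce

lemma Low_diff: "Low A d f \<Longrightarrow> Low A d g \<Longrightarrow> Low A d (\<lambda>l. f l - g l)"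
  using Low.add[OF _ Low_scale[of A d g "-1"]] by simp

lemma Low_sum: "(\<And>i. i \<in> I \<Longrightarrow> Low A d (f i)) \<Longrightarrow> Low A d (\<lambda>l. \<Sum>i\<in>I. f i l)"
  by (induction I rule: infinite_finite_induct) (auto intro: Low.add Low_zero)

lemma Low_prod:
  "finite I \<Longrightarrow> (\<And>i. i \<in> I \<Longrightarrow> Low A (Suc (k i)) (f i)) \<Longrightarrow>
    Low A (Suc (\<Sum>i\<in>I. k i)) (\<lambda>l. \<Prod>i\<in>I. f i l)"
  by (induction I rule: finite_induct) (auto intro: Low.mult Low.const)

lemma words_Cons: "x \<notin> A \<Longrightarrow> w \<in> words A \<Longrightarrow> x # w \<in> words (insert x A)"
  by (auto simp: words_def)

lemma words_snoc: "x \<notin> A \<Longrightarrow> w \<in> words A \<Longrightarrow> w @ [x] \<in> words (insert x A)"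
  by (auto simp: words_def)

text \<open>Prepending and appending \<open>x\<close> agree on comparisons of other letters and turn
  a comparison with \<open>x\<close> into opposite constants. The difference thus behaves like a
  derivation: it lowers signs to constants and obeys a Leibniz rule on products.\<close>

lemma Low_Cons_snoc:
  assumes "Low (insert x A) d f" and x: "x \<notin> A"
  shows "Low A d (\<lambda>w. f (x # w)) \<and> Low A d (\<lambda>w. f (w @ [x])) \<and>
    Low A (d - 1) (\<lambda>w. f (x # w) - f (w @ [x]))"
  using assms(1)
proof (induction rule: Low.induct)
  case zero
  then show ?case by (auto intro: Low_zero)
next
  case (const c)
  then show ?case by (auto intro: Low_zero Low.const)
next
  case (sign a b)
  consider "a = b" | "a = x" "b \<in> A" "a \<noteq> b" | "b = x" "a \<in> A" "a \<noteq> b" | "a \<in> A" "b \<in> A" "a \<noteq> b" 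
    using sign x by auto
  then show ?case
  proof cases
    case 1
    then show ?thesis by (auto intro: Low_zero)
  next
    case 2
    then have e: "\<forall>w\<in>words A. 1 = sg (x # w) a b" "\<forall>w\<in>words A. - 1 = sg (w @ [x]) a b"
      "\<forall>w\<in>words A. 2 = sg (x # w) a b - sg (w @ [x]) a b"
      using x by (auto simp: words_def sg_append sg_notin1)
    show ?thesis
      by (intro conjI Low.cong[OF Low_const e(1)] Low.cong[OF Low_const e(2)]
        Low.cong[OF Low_const e(3)]) auto
  next
    case 3
    then have e: "\<forall>w\<in>words A. - 1 = sg (x # w) a b" "\<forall>w\<in>words A. 1 = sg (w @ [x]) a b"
      "\<forall>w\<in>words A. - 2 = sg (x # w) a b - sg (w @ [x]) a b"
      using x by (auto simp: words_def sg_append sg_notin2)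
    show ?thesis
      by (intro conjI Low.cong[OF Low_const e(1)] Low.cong[OF Low_const e(2)]
        Low.cong[OF Low_const e(3)]) auto
  next
    case 4
    then have e: "\<forall>w\<in>words A. sg w a b = sg (x # w) a b" "\<forall>w\<in>words A. sg w a b = sg (w @ [x]) a b"
      "\<forall>w\<in>words A. 0 = sg (x # w) a b - sg (w @ [x]) a b"
      using x by (auto simp: words_def sg_append)
    show ?thesis
      by (intro conjI Low.cong[OF Low.sign e(1)] Low.cong[OF Low.sign e(2)]
        Low.cong[OF Low_zero e(3)]) (use 4 in auto)
  qed
next
  case (add d f g)
  have "(\<lambda>w. (f (x # w) + g (x # w)) - (f (w @ [x]) + g (w @ [x]))) =
    (\<lambda>w. (f (x # w) - f (w @ [x])) + (g (x # w) - g (w @ [x])))" by auto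
  then show ?case using add by (auto intro: Low.add)
next
  case (mult d f e g)
  have "(\<lambda>w. f (x # w) * g (x # w) - f (w @ [x]) * g (w @ [x])) =
    (\<lambda>w. f (x # w) * (g (x # w) - g (w @ [x])) + g (w @ [x]) * (f (x # w) - f (w @ [x])))"
    by (auto simp: algebra_simps)
  moreover have "Low A (d + e) (\<lambda>w. f (x # w) * (g (x # w) - g (w @ [x])))"
    by (rule Low_mult_0) (use mult.IH in auto)
  moreover have "Low A (d + e) (\<lambda>w. g (w @ [x]) * (f (x # w) - f (w @ [x])))"
    unfolding add.commute[of d e] by (rule Low_mult_0) (use mult.IH in auto)
  ultimately have "Low A (d + e) (\<lambda>w. f (x # w) * g (x # w) - f (w @ [x]) * g (w @ [x]))"
    by (simp add: Low.add)
  moreover have "Low A (Suc (d + e)) (\<lambda>w. f (x # w) * g (x # w))"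
    "Low A (Suc (d + e)) (\<lambda>w. f (w @ [x]) * g (w @ [x]))"
    by (rule Low.mult; use mult.IH in blast)+
  ultimately show ?case by simp
next
  case (weaken d f)
  have "Low A d (\<lambda>w. f (x # w) - f (w @ [x]))"
    using weaken.IH Low_mono[of A "d - 1" _ d] by (meson diff_le_self)
  then show ?case using weaken.IH Low.weaken by auto
next
  case (cong d f g)
  have e: "\<forall>w\<in>words A. f (x # w) = g (x # w)" "\<forall>w\<in>words A. f (w @ [x]) = g (w @ [x])"
    using cong words_Cons[OF x] words_snoc[OF x] by auto
  then have e3: "\<forall>w\<in>words A. f (x # w) - f (w @ [x]) = g (x # w) - g (w @ [x])"
    by simp
  show ?case
    using Low.cong[OF _ e(1), of d] Low.cong[OF _ e(2), of d] Low.cong[OF _ e3, of "d - 1"] cong.IH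
    by blast
qed

text \<open>A Lie polynomial of degree \<open>m\<close> annihilates the functions of filtration degree below \<open>m - 1\<close>,
  because bracketing with a letter lowers the degree.\<close>

lemma lie_Low:
  "distinct xs \<Longrightarrow> Low (set xs) d f \<Longrightarrow> d < length xs \<Longrightarrow> lie xs f = 0"
proof (induction xs arbitrary: d f)
  case (Cons x xs)
  show ?case
  proof (cases "xs = []")
    case True
    then have "d = 0" using Cons by simp
    then show ?thesis using Low_0[of "{x}" d f "[x]"] Cons.prems True by (auto simp: words_def)
  next
    case False
    have L: "Low (set xs) (d - 1) (\<lambda>w. f (x # w) - f (w @ [x]))"
      using Low_Cons_snoc[of x "set xs" d f] Cons.prems by auto
    have "lie xs (\<lambda>w. f (x # w) - f (w @ [x])) = 0"
      by (rule Cons.IH[OF _ L]) (use Cons.prems False in \<open>auto simp: neq_Nil_conv\<close>)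
    then show ?thesis using False by (simp add: lie_Cons)
  qed
qed auto

section \<open>Rotating words and the functions Q\<close>

text \<open>The chosen letter is put last, not first, because \<open>Q\<close> keeps the last letter
  outside the bracket.\<close>

definition rot_to :: "'a \<Rightarrow> 'a list \<Rightarrow> 'a list" where
  "rot_to j l = tl (dropWhile (\<lambda>x. x \<noteq> j) l) @ takeWhile (\<lambda>x. x \<noteq> j) l @ [j]"

lemma rot_to_eq: "j \<notin> set p \<Longrightarrow> rot_to j (p @ j # q) = q @ p @ [j]"
proof -
  assume j: "j \<notin> set p"
  have "dropWhile (\<lambda>x. x \<noteq> j) (p @ j # q) = j # q" "takeWhile (\<lambda>x. x \<noteq> j) (p @ j # q) = p"
    using j by (induction p) auto
  then show ?thesis by (simp add: rot_to_def)
qed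

lemma words_split:
  assumes "l \<in> words A" "j \<in> A"
  obtains p q where "l = p @ j # q" "j \<notin> set p" "j \<notin> set q" "set p \<inter> set q = {}"
    "distinct p" "distinct q" "A = insert j (set p \<union> set q)"
proof -
  obtain p q where "l = p @ j # q" using assms by (metis (mono_tags, lifting) in_set_conv_decomp mem_Collect_eq words_def)
  then show ?thesis using that assms by (auto simp: words_def)
qed

lemma finite_words [simp]: "finite A \<Longrightarrow> finite (words A)"
  by (rule finite_subset[of _ "{l. set l \<subseteq> A \<and> distinct l}"])
    (auto simp: words_def intro: finite_subset_distinct)

lemma rot_to_words: "l \<in> words A \<Longrightarrow> j \<in> A \<Longrightarrow> rot_to j l \<in> words A"
  by (erule (1) words_split) (auto simp: rot_to_eq words_def)

lemma last_rot_to [simp]: "last (rot_to j l) = j"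
  by (simp add: rot_to_def)

lemma rot_to_rot_to:
  assumes "v \<in> words A" "z \<in> A" "j \<in> A" "last v = j"
  shows "rot_to j (rot_to z v) = v"
proof -
  obtain p q where v: "v = p @ z # q" "z \<notin> set p" "z \<notin> set q" "set p \<inter> set q = {}"
    "distinct p" "distinct q" "A = insert z (set p \<union> set q)"
    using words_split[OF assms(1,2)] by metis
  show ?thesis
  proof (cases q rule: rev_cases)
    case Nil
    then show ?thesis using v assms rot_to_eq[of z p "[]"] by auto
  next
    case (snoc q' x)
    then have "x = j" using v assms by auto
    have "j \<notin> set q'" using v snoc \<open>x = j\<close> by auto
    then show ?thesis using v snoc \<open>x = j\<close> rot_to_eq[of z p q] rot_to_eq[of j q' "p @ [z]"] by simp
  qed
qed

lemma rot_to_rotate1: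
  assumes "l \<in> words A" "j \<in> A"
  shows "rot_to j (rotate1 l) = rot_to j l"
proof -
  obtain p q where v: "l = p @ j # q" "j \<notin> set p" "j \<notin> set q"
    using words_split[OF assms] by metis
  show ?thesis
  proof (cases p)
    case Nil
    then show ?thesis using v rot_to_eq[of j "[]" q] rot_to_eq[of j q "[]"] by simp
  next
    case (Cons a p')
    then show ?thesis using v rot_to_eq[of j p q] rot_to_eq[of j p' "q @ [a]"] by simp
  qed
qed

lemma rot_to_map: "inj g \<Longrightarrow> rot_to (g j) (map g l) = map g (rot_to j l)"
  by (simp add: rot_to_def dropWhile_map takeWhile_map comp_def inj_eq map_tl)

text \<open>The right side is the orientation, 1 or -1, of the three letters in the cyclic word;
  cutting the cycle after \<open>j\<close> turns it into a linear comparison. The same expression is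
  the value of a word functional on a triangle.\<close>

lemma sg_rot_to:
  assumes "l \<in> words A" "a \<in> A" "b \<in> A" "j \<in> A" "a \<noteq> j" "b \<noteq> j" "a \<noteq> b"
  shows "sg (rot_to j l) a b = sg l a b + sg l b j + sg l j a"
proof -
  obtain p q where v: "l = p @ j # q" "j \<notin> set p" "j \<notin> set q" "set p \<inter> set q = {}"
    "A = insert j (set p \<union> set q)"
    using words_split[OF assms(1,4)] by metis
  have "rot_to j l = q @ p @ [j]" using v by (simp add: rot_to_eq)
  moreover have "(a \<in> set p \<or> a \<in> set q)" "(b \<in> set p \<or> b \<in> set q)" using assms v by auto
  ultimately show ?thesis using v assms(5-)
    by (elim disjE) (auto simp: sg_append sg_notin1 sg_notin2 disjoint_iff)
qed

text \<open>\<open>Q l x\<close> is the coefficient of the cyclic word \<open>l\<close> in the bracket of the letters of \<open>x\<close> but the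
  last, followed by the last letter of \<open>x\<close>.\<close>

definition Q :: "'a list \<Rightarrow> 'a list \<Rightarrow> complex" where
  "Q l x = lie (butlast x) (\<lambda>y. of_bool (rot_to (last x) l = y @ [last x]))"

lemma Q_map: "inj g \<Longrightarrow> x \<noteq> [] \<Longrightarrow> Q (map g l) (map g x) = Q l x"
proof -
  assume g: "inj g" and x: "x \<noteq> []"
  have "(\<lambda>w. of_bool (map g (rot_to (last x) l) = map g w @ [g (last x)]) :: complex)
     = (\<lambda>w. of_bool (rot_to (last x) l = w @ [last x]))"
  proof
    fix w
    have "map g (rot_to (last x) l) = map g w @ [g (last x)] \<longleftrightarrow> map g (rot_to (last x) l) = map g (w @ [last x])"
      by simp
    also have "\<dots> \<longleftrightarrow> rot_to (last x) l = w @ [last x]" by (rule inj_map_eq_map[OF g])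
    finally show "(of_bool (map g (rot_to (last x) l) = map g w @ [g (last x)]) :: complex)
      = of_bool (rot_to (last x) l = w @ [last x])" by simp
  qed
  then show ?thesis using g x
    by (simp add: Q_def last_map map_butlast[symmetric] lie_map rot_to_map)
qed

lemma words_last_in: "x \<in> words A \<Longrightarrow> A \<noteq> {} \<Longrightarrow> last x \<in> A"
  using last_in_set[of x] by (auto simp: words_def)

lemma words_butlast:
  assumes "x \<in> words A" "A \<noteq> {}"
  shows "butlast x \<in> words (A - {last x})"
proof -
  have "x \<noteq> []" using assms by (auto simp: words_def)
  then obtain p z where "x = p @ [z]" by (cases x rule: rev_cases) auto
  then show ?thesis using assms by (auto simp: words_def)
qed

lemma Q_rotate1: "l \<in> words A \<Longrightarrow> x \<in> words A \<Longrightarrow> A \<noteq> {} \<Longrightarrow> Q (rotate1 l) x = Q l x"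
  by (simp add: Q_def rot_to_rotate1 words_last_in)

lemma Q_rot_to: "l \<in> words A \<Longrightarrow> x \<in> words A \<Longrightarrow> j \<in> A \<Longrightarrow> Q (rot_to j l) x = Q l x"
proof -
  assume l: "l \<in> words A" and x: "x \<in> words A" and j: "j \<in> A"
  obtain p q where v: "l = p @ j # q" "j \<notin> set p" using words_split[OF l j] by metis
  have "Q (rotate k l) x = Q l x" for k
  proof (induction k)
    case (Suc k)
    have "rotate k l \<in> words A" using l by (auto simp: words_def)
    then show ?case using Suc Q_rotate1[of "rotate k l" A x] x j by auto
  qed simp
  moreover have "rot_to j l = rotate (length (p @ [j])) l"
    using v rotate_append[of "p @ [j]" q] by (simp add: rot_to_eq)
  ultimately show ?thesis by metis
qed

text \<open>Both words end in \<open>y\<close>, so no rotation takes place, and \<open>z\<close> is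
  innermost in the bracket. This provides dual evaluation points for (n-2)! of the functions
  \<open>Q\<close>.\<close>

lemma Q_indicator:
  "z \<notin> set xs \<Longrightarrow> y \<notin> set (xs @ [z]) \<Longrightarrow> y \<notin> set (ls @ [z]) \<Longrightarrow>
    Q (ls @ [z, y]) (xs @ [z, y]) = of_bool (xs = ls)"
  using rot_to_eq[of y "ls @ [z]" "[]"] lie_indicator[of z xs ls]
  by (simp add: Q_def butlast_append eq_commute[of "ls @ [z]"])

lemma Low_sg_snoc:
  assumes "z \<in> A" "a \<in> A" "b \<in> A"
  shows "Low (A - {z}) (Suc (Suc 0)) (\<lambda>y. sg (y @ [z]) a b)"
  using Low_Cons_snoc[of z "A - {z}" "Suc (Suc 0)" "\<lambda>l. sg l a b"] Low.sign[of a A b] assms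
  by (simp add: insert_absorb)

lemma words_snoc': "z \<in> A \<Longrightarrow> y \<in> words (A - {z}) \<Longrightarrow> y @ [z] \<in> words A"
  by (auto simp: words_def)

text \<open>By \<open>sg_rot_to\<close> the comparison after rotation is an affine function of three
  signs of the unrotated word: cutting the cyclic word at \<open>j\<close> instead of
  \<open>z\<close> keeps the degree one.\<close>

lemma Low_before:
  assumes "a \<in> A" "b \<in> A" "a \<noteq> j" "b \<noteq> j" "a \<noteq> b" "j \<in> A" "z \<in> A"
  shows "Low (A - {z}) (Suc (Suc 0)) (\<lambda>y. of_bool (sg (rot_to j (y @ [z])) a b = 1))"
proof (rule Low.cong)
  let ?f = "\<lambda>y. (1/2) * (1 + (sg (y @ [z]) a b + sg (y @ [z]) b j + sg (y @ [z]) j a))"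
  show "Low (A - {z}) (Suc (Suc 0)) ?f"
    by (intro Low_scale Low.add Low_sg_snoc Low_const assms) auto
  show "\<forall>y\<in>words (A - {z}). ?f y = of_bool (sg (rot_to j (y @ [z])) a b = 1)"
  proof
    fix y assume "y \<in> words (A - {z})"
    then have w: "y @ [z] \<in> words A" using assms words_snoc' by metis
    have r: "rot_to j (y @ [z]) \<in> words A" using rot_to_words w assms by metis
    have "sg (rot_to j (y @ [z])) a b = 1 \<or> sg (rot_to j (y @ [z])) a b = - 1"
      by (rule sg_cases) (use r assms in \<open>auto simp: words_def\<close>)
    then show "?f y = of_bool (sg (rot_to j (y @ [z])) a b = 1)"
      unfolding sg_rot_to[OF w assms(1,2,6,3,4,5), symmetric] by auto
  qed
qed

text \<open>Summing over the words ending in \<open>j\<close> amounts to evaluating the weight at the rotation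
  of the argument of the Lie polynomial.\<close>

lemma sum_Q_Low:
  assumes fin: "finite A" and x: "x \<in> words A" and j: "j \<in> A"
    and L: "Low (A - {last x}) d (\<lambda>y. \<beta> (rot_to j (y @ [last x])))"
    and d: "d + 2 \<le> card A"
  shows "(\<Sum>v | v \<in> words A \<and> last v = j. \<beta> v * Q v x) = 0"
proof -
  let ?z = "last x" and ?W = "{v. v \<in> words A \<and> last v = j}"
  have z: "?z \<in> A" using words_last_in[OF x] j by auto
  have xb: "butlast x \<in> words (A - {?z})" using words_butlast[OF x] j by auto
  have "(\<Sum>v\<in>?W. \<beta> v * Q v x) = (\<Sum>v\<in>?W. lie (butlast x) (\<lambda>y. \<beta> v * of_bool (rot_to ?z v = y @ [?z])))"
    by (simp add: Q_def lie_scale)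
  also have "\<dots> = lie (butlast x) (\<lambda>y. \<Sum>v\<in>?W. \<beta> v * of_bool (rot_to ?z v = y @ [?z]))"
    by (rule lie_sum[symmetric])
  also have "\<dots> = lie (butlast x) (\<lambda>y. \<beta> (rot_to j (y @ [?z])))"
  proof (rule lie_cong)
    show "distinct (butlast x)" using xb by (simp add: words_def)
    fix y assume "y \<in> words (set (butlast x))"
    then have y: "y \<in> words (A - {?z})" using xb by (simp add: words_def)
    then have yz: "y @ [?z] \<in> words A" using words_snoc' z by metis
    have eq: "rot_to ?z v = y @ [?z] \<longleftrightarrow> v = rot_to j (y @ [?z])" if "v \<in> ?W" for v
      using that rot_to_rot_to[of v A ?z j] rot_to_rot_to[OF yz j z] z j by auto
    have "(\<Sum>v\<in>?W. \<beta> v * of_bool (rot_to ?z v = y @ [?z])) =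
      (\<Sum>v\<in>?W. if v = rot_to j (y @ [?z]) then \<beta> v else 0)"
      by (rule sum.cong) (auto simp: eq)
    also have "\<dots> = \<beta> (rot_to j (y @ [?z]))"
      using rot_to_words[OF yz j] fin by (subst sum.delta) auto
    finally show "(\<Sum>v\<in>?W. \<beta> v * of_bool (rot_to ?z v = y @ [?z])) = \<beta> (rot_to j (y @ [?z]))" .
  qed
  also have "\<dots> = 0"
  proof (rule lie_Low)
    show "Low (set (butlast x)) d (\<lambda>y. \<beta> (rot_to j (y @ [?z])))" using L xb by (simp add: words_def)
    have "length (butlast x) = card A - 1"
      using x fin distinct_card[of x] by (auto simp: words_def)
    then show "d < length (butlast x)" using d by simp
  qed (use xb in \<open>simp add: words_def\<close>)
  finally show ?thesis .
qed

section \<open>Klyachko's identity\<close>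

definition before :: "'a \<Rightarrow> 'a \<Rightarrow> 'a list \<Rightarrow> complex" where
  "before a b l = of_bool (sg l a b = 1)"

text \<open>The power of \<open>w\<close> whose exponent is the major index of the inverse
  permutation: \<open>i\<close> is counted when \<open>Suc i\<close> comes before it. For a
  primitive root of unity these are, up to a scalar, the coefficients of Klyachko's
  idempotent.\<close>

definition klyachko :: "complex \<Rightarrow> nat \<Rightarrow> nat list \<Rightarrow> complex" where
  "klyachko w m l = (\<Prod>i\<in>{1..<m}. if sg l i (Suc i) = 1 then 1 else w ^ i)"

text \<open>In the expansion of the product over subsets of \<open>{1..<m}\<close> only the full subset survives.\<close>

lemma klyachko_expand:
  fixes d :: "nat list \<Rightarrow> complex"
  assumes "finite W"
    and van: "\<And>E. E \<subset> {1..<m} \<Longrightarrow> (\<Sum>l\<in>W. (\<Prod>i\<in>E. before i (Suc i) l) * d l) = 0"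
  shows "(\<Sum>l\<in>W. klyachko w m l * d l) =
    (\<Prod>i\<in>{1..<m}. 1 - w ^ i) * (\<Sum>l\<in>W. (\<Prod>i\<in>{1..<m}. before i (Suc i) l) * d l)"
proof -
  let ?I = "{1..<m}"
  let ?c = "\<lambda>E. (\<Prod>i\<in>E. 1 - w ^ i) * (\<Prod>i\<in>?I - E. w ^ i)"
  have "klyachko w m l = (\<Sum>E\<in>Pow ?I. ?c E * (\<Prod>i\<in>E. before i (Suc i) l))" for l
  proof -
    have "klyachko w m l = (\<Prod>i\<in>?I. (1 - w ^ i) * before i (Suc i) l + w ^ i)"
      unfolding klyachko_def by (rule prod.cong) (auto simp: before_def)
    also have "\<dots> = (\<Sum>E\<in>Pow ?I. (\<Prod>i\<in>E. (1 - w ^ i) * before i (Suc i) l) * (\<Prod>i\<in>?I - E. w ^ i))"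
      by (rule prod_add) simp
    also have "\<dots> = (\<Sum>E\<in>Pow ?I. ?c E * (\<Prod>i\<in>E. before i (Suc i) l))"
      by (rule sum.cong) (auto simp: prod.distrib mult_ac)
    finally show ?thesis .
  qed
  then have "(\<Sum>l\<in>W. klyachko w m l * d l) =
      (\<Sum>l\<in>W. \<Sum>E\<in>Pow ?I. ?c E * ((\<Prod>i\<in>E. before i (Suc i) l) * d l))"
    by (simp only: sum_distrib_right mult.assoc)
  also have "\<dots> = (\<Sum>E\<in>Pow ?I. \<Sum>l\<in>W. ?c E * ((\<Prod>i\<in>E. before i (Suc i) l) * d l))"
    by (rule sum.swap)
  also have "\<dots> = (\<Sum>E\<in>Pow ?I. ?c E * (\<Sum>l\<in>W. (\<Prod>i\<in>E. before i (Suc i) l) * d l))"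
    by (simp add: sum_distrib_left)
  also have "\<dots> = (\<Sum>E\<in>{?I}. ?c E * (\<Sum>l\<in>W. (\<Prod>i\<in>E. before i (Suc i) l) * d l))"
    by (rule sum.mono_neutral_right) (use van in auto)
  finally show ?thesis by simp
qed

text \<open>Moving the first letter \<open>a\<close> to the end changes only its comparisons with
  \<open>a - 1\<close> and \<open>a + 1\<close>: the factor \<open>w ^ (a - 1)\<close> disappears
  and \<open>w ^ a\<close> appears. At the ends of the alphabet one of them is absent; for
  \<open>a = m\<close> this is where \<open>w ^ m = 1\<close> enters.\<close>

lemma klyachko_rotate1:
  assumes "l \<in> words {1..m}" "w ^ m = 1" "w \<noteq> 0" "m \<ge> 1"
  shows "klyachko w m (rotate1 l) = w * klyachko w m l"
proof -
  obtain a l' where l: "l = a # l'" using assms by (cases l) (auto simp: words_def)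
  have "set l = {1..m}" "distinct l" using assms by (auto simp: words_def)
  then have sl: "insert a (set l') = {1..m}" and a3: "a \<notin> set l'" using l by auto
  have "a \<in> {1..m}" unfolding sl[symmetric] by simp
  moreover have "i = a \<or> i \<in> set l'" if "1 \<le> i" "i \<le> m" for i
  proof -
    have "i \<in> insert a (set l')" unfolding sl using that by simp
    then show ?thesis by simp
  qed
  ultimately have a: "1 \<le> a" "a \<le> m" "a \<notin> set l'" "\<And>i. 1 \<le> i \<Longrightarrow> i \<le> m \<Longrightarrow> i = a \<or> i \<in> set l'"
    using a3 by auto
  let ?I = "{1..<m}"
  let ?k = "\<lambda>l i. if sg l i (Suc i) = 1 then 1 else w ^ i"
  have f: "?k (rotate1 l) i * (if Suc i = a then w ^ i else 1) = ?k l i * (if i = a then w ^ i else 1)"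
    if "i \<in> ?I" for i
  proof -
    have "i = a \<or> i \<in> set l'" "Suc i = a \<or> Suc i \<in> set l'" using a(4)[of i] a(4)[of "Suc i"] that by auto
    then show ?thesis using l a(3) by (auto simp: sg_append sg_notin1 sg_notin2)
  qed
  have d1: "(\<Prod>i\<in>?I. if Suc i = a then w ^ i else 1) = w ^ (a - 1)"
  proof (cases "a = 1")
    case True
    then show ?thesis by (intro prod.neutral[THEN trans]) auto
  next
    case False
    have "(\<Prod>i\<in>?I. if Suc i = a then w ^ i else 1) = (\<Prod>i\<in>?I. if i = a - 1 then w ^ i else 1)"
      using a by (intro prod.cong) auto
    also have "\<dots> = w ^ (a - 1)" using False a by (subst prod.delta) auto
    finally show ?thesis .
  qed
  have d2: "(\<Prod>i\<in>?I. if i = a then w ^ i else 1) = w ^ a"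
    using a assms(2) by (subst prod.delta) (auto simp: not_less)
  have "klyachko w m (rotate1 l) * w ^ (a - 1) = klyachko w m l * w ^ a"
    unfolding klyachko_def d1[symmetric] d2[symmetric] prod.distrib[symmetric]
    by (rule prod.cong[OF refl f])
  also have "w ^ a = w * w ^ (a - 1)" using a by (metis Suc_pred' less_eq_Suc_le One_nat_def power_Suc)
  finally show ?thesis using assms(3) by (simp add: mult_ac)
qed

section \<open>Klyachko's identity paired with the functions \<open>Q\<close>\<close>

locale braid_words =
  fixes n :: nat
  assumes n3: "n \<ge> 3"
begin

abbreviation "A \<equiv> {1..n}"
abbreviation "W \<equiv> words A"
abbreviation "idw \<equiv> [1..<Suc n]"

lemma idw_W: "idw \<in> W"
  by (auto simp: words_def simp del: upt_Suc)

lemma W_ne: "l \<in> W \<Longrightarrow> l \<noteq> []"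
  using n3 by (auto simp: words_def)

lemma W_length: "l \<in> W \<Longrightarrow> length l = n"
  using distinct_card[of l] by (auto simp: words_def)

text \<open>Factors with index in \<open>C\<close> are constant on words ending in \<open>j\<close>;
  the others compare two letters different from \<open>j\<close> and have degree one each. With at
  most n - 3 of these the weight stays below the degree that a Lie polynomial in n - 1 letters
  detects.\<close>

lemma sum_Q_before:
  assumes x: "x \<in> W" and j: "j \<in> A"
    and E: "finite E" "card (E - C) + 3 \<le> n"
    and C: "\<And>i y. i \<in> C \<Longrightarrow> y \<in> W \<Longrightarrow> last y = j \<Longrightarrow> f i y = c i"
    and B: "\<And>i. i \<in> E - C \<Longrightarrow> \<exists>a b. a \<in> A \<and> b \<in> A \<and> a \<noteq> j \<and> b \<noteq> j \<and> a \<noteq> b \<and>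
              (\<forall>y\<in>W. last y = j \<longrightarrow> f i y = before a b y)"
  shows "(\<Sum>v | v \<in> W \<and> last v = j. (\<Prod>i\<in>E. f i v) * Q v x) = 0"
proof (rule sum_Q_Low[OF _ x j, where d = "Suc (card (E - C))"])
  let ?z = "last x"
  have z: "?z \<in> A" using words_last_in[OF x] j by (metis empty_iff)
  have rw: "rot_to j (y @ [?z]) \<in> W" if "y \<in> words (A - {?z})" for y
    by (rule rot_to_words[OF words_snoc'[OF z that] j])
  have "Low (A - {?z}) (Suc (\<Sum>i\<in>E. of_bool (i \<notin> C))) (\<lambda>y. \<Prod>i\<in>E. f i (rot_to j (y @ [?z])))"
  proof (rule Low_prod[OF E(1)])
    fix i assume i: "i \<in> E"
    show "Low (A - {?z}) (Suc (of_bool (i \<notin> C))) (\<lambda>y. f i (rot_to j (y @ [?z])))"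
    proof (cases "i \<in> C")
      case True
      then have "\<forall>y\<in>words (A - {?z}). c i = f i (rot_to j (y @ [?z]))"
        using C rw by simp
      from Low.cong[OF Low.const this] show ?thesis using True by simp
    next
      case False
      then obtain a b where ab: "a \<in> A" "b \<in> A" "a \<noteq> j" "b \<noteq> j" "a \<noteq> b"
        "\<forall>y\<in>W. last y = j \<longrightarrow> f i y = before a b y" using B i by blast
      have "Low (A - {?z}) (Suc (Suc 0)) (\<lambda>y. f i (rot_to j (y @ [?z])))"
        by (rule Low.cong[OF Low_before[OF ab(1-5) j z]]) (use ab(6) rw in \<open>auto simp: before_def\<close>)
      then show ?thesis using False by simp
    qed
  qed
  also have "(\<Sum>i\<in>E. of_bool (i \<notin> C)) = card (E - C)"
    using E(1) by (simp add: sum.If_cases of_bool_def Int_def set_diff_eq)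
  finally show "Low (A - {?z}) (Suc (card (E - C))) (\<lambda>y. \<Prod>i\<in>E. f i (rot_to j (y @ [?z])))" .
qed (use E in auto)

lemma prod_before: "finite E \<Longrightarrow> (\<Prod>i\<in>E. before (f i) (g i) l) = of_bool (\<forall>i\<in>E. sg l (f i) (g i) = 1)"
  by (induction E rule: finite_induct) (auto simp: before_def)

lemma all_before_iff:
  assumes "v \<in> W"
  shows "(\<forall>i\<in>{1..<n}. sg v i (Suc i) = 1) \<longleftrightarrow> v = idw"
proof -
  have "(\<forall>i. Suc i < length idw \<longrightarrow> sg v (idw ! i) (idw ! Suc i) = 1)
    \<longleftrightarrow> (\<forall>i. Suc i < n \<longrightarrow> sg v (Suc i) (Suc (Suc i)) = 1)" by (auto simp del: upt_Suc)
  also have "\<dots> \<longleftrightarrow> (\<forall>i\<in>{1..<n}. sg v i (Suc i) = 1)"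
    by (auto simp: Ball_def) (metis Suc_le_D One_nat_def)
  finally show ?thesis using word_eq_iff_consecutive[OF assms idw_W] by simp
qed

lemma sg_last: "l \<in> W \<Longrightarrow> last l = j \<Longrightarrow> a \<in> A \<Longrightarrow> a \<noteq> j \<Longrightarrow> sg l a j = 1"
proof -
  assume a: "l \<in> W" "last l = j" "a \<in> A" "a \<noteq> j"
  then obtain p where p: "l = p @ [j]" using W_ne append_butlast_last_id by metis
  have "a \<in> set l" "distinct l" using a by (simp_all add: words_def)
  then show ?thesis using p a(4) by (auto simp: sg_append sg_notin2)
qed

text \<open>The weight compares only the letters below \<open>n\<close>, so all n - 2 comparisons
  count for the degree. A proper subset has at most n - 3 of them, which is just what
  \<open>sum_Q_before\<close> allows, and the full set singles out the identity word.\<close>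

lemma klyachko_short:
  assumes x: "x \<in> W"
  shows "(\<Sum>v | v \<in> W \<and> last v = n. klyachko w (n - 1) v * Q v x) =
    (\<Prod>i\<in>{1..<n - 1}. 1 - w ^ i) * Q idw x"
proof -
  let ?W = "{v. v \<in> W \<and> last v = n}"
  have "(\<Sum>v\<in>?W. klyachko w (n - 1) v * Q v x) =
    (\<Prod>i\<in>{1..<n - 1}. 1 - w ^ i) * (\<Sum>v\<in>?W. (\<Prod>i\<in>{1..<n - 1}. before i (Suc i) v) * Q v x)"
  proof (rule klyachko_expand)
    fix E assume E: "E \<subset> {1..<n - 1}"
    then have "card E < card {1..<n - 1}" by (intro psubset_card_mono) auto
    then have c: "card (E - {}) + 3 \<le> n" by simp
    show "(\<Sum>l\<in>?W. (\<Prod>i\<in>E. before i (Suc i) l) * Q l x) = 0"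
    proof (rule sum_Q_before[OF x _ _ c])
      fix i assume "i \<in> E - {}"
      then have "i \<in> {1..<n - 1}" using E by blast
      then have "i \<in> A" "Suc i \<in> A" "i \<noteq> n" "Suc i \<noteq> n" by auto
      then show "\<exists>a b. a \<in> A \<and> b \<in> A \<and> a \<noteq> n \<and> b \<noteq> n \<and> a \<noteq> b \<and>
          (\<forall>y\<in>W. last y = n \<longrightarrow> before i (Suc i) y = before a b y)"
        by (intro exI[of _ i] exI[of _ "Suc i"]) simp
    next
      show "n \<in> A" using n3 by simp
      show "finite E" using E finite_subset by blast
    qed simp
  qed auto
  also have "(\<Sum>v\<in>?W. (\<Prod>i\<in>{1..<n - 1}. before i (Suc i) v) * Q v x) = (\<Sum>v\<in>?W. if v = idw then Q v x else 0)"
  proof (rule sum.cong)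
    fix v assume v: "v \<in> ?W"
    \<comment> \<open>The weight omits the comparison of \<open>n - 1\<close> with \<open>n\<close>,
      but it holds automatically because \<open>n\<close> is last.\<close>
    have "(\<forall>i\<in>{1..<n - 1}. sg v i (Suc i) = 1) \<longleftrightarrow> (\<forall>i\<in>{1..<n}. sg v i (Suc i) = 1)"
    proof (intro iffI ballI)
      fix i assume a: "\<forall>i\<in>{1..<n - 1}. sg v i (Suc i) = 1" "i \<in> {1..<n}"
      show "sg v i (Suc i) = 1"
      proof (cases "Suc i = n")
        case True
        then show ?thesis using sg_last[of v n i] v a by auto
      qed (use a in auto)
    qed auto
    then show "(\<Prod>i\<in>{1..<n - 1}. before i (Suc i) v) * Q v x = (if v = idw then Q v x else 0)"
      using all_before_iff v by (auto simp: prod_before simp del: upt_Suc)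
  qed auto
  also have "\<dots> = Q idw x" using idw_W n3 by (subst sum.delta) auto
  finally show ?thesis .
qed

text \<open>Rotation by one letter matches the two sets of words and leaves \<open>Q\<close>
  unchanged, so only the weight has to be transported.\<close>

lemma sum_hd_eq_sum_last:
  assumes x: "x \<in> W"
  shows "(\<Sum>v | v \<in> W \<and> hd v = j. \<beta> v * Q v x) =
    (\<Sum>v | v \<in> W \<and> last v = j. \<beta> (last v # butlast v) * Q v x)"
proof (rule sum.reindex_bij_witness[where i = "\<lambda>v. last v # butlast v" and j = rotate1])
  fix v assume v: "v \<in> {v. v \<in> W \<and> hd v = j}"
  then obtain r where r: "v = j # r" using W_ne by (cases v) auto
  show "last (rotate1 v) # butlast (rotate1 v) = v" using r by simp
  show "rotate1 v \<in> {v. v \<in> W \<and> last v = j}" using v r by (auto simp: words_def)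
  have "Q (rotate1 v) x = Q v x" using v x n3 by (intro Q_rotate1) auto
  then show "\<beta> (last (rotate1 v) # butlast (rotate1 v)) * Q (rotate1 v) x = \<beta> v * Q v x"
    using r by simp
next
  fix v assume v: "v \<in> {v. v \<in> W \<and> last v = j}"
  then obtain r where r: "v = r @ [j]" using W_ne append_butlast_last_id by (metis (mono_tags, lifting) mem_Collect_eq)
  show "rotate1 (last v # butlast v) = v" using r by simp
  show "last v # butlast v \<in> {v. v \<in> W \<and> hd v = j}" using v r by (auto simp: words_def)
qed

text \<open>If no comparison in \<open>E\<close> involves \<open>j\<close>, moving \<open>j\<close>
  from the end to the front does not affect the weight. Otherwise some factor is constant on both
  sides; of the at most n - 2 factors at most n - 3 keep positive degree, and both sums
  vanish.\<close>

lemma sum_last_eq_sum_hd: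
  assumes x: "x \<in> W" and j: "j \<in> A" and E: "E \<subset> {1..<n}"
  shows "(\<Sum>v | v \<in> W \<and> last v = j. (\<Prod>i\<in>E. before i (Suc i) v) * Q v x) =
    (\<Sum>v | v \<in> W \<and> hd v = j. (\<Prod>i\<in>E. before i (Suc i) v) * Q v x)"
proof -
  define C where "C = {i \<in> {1..<n}. i = j \<or> Suc i = j}"
  let ?\<beta> = "\<lambda>v. \<Prod>i\<in>E. before i (Suc i) v"
  have fin: "finite E" using E by (auto intro: finite_subset)
  have cE: "card E < n - 1" using psubset_card_mono[OF _ E] by simp
  have same: "before i (Suc i) (last y # butlast y) = before i (Suc i) y"
    if "i \<in> E - C" "y \<in> W" "last y = j" for i y
  proof -
    have r: "y = butlast y @ [j]" using append_butlast_last_id[OF W_ne[OF that(2)]] that(3) by simp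
    have "i \<in> {1..<n}" using E that by blast
    then have i: "i \<noteq> j" "Suc i \<noteq> j" "i \<in> A" using that by (auto simp: C_def)
    then have "i \<in> set y" using that by (simp add: words_def)
    then have "i \<in> set (butlast y @ [j])" using r by simp
    then have "sg (butlast y @ [j]) i (Suc i) = sg (last y # butlast y) i (Suc i)"
      using i that(3) by (auto simp: sg_append)
    then show ?thesis using r by (simp add: before_def)
  qed
  show ?thesis
  proof (cases "E \<inter> C = {}")
    case True
    have "(\<Prod>i\<in>E. before i (Suc i) (last v # butlast v)) = ?\<beta> v" if "v \<in> W" "last v = j" for v
      using True that by (intro prod.cong same) auto
    then show ?thesis unfolding sum_hd_eq_sum_last[OF x] by (intro sum.cong) auto
  next
    case False
    have "E - C \<subset> E" using False by auto
    then have "card (E - C) < card E" using fin by (rule psubset_card_mono[rotated])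
    then have c3: "card (E - C) + 3 \<le> n" using cE by simp
    have E': "a \<in> A" "Suc a \<in> A" "a \<noteq> j" "Suc a \<noteq> j" if a: "a \<in> E - C" for a
    proof -
      have "a \<in> {1..<n}" using E a by blast
      then show "a \<in> A" "Suc a \<in> A" "a \<noteq> j" "Suc a \<noteq> j" using a by (auto simp: C_def)
    qed
    have "(\<Sum>v | v \<in> W \<and> last v = j. ?\<beta> v * Q v x) = 0"
    \<comment> \<open>With \<open>j\<close> at the end every other letter precedes it, so the
      comparison fails for \<open>i = j\<close> and holds for \<open>Suc i = j\<close>. With
      \<open>j\<close> in front it is the reverse.\<close>
    proof (rule sum_Q_before[OF x j fin c3, where c = "\<lambda>i. of_bool (i \<noteq> j)"])
      fix i y assume i: "i \<in> C" "y \<in> W" "last y = j"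
      show "before i (Suc i) y = of_bool (i \<noteq> j)"
      proof (cases "i = j")
        case True
        then show ?thesis using sg_last[of y j "Suc i"] i sg_antisym[of y i "Suc i"]
          by (simp add: before_def C_def)
      next
        case False
        then show ?thesis using sg_last[of y j i] i by (simp add: before_def C_def)
      qed
    next
      fix i assume "i \<in> E - C"
      from E'[OF this] show "\<exists>a b. a \<in> A \<and> b \<in> A \<and> a \<noteq> j \<and> b \<noteq> j \<and> a \<noteq> b \<and>
          (\<forall>y\<in>W. last y = j \<longrightarrow> before i (Suc i) y = before a b y)"
        by (intro exI[of _ i] exI[of _ "Suc i"]) simp
    qed
    moreover have "(\<Sum>v | v \<in> W \<and> last v = j. ?\<beta> (last v # butlast v) * Q v x) = 0"
    proof (rule sum_Q_before[OF x j fin c3, where c = "\<lambda>i. of_bool (i = j)"])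
      fix i y assume i: "i \<in> C" "y \<in> W" "last y = j"
      show "before i (Suc i) (last y # butlast y) = of_bool (i = j)"
        using i by (auto simp add: before_def C_def)
    next
      fix i assume i: "i \<in> E - C"
      from E'[OF i] same[OF i] show "\<exists>a b. a \<in> A \<and> b \<in> A \<and> a \<noteq> j \<and> b \<noteq> j \<and> a \<noteq> b \<and>
          (\<forall>y\<in>W. last y = j \<longrightarrow> before i (Suc i) (last y # butlast y) = before a b y)"
        by (intro exI[of _ i] exI[of _ "Suc i"]) simp
    qed
    ultimately show ?thesis unfolding sum_hd_eq_sum_last[OF x] by simp
  qed
qed

text \<open>With all \<open>n\<close> letters a proper subset of comparisons can have n - 2
  elements, one too many for vanishing. Taking the difference between words ending and words
  beginning with \<open>j\<close> cancels these contributions by \<open>sum_last_eq_sum_hd\<close>;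
  what survives is the identity word, with last letter \<open>n\<close> and first letter 1.\<close>

lemma klyachko_long:
  assumes x: "x \<in> W" and j: "j \<in> A"
  shows "(\<Sum>v\<in>W. klyachko w n v * (Q v x * (of_bool (last v = j) - of_bool (hd v = j)))) =
    (\<Prod>i\<in>{1..<n}. 1 - w ^ i) * (Q idw x * (of_bool (n = j) - of_bool (1 = j)))"
proof -
  let ?d = "\<lambda>v. Q v x * (of_bool (last v = j) - of_bool (hd v = j))"
  have "(\<Sum>v\<in>W. klyachko w n v * ?d v) =
    (\<Prod>i\<in>{1..<n}. 1 - w ^ i) * (\<Sum>v\<in>W. (\<Prod>i\<in>{1..<n}. before i (Suc i) v) * ?d v)"
  proof (rule klyachko_expand)
    fix E assume E: "E \<subset> {1..<n}"
    let ?b = "\<lambda>v. (\<Prod>i\<in>E. before i (Suc i) v) * Q v x"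
    have "(\<Sum>v\<in>W. (\<Prod>i\<in>E. before i (Suc i) v) * ?d v) =
      (\<Sum>v\<in>W. (if last v = j then ?b v else 0)) - (\<Sum>v\<in>W. if hd v = j then ?b v else 0)"
      unfolding sum_subtractf[symmetric] by (rule sum.cong) auto
    also have "(\<Sum>v\<in>W. (if last v = j then ?b v else 0)) = (\<Sum>v | v \<in> W \<and> last v = j. ?b v)"
      by (simp add: sum.inter_filter[symmetric])
    also have "(\<Sum>v\<in>W. (if hd v = j then ?b v else 0)) = (\<Sum>v | v \<in> W \<and> hd v = j. ?b v)"
      by (simp add: sum.inter_filter[symmetric])
    finally show "(\<Sum>v\<in>W. (\<Prod>i\<in>E. before i (Suc i) v) * ?d v) = 0"
      using sum_last_eq_sum_hd[OF x j E] by simp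
  qed simp
  also have "(\<Sum>v\<in>W. (\<Prod>i\<in>{1..<n}. before i (Suc i) v) * ?d v) = (\<Sum>v\<in>W. if v = idw then ?d v else 0)"
  proof (rule sum.cong)
    fix v assume v: "v \<in> W"
    show "(\<Prod>i\<in>{1..<n}. before i (Suc i) v) * ?d v = (if v = idw then ?d v else 0)"
      using all_before_iff[OF v] by (simp add: prod_before del: upt_Suc)
  qed auto
  also have "\<dots> = ?d idw" using idw_W by (subst sum.delta) auto
  also have "\<dots> = Q idw x * (of_bool (n = j) - of_bool (1 = j))"
    using n3 by (simp add: last_upt hd_upt del: upt_Suc)
  finally show ?thesis .
qed

end

hide_const (open) Polynomial.smult Multiset.mult up_ring.coeff up_ring.monom

section \<open>Substitution in polynomials\<close>

abbreviation pkeys :: "('a \<Rightarrow>\<^sub>0 'b::zero) \<Rightarrow> 'a set" where "pkeys \<equiv> Poly_Mapping.keys"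
abbreviation plook :: "('a \<Rightarrow>\<^sub>0 'b::zero) \<Rightarrow> 'a \<Rightarrow> 'b" where "plook \<equiv> Poly_Mapping.lookup"
abbreviation psingle :: "'a \<Rightarrow> 'b::zero \<Rightarrow> ('a \<Rightarrow>\<^sub>0 'b)" where "psingle \<equiv> Poly_Mapping.single"

definition mono_val :: "('u \<Rightarrow> 'r::comm_ring_1) \<Rightarrow> ('u \<Rightarrow>\<^sub>0 nat) \<Rightarrow> 'r" where
  "mono_val \<phi> m = (\<Prod>u\<in>pkeys m. \<phi> u ^ plook m u)"

lemma mono_val_superset:
  "finite S \<Longrightarrow> pkeys m \<subseteq> S \<Longrightarrow> mono_val \<phi> m = (\<Prod>u\<in>S. \<phi> u ^ plook m u)"
  unfolding mono_val_def by (rule prod.mono_neutral_left) (auto simp: in_keys_iff)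

lemma mono_val_add: "mono_val \<phi> (m + m') = mono_val \<phi> m * mono_val \<phi> m'"
proof -
  let ?S = "pkeys m \<union> pkeys m'"
  have "mono_val \<phi> (m + m') = (\<Prod>u\<in>?S. \<phi> u ^ plook (m + m') u)"
    using keys_add[of m m'] by (intro mono_val_superset) auto
  also have "\<dots> = (\<Prod>u\<in>?S. \<phi> u ^ plook m u) * (\<Prod>u\<in>?S. \<phi> u ^ plook m' u)"
    by (simp add: lookup_add power_add prod.distrib)
  also have "\<dots> = mono_val \<phi> m * mono_val \<phi> m'"
    by (simp add: mono_val_superset[of ?S m] mono_val_superset[of ?S m'])
  finally show ?thesis .
qed

lemma poly_mapping_sum_singles: "p = (\<Sum>m\<in>pkeys p. psingle m (plook p m))"
proof (rule poly_mapping_eqI)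
  fix k
  show "plook p k = plook (\<Sum>m\<in>pkeys p. psingle m (plook p m)) k"
    by (simp add: lookup_sum lookup_single when_def in_keys_iff)
qed

text \<open>Coefficients are carried along a map \<open>h\<close>, so that the same lemmas serve for
  renaming variables, with \<open>h = Const\<close>, and for evaluation in univariate polynomials,
  where the degree remains visible.\<close>

definition insertion :: "(complex \<Rightarrow> 'r) \<Rightarrow> ('u \<Rightarrow> 'r) \<Rightarrow> 'u cpoly \<Rightarrow> 'r::comm_ring_1" where
  "insertion h \<phi> p = (\<Sum>m\<in>pkeys p. h (plook p m) * mono_val \<phi> m)"

locale coeff_hom =
  fixes h :: "complex \<Rightarrow> 'r::comm_ring_1"
  assumes h0 [simp]: "h 0 = 0" and h1 [simp]: "h 1 = 1"
    and hadd: "h (a + b) = h a + h b" and hmult: "h (a * b) = h a * h b"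
begin

lemma insertion_superset:
  "finite S \<Longrightarrow> pkeys p \<subseteq> S \<Longrightarrow> insertion h \<phi> p = (\<Sum>m\<in>S. h (plook p m) * mono_val \<phi> m)"
  unfolding insertion_def by (rule sum.mono_neutral_left) (auto simp: in_keys_iff)

lemma insertion_add: "insertion h \<phi> (p + q) = insertion h \<phi> p + insertion h \<phi> q"
proof -
  let ?S = "pkeys p \<union> pkeys q"
  have "insertion h \<phi> (p + q) = (\<Sum>m\<in>?S. h (plook (p + q) m) * mono_val \<phi> m)"
    using keys_add[of p q] by (intro insertion_superset) auto
  also have "\<dots> = (\<Sum>m\<in>?S. h (plook p m) * mono_val \<phi> m) + (\<Sum>m\<in>?S. h (plook q m) * mono_val \<phi> m)"
    by (simp add: lookup_add hadd distrib_right sum.distrib)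
  also have "\<dots> = insertion h \<phi> p + insertion h \<phi> q"
    by (simp add: insertion_superset[of ?S p] insertion_superset[of ?S q])
  finally show ?thesis .
qed

lemma insertion_zero [simp]: "insertion h \<phi> 0 = 0"
  by (simp add: insertion_def)

lemma insertion_sum: "insertion h \<phi> (\<Sum>i\<in>I. f i) = (\<Sum>i\<in>I. insertion h \<phi> (f i))"
  by (induction I rule: infinite_finite_induct) (auto simp: insertion_add)

lemma insertion_single: "insertion h \<phi> (psingle m c) = h c * mono_val \<phi> m"
  by (simp add: insertion_def)

lemma insertion_mult: "insertion h \<phi> (p * q) = insertion h \<phi> p * insertion h \<phi> q"
proof -
  have "insertion h \<phi> (p * q) = insertion h \<phi>
    ((\<Sum>m\<in>pkeys p. psingle m (plook p m)) * (\<Sum>m\<in>pkeys q. psingle m (plook q m)))"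
    using poly_mapping_sum_singles[of p] poly_mapping_sum_singles[of q] by simp
  also have "\<dots> = (\<Sum>m\<in>pkeys p. \<Sum>m'\<in>pkeys q. insertion h \<phi> (psingle m (plook p m)) * insertion h \<phi> (psingle m' (plook q m')))"
    by (simp add: sum_product insertion_sum mult_single insertion_single mono_val_add hmult mult_ac)
  also have "\<dots> = (\<Sum>m\<in>pkeys p. insertion h \<phi> (psingle m (plook p m))) * (\<Sum>m'\<in>pkeys q. insertion h \<phi> (psingle m' (plook q m')))"
    by (simp add: sum_product)
  also have "\<dots> = insertion h \<phi> p * insertion h \<phi> q"
    unfolding insertion_single by (simp add: insertion_def)
  finally show ?thesis .
qed

lemma insertion_Const [simp]: "insertion h \<phi> (Const c) = h c"
  by (simp add: Const_def insertion_single mono_val_def)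

lemma insertion_Var [simp]: "insertion h \<phi> (Var u) = \<phi> u"
  by (simp add: Var_def insertion_single mono_val_def)

lemma insertion_one [simp]: "insertion h \<phi> 1 = 1"
  by (metis Const_def h1 insertion_Const single_one)

lemma insertion_diff: "insertion h \<phi> (p - q) = insertion h \<phi> p - insertion h \<phi> q"
  using insertion_add[of \<phi> "p - q" q] by simp

lemma insertion_power: "insertion h \<phi> (p ^ k) = insertion h \<phi> p ^ k"
  by (induction k) (auto simp: insertion_mult)

lemma insertion_prod: "insertion h \<phi> (\<Prod>i\<in>I. f i) = (\<Prod>i\<in>I. insertion h \<phi> (f i))"
  by (induction I rule: infinite_finite_induct) (auto simp: insertion_mult)

lemma insertion_mono_val: "insertion h \<phi> (mono_val \<psi> m) = mono_val (\<lambda>u. insertion h \<phi> (\<psi> u)) m"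
  by (simp add: mono_val_def insertion_prod insertion_power)

lemma insertion_insertion:
  "insertion h \<phi> (insertion Const \<psi> p) = insertion h (\<lambda>u. insertion h \<phi> (\<psi> u)) p"
  by (simp add: insertion_def[of Const] insertion_sum insertion_mult insertion_mono_val)
    (simp add: insertion_def)

end

lemma Const_add: "Const (a + b) = Const a + Const b"
  by (simp add: Const_def single_add)

lemma Const_mult: "Const (a * b) = Const a * Const b"
  by (simp add: Const_def mult_single)

lemma Const_0 [simp]: "Const 0 = 0" and Const_1 [simp]: "Const 1 = 1"
  by (simp_all add: Const_def)

lemma Const_uminus: "Const (- c) = - Const c"
  by (simp add: Const_def single_uminus)

interpretation Const: coeff_hom Const
  by unfold_locales (auto simp: Const_add Const_mult)

interpretation monom0: coeff_hom "\<lambda>c::complex. [:c:]"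
  by unfold_locales (auto simp: one_pCons)

lemma rename_vars_eq: "rename_vars f = insertion Const (\<lambda>u. Var (f u))"
  by (rule ext) (simp add: rename_vars_def insertion_def mono_val_def)

lemma single_eq: "psingle m c = Const c * mono_val Var m"
proof -
  have V: "Var u ^ k = psingle (psingle u k) (1::complex)" for u :: 'a and k
    by (induction k) (auto simp: Var_def mult_single single_add[symmetric])
  have prodS: "(\<Prod>u\<in>S. psingle (f u) (1::complex)) = psingle (\<Sum>u\<in>S. f u) 1"
    for S and f :: "'a \<Rightarrow> ('a \<Rightarrow>\<^sub>0 nat)"
    by (induction S rule: infinite_finite_induct) (auto simp: mult_single)
  have "mono_val Var m = psingle m 1"
    unfolding mono_val_def V prodS using poly_mapping_sum_singles[of m] by simp
  then show ?thesis by (simp add: Const_def mult_single)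
qed

lemma poly_expand: "p = (\<Sum>m\<in>pkeys p. Const (plook p m) * mono_val Var m)"
  using poly_mapping_sum_singles[of p] by (simp add: single_eq)

lemma insertion_Var_id: "insertion Const Var p = p"
  using poly_expand[of p] by (simp add: insertion_def)

lemma insertion_cong: "(\<And>m u. m \<in> pkeys p \<Longrightarrow> u \<in> pkeys m \<Longrightarrow> \<phi> u = \<psi> u) \<Longrightarrow> insertion h \<phi> p = insertion h \<psi> p"
  by (auto simp: insertion_def mono_val_def intro!: sum.cong arg_cong2[where f = "(*)"] prod.cong)

section \<open>Polynomials in a given set of variables, renaming and degree\<close>

definition polys :: "'u set \<Rightarrow> 'u cpoly set" where
  "polys X = {p. \<forall>m\<in>pkeys p. pkeys m \<subseteq> X}"

lemma polys_zero [simp]: "0 \<in> polys X" and polys_one [simp]: "1 \<in> polys X"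
  by (auto simp: polys_def)

lemma polys_Const [simp]: "Const c \<in> polys X"
  by (auto simp: polys_def Const_def)

lemma polys_Var [simp]: "u \<in> X \<Longrightarrow> Var u \<in> polys X"
  by (auto simp: polys_def Var_def)

lemma polys_add [intro, simp]: "p \<in> polys X \<Longrightarrow> q \<in> polys X \<Longrightarrow> p + q \<in> polys X"
  using keys_add[of p q] by (auto simp: polys_def)

lemma polys_uminus [intro, simp]: "p \<in> polys X \<Longrightarrow> - p \<in> polys X"
  by (auto simp: polys_def)

lemma polys_diff [intro, simp]: "p \<in> polys X \<Longrightarrow> q \<in> polys X \<Longrightarrow> p - q \<in> polys X"
  using polys_add[of p X "- q"] by simp

lemma polys_mult [intro, simp]: "p \<in> polys X \<Longrightarrow> q \<in> polys X \<Longrightarrow> p * q \<in> polys X"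
proof -
  assume a: "p \<in> polys X" "q \<in> polys X"
  show ?thesis unfolding polys_def
  proof (intro CollectI ballI)
    fix m assume "m \<in> pkeys (p * q)"
    then obtain k l where "m = k + l" "k \<in> pkeys p" "l \<in> pkeys q" using keys_mult[of p q] by auto
    then show "pkeys m \<subseteq> X" using a keys_add[of k l] by (fastforce simp: polys_def)
  qed
qed

lemma polys_sum [intro, simp]: "(\<And>i. i \<in> I \<Longrightarrow> f i \<in> polys X) \<Longrightarrow> (\<Sum>i\<in>I. f i) \<in> polys X"
  by (induction I rule: infinite_finite_induct) auto

lemma polys_prod [intro, simp]: "(\<And>i. i \<in> I \<Longrightarrow> f i \<in> polys X) \<Longrightarrow> (\<Prod>i\<in>I. f i) \<in> polys X"
  by (induction I rule: infinite_finite_induct) auto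

lemma polys_power [intro, simp]: "p \<in> polys X \<Longrightarrow> p ^ k \<in> polys X"
  by (induction k) auto

lemma rename_polys:
  assumes "p \<in> polys X" "\<And>u. u \<in> X \<Longrightarrow> f u \<in> Y"
  shows "rename_vars f p \<in> polys Y"
  unfolding rename_vars_eq insertion_def mono_val_def
  using assms by (intro polys_sum polys_mult polys_prod polys_power polys_Const polys_Var) (auto simp: polys_def)

lemma rename_rename: "rename_vars f (rename_vars g p) = rename_vars (\<lambda>u. f (g u)) p"
  by (simp add: rename_vars_eq Const.insertion_insertion)

lemma rename_id: "p \<in> polys X \<Longrightarrow> (\<And>u. u \<in> X \<Longrightarrow> f u = u) \<Longrightarrow> rename_vars f p = p"
proof -
  assume a: "p \<in> polys X" "\<And>u. u \<in> X \<Longrightarrow> f u = u"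
  have "rename_vars f p = insertion Const Var p"
    unfolding rename_vars_eq
  proof (rule insertion_cong)
    fix m u assume "m \<in> pkeys p" "u \<in> pkeys m"
    then have "u \<in> X" using a(1) by (auto simp: polys_def)
    then show "Var (f u) = Var u" using a(2) by simp
  qed
  then show ?thesis by (simp add: insertion_Var_id)
qed

abbreviation mdeg :: "('u \<Rightarrow>\<^sub>0 nat) \<Rightarrow> nat" where
  "mdeg m \<equiv> (\<Sum>u\<in>pkeys m. plook m u)"

lemma mdeg_add: "mdeg (k + l) = mdeg k + mdeg l"
proof -
  have s: "mdeg m = (\<Sum>u\<in>S. plook m u)" if "finite S" "pkeys m \<subseteq> S" for m and S :: "'a set"
    using that by (intro sum.mono_neutral_left) (auto simp: in_keys_iff)
  let ?S = "pkeys k \<union> pkeys l"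
  have "mdeg (k + l) = (\<Sum>u\<in>?S. plook (k + l) u)"
    using keys_add[of k l] by (intro s) auto
  also have "\<dots> = mdeg k + mdeg l"
    by (simp add: lookup_add sum.distrib s[of ?S k] s[of ?S l])
  finally show ?thesis .
qed

lemma homogeneous_mult: "homogeneous d p \<Longrightarrow> homogeneous e q \<Longrightarrow> homogeneous (d + e) (p * q)"
  unfolding homogeneous_def
proof
  fix m assume a: "\<forall>m\<in>pkeys p. mdeg m = d" "\<forall>m\<in>pkeys q. mdeg m = e" and "m \<in> pkeys (p * q)"
  then obtain k l where "m = k + l" "k \<in> pkeys p" "l \<in> pkeys q" using keys_mult[of p q] by auto
  then show "mdeg m = d + e" using a by (simp add: mdeg_add)
qed

lemma homogeneous_Var: "homogeneous 1 (Var u)"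
  by (simp add: homogeneous_def Var_def)

lemma homogeneous_one: "homogeneous 0 1"
  by (simp add: homogeneous_def)

lemma homogeneous_zero: "homogeneous d 0"
  by (simp add: homogeneous_def)

lemma homogeneous_Const_mult: "homogeneous d p \<Longrightarrow> homogeneous d (Const c * p)"
  using homogeneous_mult[of 0 "Const c" d p] by (simp add: homogeneous_def[of 0] Const_def)

lemma homogeneous_add: "homogeneous d p \<Longrightarrow> homogeneous d q \<Longrightarrow> homogeneous d (p + q)"
  using keys_add[of p q] by (auto simp: homogeneous_def)

lemma homogeneous_prod_Var: "finite I \<Longrightarrow> homogeneous (card I) (\<Prod>i\<in>I. Var (f i))"
proof (induction I rule: finite_induct)
  case (insert i I)
  then show ?case using homogeneous_mult[OF homogeneous_Var insert.IH, of "f i"] by simp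
qed (simp add: homogeneous_one)

lemma homogeneous_rename: "homogeneous d p \<Longrightarrow> homogeneous d (rename_vars f p)"
proof -
  assume p: "homogeneous d p"
  have pw: "homogeneous k (Var u ^ k)" for u :: 'a and k
    by (induction k) (use homogeneous_mult[OF homogeneous_Var] in \<open>auto simp: homogeneous_one\<close>)
  have mv: "homogeneous (\<Sum>u\<in>S. k u) (\<Prod>u\<in>S. Var (f u) ^ k u)" if "finite S" for S k
    using that by (induction S rule: finite_induct) (auto simp: homogeneous_one intro: homogeneous_mult pw)
  have "homogeneous d (\<Sum>m\<in>S. Const (plook p m) * mono_val (\<lambda>u. Var (f u)) m)" if "S \<subseteq> pkeys p" for S
    using finite_subset[OF that finite_keys] that
  proof (induction S rule: finite_induct)
    case (insert m S)
    have "homogeneous d (mono_val (\<lambda>u. Var (f u)) m)"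
      using mv[of "pkeys m" "plook m"] p insert by (simp add: mono_val_def homogeneous_def[of d p])
    then show ?case using insert by (auto intro: homogeneous_add homogeneous_Const_mult)
  qed (simp add: homogeneous_zero)
  then show ?thesis by (simp add: rename_vars_eq insertion_def)
qed

section \<open>The kernel of the braid map\<close>

text \<open>Coordinates are stored for \<open>a < b\<close> only and a vector vanishes at all other
  pairs, so at most one of the two terms is nonzero: this is the signed flow from \<open>a\<close>
  to \<open>b\<close>.\<close>

definition antisym_part :: "(nat \<times> nat \<Rightarrow> complex) \<Rightarrow> nat \<Rightarrow> nat \<Rightarrow> complex" where
  "antisym_part u a b = u (a, b) - u (b, a)"

lemma antisym_part_swap: "antisym_part u b a = - antisym_part u a b"
  by (simp add: antisym_part_def)

lemma antisym_part_hvec: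
  "antisym_part (hvec i j) a b = of_bool (a = i \<and> b = j) - of_bool (a = j \<and> b = i)"
  by (cases i j rule: linorder_cases) (auto simp: antisym_part_def hvec_def of_bool_def)

text \<open>The unit flow around a triangle. It is zero when two vertices coincide, so sums over all
  pairs of vertices need no side condition.\<close>

definition tri :: "nat \<Rightarrow> nat \<Rightarrow> nat \<Rightarrow> nat \<times> nat \<Rightarrow> complex" where
  "tri a b c = (\<lambda>e. hvec a b e + hvec b c e + hvec c a e)"

lemma hvec_swap: "hvec b a e = - hvec a b e"
  by (auto simp: hvec_def)

lemma hvec_same [simp]: "hvec a a e = 0"
  by (auto simp: hvec_def)

context braid_words
begin

abbreviation "idx \<equiv> braid_index n"
abbreviation "K \<equiv> carrier (braid_kernel n)"
abbreviation "kact \<equiv> act (braid_kernel n)"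

lemma finite_idx [simp]: "finite idx"
  by (rule finite_subset[of _ "A \<times> A"]) (auto simp: braid_index_def)

lemma idx_mem: "d \<in> idx \<Longrightarrow> fst d \<in> A" "d \<in> idx \<Longrightarrow> snd d \<in> A"
  by (auto simp: braid_index_def)

lemma permutes_idx:
  "h permutes A \<Longrightarrow> d \<in> idx \<Longrightarrow> h (fst d) \<in> A"
  "h permutes A \<Longrightarrow> d \<in> idx \<Longrightarrow> h (snd d) \<in> A"
  using idx_mem permutes_in_image by metis+

lemma idx_sum:
  assumes "\<And>e. e \<notin> idx \<Longrightarrow> F e = 0"
  shows "sum F idx = (\<Sum>i\<in>A. \<Sum>j\<in>A. F (i, j))"
proof -
  have "sum F idx = sum F (A \<times> A)"
    by (rule sum.mono_neutral_left) (use assms in \<open>auto simp: braid_index_def\<close>)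
  then show ?thesis by (simp add: sum.cartesian_product)
qed

lemma hvec_off: "i \<in> A \<Longrightarrow> j \<in> A \<Longrightarrow> e \<notin> idx \<Longrightarrow> hvec i j e = 0"
  by (auto simp: hvec_def braid_index_def)

lemma antisym_part_eq: "e \<in> idx \<Longrightarrow> (\<And>e. e \<notin> idx \<Longrightarrow> u e = 0) \<Longrightarrow> antisym_part u (fst e) (snd e) = u e"
  by (cases e) (auto simp: antisym_part_def braid_index_def)

text \<open>The coordinate \<open>k\<close> of the image is the net outflow at the vertex
  \<open>k\<close>, so the kernel consists of the flows obeying Kirchhoff's law.\<close>

lemma braid_map_antisym:
  assumes "\<And>e. e \<notin> idx \<Longrightarrow> u e = 0"
  shows "braid_map n u k = (if k \<in> A then \<Sum>b\<in>A. antisym_part u k b else 0)"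
proof -
  have "braid_map n u k = (\<Sum>e\<in>idx. u e * (of_bool (k = fst e) - of_bool (k = snd e)))"
    unfolding braid_map_def by (rule sum.cong) auto
  also have "\<dots> = (\<Sum>i\<in>A. \<Sum>j\<in>A. u (i, j) * (of_bool (k = i) - of_bool (k = j)))"
    using assms by (subst idx_sum) auto
  also have "\<dots> = (\<Sum>i\<in>A. \<Sum>j\<in>A. if k = i then u (i, j) else 0) - (\<Sum>i\<in>A. \<Sum>j\<in>A. if k = j then u (i, j) else 0)"
    unfolding sum_subtractf[symmetric] by (intro sum.cong) auto
  also have "(\<Sum>i\<in>A. \<Sum>j\<in>A. if k = i then u (i, j) else 0) = (\<Sum>j\<in>A. \<Sum>i\<in>A. if k = i then u (i, j) else 0)"
    by (rule sum.swap)
  also have "\<dots> - (\<Sum>i\<in>A. \<Sum>j\<in>A. if k = j then u (i, j) else 0)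
    = (if k \<in> A then \<Sum>b\<in>A. antisym_part u k b else 0)"
    by (cases "k \<in> A") (simp_all only: sum.delta sum.delta' finite_atLeastAtMost if_True if_False
        antisym_part_def sum_subtractf sum.neutral_const diff_self)
  finally show ?thesis .
qed

lemma K_iff: "u \<in> K \<longleftrightarrow> (\<forall>e. e \<notin> idx \<longrightarrow> u e = 0) \<and> (\<forall>k\<in>A. (\<Sum>b\<in>A. antisym_part u k b) = 0)"
proof -
  have "u \<in> K \<longleftrightarrow> (\<forall>e. e \<notin> idx \<longrightarrow> u e = 0) \<and> braid_map n u = (\<lambda>k. 0)"
    by (auto simp: braid_kernel_def braid_space_def)
  then show ?thesis using braid_map_antisym[of u] by (simp only: fun_eq_iff) (metis (full_types))
qed

lemma K_off: "u \<in> K \<Longrightarrow> e \<notin> idx \<Longrightarrow> u e = 0"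
  unfolding K_iff by blast

lemma K_row_sum: "u \<in> K \<Longrightarrow> a \<in> A \<Longrightarrow> (\<Sum>b\<in>A. antisym_part u a b) = 0"
  by (simp add: K_iff)

lemma K_add: "u \<in> K \<Longrightarrow> v \<in> K \<Longrightarrow> (\<lambda>e. u e + v e) \<in> K"
proof -
  have "antisym_part (\<lambda>e. u e + v e) k b = antisym_part u k b + antisym_part v k b" for k b
    by (simp add: antisym_part_def)
  then show "u \<in> K \<Longrightarrow> v \<in> K \<Longrightarrow> ?thesis" by (simp add: K_iff sum.distrib)
qed

lemma K_scale: "u \<in> K \<Longrightarrow> (\<lambda>e. c * u e) \<in> K"
proof -
  have "antisym_part (\<lambda>e. c * u e) k b = c * antisym_part u k b" for k b
    by (simp add: antisym_part_def algebra_simps)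
  then show "u \<in> K \<Longrightarrow> ?thesis" by (simp add: K_iff sum_distrib_left[symmetric])
qed

lemma K_zero: "(\<lambda>e. 0) \<in> K"
  by (simp add: K_iff antisym_part_def)

lemma K_sum: "(\<And>i. i \<in> I \<Longrightarrow> f i \<in> K) \<Longrightarrow> (\<lambda>e. \<Sum>i\<in>I. f i e) \<in> K"
  by (induction I rule: infinite_finite_induct) (auto intro: K_add K_zero)

lemma K_ops [simp]:
  "add (braid_kernel n) = (\<lambda>u v e. u e + v e)"
  "zero (braid_kernel n) = (\<lambda>e. 0)"
  "smult (braid_kernel n) = (\<lambda>c u e. c * u e)"
  by (simp_all add: braid_kernel_def braid_space_def)

lemma kact_def': "kact p u = (\<lambda>e. \<Sum>d\<in>idx. u d * hvec (p (fst d)) (p (snd d)) e)"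
  by (simp add: braid_kernel_def braid_space_def case_prod_beta)

lemma tri_K: "a \<in> A \<Longrightarrow> b \<in> A \<Longrightarrow> c \<in> A \<Longrightarrow> tri a b c \<in> K"
proof -
  assume abc: "a \<in> A" "b \<in> A" "c \<in> A"
  have "(\<Sum>l\<in>A. antisym_part (tri a b c) k l) = 0" if "k \<in> A" for k
  proof -
    have r: "(\<Sum>l\<in>A. antisym_part (hvec i j) k l) = of_bool (k = i) - of_bool (k = j)"
      if "i \<in> A" "j \<in> A" for i j
    proof -
      have "(\<Sum>l\<in>A. antisym_part (hvec i j) k l) = (\<Sum>l\<in>A. if l = j then of_bool (k = i) else 0) - (\<Sum>l\<in>A. if l = i then of_bool (k = j) else 0)"
        unfolding sum_subtractf[symmetric] antisym_part_hvec by (rule sum.cong) auto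
      then show ?thesis using that by simp
    qed
    have "(\<Sum>l\<in>A. antisym_part (tri a b c) k l) =
      (\<Sum>l\<in>A. antisym_part (hvec a b) k l + antisym_part (hvec b c) k l + antisym_part (hvec c a) k l)"
      by (simp add: tri_def antisym_part_def algebra_simps)
    also have "\<dots> = 0" by (simp only: sum.distrib r abc)  simp
    finally show ?thesis .
  qed
  then show ?thesis using hvec_off abc by (auto simp: K_iff tri_def)
qed

text \<open>A flow \<open>u\<close> is half the sum over \<open>(a, b)\<close> of the triangles through \<open>j\<close>; the edges at \<open>j\<close>
  cancel by the conservation law.\<close>

lemma K_tri_expand:
  assumes u: "u \<in> K" and j: "j \<in> A"
  shows "u = (\<lambda>e. \<Sum>a\<in>A. \<Sum>b\<in>A. antisym_part u a b / 2 * tri j a b e)"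
proof
  fix e
  have c1: "(\<Sum>a\<in>A. \<Sum>b\<in>A. antisym_part u a b / 2 * hvec j a e) = 0"
    using K_row_sum[OF u] by (simp add: sum_distrib_right[symmetric] sum_divide_distrib[symmetric])
  have "(\<Sum>a\<in>A. \<Sum>b\<in>A. antisym_part u a b / 2 * hvec b j e) = (\<Sum>b\<in>A. \<Sum>a\<in>A. antisym_part u a b / 2 * hvec b j e)"
    by (rule sum.swap)
  also have "\<dots> = (\<Sum>b\<in>A. \<Sum>a\<in>A. antisym_part u b a / 2 * hvec j b e)"
  proof (intro sum.cong refl)
    fix a b show "antisym_part u a b / 2 * hvec b j e = antisym_part u b a / 2 * hvec j b e"
      using antisym_part_swap[of u a b] hvec_swap[of j b e] by simp
  qed
  finally have c3: "(\<Sum>a\<in>A. \<Sum>b\<in>A. antisym_part u a b / 2 * hvec b j e) = 0" using c1 by simp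
  have c2: "(\<Sum>a\<in>A. \<Sum>b\<in>A. antisym_part u a b / 2 * hvec a b e) = u e"
  proof (cases "e \<in> idx")
    case True
    then obtain k l where e: "e = (k, l)" "k < l" "k \<in> A" "l \<in> A" by (auto simp: braid_index_def)
    have "hvec a b e = of_bool (a = k \<and> b = l) - of_bool (a = l \<and> b = k)" for a b
      using e by (auto simp: hvec_def)
    then have "(\<Sum>a\<in>A. \<Sum>b\<in>A. antisym_part u a b / 2 * hvec a b e) =
      (\<Sum>a\<in>A. \<Sum>b\<in>A. (if b = l then if a = k then antisym_part u a b / 2 else 0 else 0)) -
      (\<Sum>a\<in>A. \<Sum>b\<in>A. (if b = k then if a = l then antisym_part u a b / 2 else 0 else 0))"
      unfolding sum_subtractf[symmetric] by (intro sum.cong) auto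
    also have "\<dots> = antisym_part u k l / 2 - antisym_part u l k / 2" using e by simp
    also have "\<dots> = antisym_part u k l" using antisym_part_swap[of u k l] by simp
    also have "\<dots> = u e" using antisym_part_eq[OF True K_off[OF u]] e by simp
    finally show ?thesis .
  next
    case False
    then show ?thesis using hvec_off K_off[OF u] by simp
  qed
  have "(\<Sum>a\<in>A. \<Sum>b\<in>A. antisym_part u a b / 2 * tri j a b e) =
    (\<Sum>a\<in>A. \<Sum>b\<in>A. antisym_part u a b / 2 * hvec j a e) +
    (\<Sum>a\<in>A. \<Sum>b\<in>A. antisym_part u a b / 2 * hvec a b e) +
    (\<Sum>a\<in>A. \<Sum>b\<in>A. antisym_part u a b / 2 * hvec b j e)"
    unfolding sum.distrib[symmetric] tri_def by (simp add: algebra_simps)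
  then show "u e = (\<Sum>a\<in>A. \<Sum>b\<in>A. antisym_part u a b / 2 * tri j a b e)"
    using c1 c2 c3 by simp
qed

text \<open>An antisymmetric \<open>F\<close> is a linear functional on the arrangement space, and
  the formula evaluates it at a basis vector in either orientation. The action and
  \<open>eps\<close> both have this form.\<close>

lemma hvec_expand:
  assumes "a \<in> A" "b \<in> A" and F: "\<And>k l. F l k = - F k l"
  shows "(\<Sum>d\<in>idx. hvec a b d * F (fst d) (snd d)) = (F a b :: complex)"
proof -
  have F0: "F k k = 0" for k
  proof -
    have "F k k + F k k = 0" using F[of k k] by (metis add.right_inverse)
    then show ?thesis by simp
  qed
  consider "a < b" | "b < a" | "a = b" by linarith
  then show ?thesis
  proof cases
    case 1
    then have "(\<Sum>d\<in>idx. hvec a b d * F (fst d) (snd d)) = (\<Sum>d\<in>idx. if d = (a, b) then F a b else 0)"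
      by (intro sum.cong) (auto simp: hvec_def)
    moreover have "(a, b) \<in> idx" using 1 assms(1,2) by (simp add: braid_index_def)
    ultimately show ?thesis by simp
  next
    case 2
    then have "(\<Sum>d\<in>idx. hvec a b d * F (fst d) (snd d)) = (\<Sum>d\<in>idx. if d = (b, a) then - F b a else 0)"
      by (intro sum.cong) (auto simp: hvec_def)
    moreover have "(b, a) \<in> idx" using 2 assms(1,2) by (simp add: braid_index_def)
    ultimately show ?thesis using F[of a b] by simp
  qed (simp add: F0)
qed

lemma kact_kact:
  assumes "h permutes A"
  shows "kact g (kact h u) = kact (g \<circ> h) u"
proof
  fix e
  have hA: "h (fst d) \<in> A" "h (snd d) \<in> A" if "d \<in> idx" for d
    using permutes_idx[OF assms that] by auto
  have "kact g (kact h u) e = (\<Sum>d\<in>idx. \<Sum>c\<in>idx. u c * (hvec (h (fst c)) (h (snd c)) d * hvec (g (fst d)) (g (snd d)) e))"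
    by (simp add: kact_def' sum_distrib_right mult.assoc)
  also have "\<dots> = (\<Sum>c\<in>idx. u c * (\<Sum>d\<in>idx. hvec (h (fst c)) (h (snd c)) d * hvec (g (fst d)) (g (snd d)) e))"
    unfolding sum_distrib_left by (rule sum.swap)
  also have "\<dots> = (\<Sum>c\<in>idx. u c * hvec (g (h (fst c))) (g (h (snd c))) e)"
    by (intro sum.cong refl, subst hvec_expand[where F = "\<lambda>k l. hvec (g k) (g l) e"])
      (simp_all only: hA hvec_swap[symmetric] minus_minus)
  finally show "kact g (kact h u) e = kact (g \<circ> h) u e" by (simp add: kact_def')
qed

lemma kact_id: "u \<in> K \<Longrightarrow> kact id u = u"
proof
  fix e assume u: "u \<in> K"
  have "kact id u e = (\<Sum>d\<in>idx. if d = e then u e else 0)"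
    unfolding kact_def' by (intro sum.cong) (auto simp: hvec_def braid_index_def)
  then show "kact id u e = u e" using K_off[OF u] by auto
qed

text \<open>The outflow of \<open>kact h u\<close> at \<open>k\<close> is that of \<open>u\<close>
  at the preimage of \<open>k\<close>; this is the equivariance of the braid map.\<close>

lemma kact_K: "h permutes A \<Longrightarrow> u \<in> K \<Longrightarrow> kact h u \<in> K"
proof -
  assume h: "h permutes A" and u: "u \<in> K"
  have hA: "h (fst d) \<in> A" "h (snd d) \<in> A" if "d \<in> idx" for d
    using permutes_idx[OF h that] by auto
  have "(\<Sum>l\<in>A. antisym_part (kact h u) k l) = 0" if k: "k \<in> A" for k
  proof -
    have "(\<Sum>l\<in>A. antisym_part (kact h u) k l) = (\<Sum>l\<in>A. \<Sum>d\<in>idx. u d * antisym_part (hvec (h (fst d)) (h (snd d))) k l)"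
      by (simp add: antisym_part_def kact_def' sum_subtractf right_diff_distrib)
    also have "\<dots> = (\<Sum>d\<in>idx. \<Sum>l\<in>A. u d * antisym_part (hvec (h (fst d)) (h (snd d))) k l)"
      by (rule sum.swap)
    also have "\<dots> = (\<Sum>d\<in>idx. u d * (of_bool (Hilbert_Choice.inv h k = fst d) - of_bool (Hilbert_Choice.inv h k = snd d)))"
    proof (intro sum.cong refl)
      fix d assume d: "d \<in> idx"
      have "(\<Sum>l\<in>A. antisym_part (hvec (h (fst d)) (h (snd d))) k l) =
        (\<Sum>l\<in>A. if l = h (snd d) then of_bool (k = h (fst d)) else 0) - (\<Sum>l\<in>A. if l = h (fst d) then of_bool (k = h (snd d)) else 0)"
        unfolding sum_subtractf[symmetric] antisym_part_hvec by (rule sum.cong) auto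
      also have "\<dots> = of_bool (k = h (fst d)) - of_bool (k = h (snd d))" using hA[OF d] by simp
      also have "\<dots> = of_bool (Hilbert_Choice.inv h k = fst d) - of_bool (Hilbert_Choice.inv h k = snd d)"
        by (simp only: permutes_inv_eq[OF h] eq_commute[of k])
      finally show "(\<Sum>l\<in>A. u d * antisym_part (hvec (h (fst d)) (h (snd d))) k l) =
        u d * (of_bool (Hilbert_Choice.inv h k = fst d) - of_bool (Hilbert_Choice.inv h k = snd d))"
        by (simp add: sum_distrib_left[symmetric])
    qed
    also have "\<dots> = braid_map n u (Hilbert_Choice.inv h k)"
      unfolding braid_map_def by (rule sum.cong) auto
    also have "\<dots> = 0" using braid_map_antisym[of u "Hilbert_Choice.inv h k"] K_off[OF u] K_row_sum[OF u] by auto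
    finally show ?thesis .
  qed
  moreover have "kact h u e = 0" if "e \<notin> idx" for e
    using that hA hvec_off by (simp add: kact_def')
  ultimately show ?thesis unfolding K_iff by blast
qed

text \<open>The linear functional sending \<open>hvec a b\<close> to \<open>sg l a b\<close>. On a
  triangle with distinct vertices it gives their orientation in the cyclic word.\<close>

definition eps :: "nat list \<Rightarrow> (nat \<times> nat \<Rightarrow> complex) \<Rightarrow> complex" where
  "eps l u = (\<Sum>d\<in>idx. u d * sg l (fst d) (snd d))"

lemma eps_add: "eps l (\<lambda>e. u e + v e) = eps l u + eps l v"
  by (simp add: eps_def distrib_right sum.distrib)

lemma eps_scale: "eps l (\<lambda>e. c * u e) = c * eps l u"
  by (simp add: eps_def sum_distrib_left mult.assoc)

lemma eps_hvec: "a \<in> A \<Longrightarrow> b \<in> A \<Longrightarrow> eps l (hvec a b) = sg l a b"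
  unfolding eps_def by (rule hvec_expand) (auto intro: sg_antisym)

lemma eps_tri: "a \<in> A \<Longrightarrow> b \<in> A \<Longrightarrow> c \<in> A \<Longrightarrow> eps l (tri a b c) = sg l a b + sg l b c + sg l c a"
  by (simp add: tri_def eps_add eps_hvec)

lemma eps_kact:
  assumes h: "h permutes A"
  shows "eps l (kact h u) = eps (map (Hilbert_Choice.inv h) l) u"
proof -
  have hA: "h (fst d) \<in> A" "h (snd d) \<in> A" if "d \<in> idx" for d
    using permutes_idx[OF h that] by auto
  have "eps l (kact h u) = (\<Sum>d\<in>idx. \<Sum>c\<in>idx. u c * (hvec (h (fst c)) (h (snd c)) d * sg l (fst d) (snd d)))"
    by (simp add: eps_def kact_def' sum_distrib_right mult.assoc)
  also have "\<dots> = (\<Sum>c\<in>idx. u c * (\<Sum>d\<in>idx. hvec (h (fst c)) (h (snd c)) d * sg l (fst d) (snd d)))"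
    unfolding sum_distrib_left by (rule sum.swap)
  also have "\<dots> = (\<Sum>c\<in>idx. u c * sg l (h (fst c)) (h (snd c)))"
    by (intro sum.cong refl, subst hvec_expand[where F = "sg l"]) (simp_all only: hA sg_antisym[symmetric] minus_minus)
  also have "\<dots> = (\<Sum>c\<in>idx. u c * sg (map (Hilbert_Choice.inv h) l) (fst c) (snd c))"
  proof (intro sum.cong refl)
    fix c
    have "map h (map (Hilbert_Choice.inv h) l) = l" using permutes_inverses[OF h] by (simp add: comp_def)
    then show "u c * sg l (h (fst c)) (h (snd c)) = u c * sg (map (Hilbert_Choice.inv h) l) (fst c) (snd c)"
      using sg_map[OF permutes_inj[OF h], of "map (Hilbert_Choice.inv h) l" "fst c" "snd c"] by simp
  qed
  finally show ?thesis by (simp add: eps_def)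
qed

end

section \<open>Reduction modulo squares of triangles\<close>

text \<open>The reduction takes place among polynomials whose variables are all flows, with
  linearity expressed by elements of the ideal. This keeps cosets out of it and uses only the
  closure properties listed here.\<close>

locale triangle_ideal = braid_words +
  fixes J :: "(nat \<times> nat \<Rightarrow> complex) cpoly set"
  assumes J_polys: "p \<in> J \<Longrightarrow> p \<in> polys K"
    and J_add: "p \<in> J \<Longrightarrow> q \<in> J \<Longrightarrow> p + q \<in> J"
    and J_mult: "q \<in> polys K \<Longrightarrow> p \<in> J \<Longrightarrow> q * p \<in> J"
    and J_lin_add: "u \<in> K \<Longrightarrow> v \<in> K \<Longrightarrow> Var (\<lambda>e. u e + v e) - (Var u + Var v) \<in> J"
    and J_lin_scale: "u \<in> K \<Longrightarrow> Var (\<lambda>e. z * u e) - Const z * Var u \<in> J"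
    and J_tri: "a \<in> A \<Longrightarrow> b \<in> A \<Longrightarrow> c \<in> A \<Longrightarrow> distinct [a, b, c] \<Longrightarrow> Var (tri a b c) ^ 2 \<in> J"
begin

lemma J_uminus: "p \<in> J \<Longrightarrow> - p \<in> J"
  using J_mult[of "Const (- 1)" p] by (simp add: Const_uminus)

lemma J_diff: "p \<in> J \<Longrightarrow> q \<in> J \<Longrightarrow> p - q \<in> J"
  using J_add[of p "- q"] J_uminus by simp

lemma J_zero: "0 \<in> J"
  using J_mult[OF polys_zero J_lin_scale[OF K_zero]] by simp

inductive_set jspan :: "(nat \<times> nat \<Rightarrow> complex) cpoly set \<Rightarrow> (nat \<times> nat \<Rightarrow> complex) cpoly set" for S where
  ideal: "p \<in> J \<Longrightarrow> p \<in> jspan S"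
| base: "p \<in> S \<Longrightarrow> p \<in> jspan S"
| add: "p \<in> jspan S \<Longrightarrow> q \<in> jspan S \<Longrightarrow> p + q \<in> jspan S"
| scale: "p \<in> jspan S \<Longrightarrow> Const c * p \<in> jspan S"

lemma jspan_uminus: "p \<in> jspan S \<Longrightarrow> - p \<in> jspan S"
  using jspan.scale[of p S "- 1"] by (simp add: Const_uminus)

lemma jspan_diff: "p \<in> jspan S \<Longrightarrow> q \<in> jspan S \<Longrightarrow> p - q \<in> jspan S"
  using jspan.add[of p S "- q"] jspan_uminus by simp

lemma jspan_sum: "(\<And>i. i \<in> I \<Longrightarrow> f i \<in> jspan S) \<Longrightarrow> (\<Sum>i\<in>I. f i) \<in> jspan S"
  by (induction I rule: infinite_finite_induct) (auto intro: jspan.add jspan.ideal J_zero)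

lemma jspan_cong: "q \<in> jspan S \<Longrightarrow> p - q \<in> J \<Longrightarrow> p \<in> jspan S"
  using jspan.add[of q S "p - q"] jspan.ideal by simp

lemma jspan_mult:
  assumes "p \<in> jspan S" "q \<in> polys K" "\<And>s. s \<in> S \<Longrightarrow> q * s \<in> jspan S'"
  shows "q * p \<in> jspan S'"
  using assms(1)
proof (induction rule: jspan.induct)
  case (ideal p)
  then show ?case using assms(2) by (auto intro: jspan.ideal J_mult)
next
  case (scale p c)
  then show ?case using jspan.scale[of "q * p" S' c] by (simp add: mult.left_commute)
qed (auto simp: distrib_left assms intro: jspan.add)

lemma jspan_mono: "p \<in> jspan S \<Longrightarrow> S \<subseteq> jspan S' \<Longrightarrow> p \<in> jspan S'"
  using jspan_mult[of p S 1 S'] by auto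

lemma jspan_empty: "p \<in> jspan {} \<Longrightarrow> p \<in> J"
  by (induction rule: jspan.induct) (auto intro: J_add J_mult)

lemma jspan_coeffs:
  assumes "p \<in> jspan S" "finite S"
  shows "\<exists>f. p - (\<Sum>s\<in>S. Const (f s) * s) \<in> J"
  using assms(1)
proof (induction rule: jspan.induct)
  case (ideal p)
  then show ?case by (intro exI[of _ "\<lambda>s. 0"]) simp
next
  case (base p)
  have "(\<Sum>s\<in>S. Const (of_bool (s = p)) * s) = (\<Sum>s\<in>S. if s = p then s else 0)"
    by (rule sum.cong) auto
  then show ?case using base assms(2) by (intro exI[of _ "\<lambda>s. of_bool (s = p)"]) (simp add: J_zero)
next
  case (add p q)
  then obtain f g where "p - (\<Sum>s\<in>S. Const (f s) * s) \<in> J" "q - (\<Sum>s\<in>S. Const (g s) * s) \<in> J" by blast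
  from J_add[OF this] show ?case
    by (intro exI[of _ "\<lambda>s. f s + g s"]) (simp add: Const_add distrib_right sum.distrib algebra_simps)
next
  case (scale p c)
  then obtain f where "p - (\<Sum>s\<in>S. Const (f s) * s) \<in> J" by blast
  from J_mult[OF polys_Const this, of c] show ?case
    by (intro exI[of _ "\<lambda>s. c * f s"]) (simp add: Const_mult right_diff_distrib sum_distrib_left mult.assoc)
qed

lemma Var_sum: "(\<And>i. i \<in> I \<Longrightarrow> f i \<in> K) \<Longrightarrow> Var (\<lambda>e. \<Sum>i\<in>I. c i * f i e) - (\<Sum>i\<in>I. Const (c i) * Var (f i)) \<in> J"
proof (induction I rule: infinite_finite_induct)
  case (insert x F)
  let ?v = "\<lambda>e. \<Sum>i\<in>F. c i * f i e" and ?s = "\<Sum>i\<in>F. Const (c i) * Var (f i)"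
  have K: "(\<lambda>e. c x * f x e) \<in> K" "?v \<in> K"
    by (rule K_scale, use insert in simp) (rule K_sum, rule K_scale, use insert in simp)
  have "(Var (\<lambda>e. c x * f x e + ?v e) - (Var (\<lambda>e. c x * f x e) + Var ?v)) +
    ((Var (\<lambda>e. c x * f x e) - Const (c x) * Var (f x)) + (Var ?v - ?s)) \<in> J"
    using insert by (intro J_add J_lin_add J_lin_scale[of "f x" "c x"] K) auto
  then show ?case using insert by (simp add: algebra_simps)
qed (use J_lin_scale[OF K_zero, of 0] in simp_all)

end

section \<open>Triangles through a fixed vertex and increasing forests\<close>

locale star_base = triangle_ideal +
  fixes j :: nat
  assumes jA: "j \<in> A"
begin

abbreviation X :: "nat \<Rightarrow> nat \<Rightarrow> (nat \<times> nat \<Rightarrow> complex) cpoly" where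
  "X a b \<equiv> Var (tri j a b)"

lemma X_polys: "a \<in> A \<Longrightarrow> b \<in> A \<Longrightarrow> X a b \<in> polys K"
  by (intro polys_Var tri_K jA)

lemma X_neg: "a \<in> A \<Longrightarrow> b \<in> A \<Longrightarrow> X b a + X a b \<in> J"
proof -
  assume ab: "a \<in> A" "b \<in> A"
  have "tri j b a = (\<lambda>e. (- 1) * tri j a b e)"
    using hvec_swap[of j b] hvec_swap[of a j] hvec_swap[of a b] by (auto simp: tri_def)
  then show ?thesis using J_lin_scale[of "tri j a b" "- 1", OF tri_K[OF jA ab]] by (simp add: Const_uminus)
qed

lemma X_same: "a \<in> A \<Longrightarrow> X a a \<in> J"
proof -
  assume a: "a \<in> A"
  have "Const (1/2) * (X a a + X a a) = X a a"
    by (simp only: distrib_left distrib_right[symmetric] Const_add[symmetric]) simp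
  then show ?thesis using J_mult[OF polys_Const X_neg[OF a a], of "1/2"] by simp
qed

lemma X_base: "a \<in> A \<Longrightarrow> X j a \<in> J" "a \<in> A \<Longrightarrow> X a j \<in> J"
proof -
  assume a: "a \<in> A"
  have z: "tri j j a = (\<lambda>e. 0 * tri j j a e)" "tri j a j = (\<lambda>e. 0 * tri j j a e)"
    using hvec_swap[of j a] by (auto simp: tri_def)
  show "X j a \<in> J" "X a j \<in> J"
    using J_lin_scale[of "tri j j a" 0, OF tri_K[OF jA jA a]] z by simp_all
qed

lemma X_square: "a \<in> A \<Longrightarrow> b \<in> A \<Longrightarrow> X a b * X a b \<in> J"
proof -
  assume ab: "a \<in> A" "b \<in> A"
  consider "a = b" | "a = j" | "b = j" | "distinct [j, a, b]" by auto
  then show ?thesis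
    using J_tri[OF jA ab] ab X_same X_base J_mult[OF X_polys[OF ab], of "X a b"]
    by cases (auto simp: power2_eq_square)
qed

text \<open>Squaring \<open>tri a b c = tri j a b + tri j b c + tri j c a\<close> gives the Arnold relation.\<close>

lemma X_arnold:
  assumes "a \<in> A" "b \<in> A" "c \<in> A" "distinct [a, b, c]"
  shows "X a b * X b c + X b c * X c a + X c a * X a b \<in> J"
proof -
  let ?x = "X a b" and ?y = "X b c" and ?z = "X c a" and ?t = "Var (tri a b c)"
  note K = tri_K[OF jA assms(1,2)] tri_K[OF jA assms(2,3)] tri_K[OF jA assms(3,1)]
  note P = X_polys[OF assms(1,2)] X_polys[OF assms(2,3)] X_polys[OF assms(3,1)]
  have t: "tri a b c = (\<lambda>e. (tri j a b e + tri j b c e) + tri j c a e)"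
    using hvec_swap[of j b] hvec_swap[of j a] hvec_swap[of j c] by (auto simp: tri_def)
  have "(?t - (Var (\<lambda>e. tri j a b e + tri j b c e) + ?z)) +
    (Var (\<lambda>e. tri j a b e + tri j b c e) - (?x + ?y)) \<in> J"
    unfolding t by (intro J_add J_lin_add K K_add)
  then have d: "?t - (?x + ?y + ?z) \<in> J" by (simp add: algebra_simps)
  have "(?t + (?x + ?y + ?z)) * (?t - (?x + ?y + ?z)) \<in> J"
    by (intro J_mult d polys_add polys_Var[OF tri_K] P assms)
  then have "?t ^ 2 - (?t + (?x + ?y + ?z)) * (?t - (?x + ?y + ?z)) - ?x * ?x - ?y * ?y - ?z * ?z \<in> J"
    using assms by (intro J_diff J_tri X_square) auto
  then have "Const (1/2) * (?t ^ 2 - (?t + (?x + ?y + ?z)) * (?t - (?x + ?y + ?z)) - ?x * ?x - ?y * ?y - ?z * ?z) \<in> J"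
    by (rule J_mult[OF polys_Const])
  also have "?t ^ 2 - (?t + (?x + ?y + ?z)) * (?t - (?x + ?y + ?z)) - ?x * ?x - ?y * ?y - ?z * ?z =
    Const 2 * (?x * ?y + ?y * ?z + ?z * ?x)"
  proof -
    have "Const 2 = (2 :: (nat \<times> nat \<Rightarrow> complex) cpoly)" using Const_add[of 1 1] by simp
    then show ?thesis by (simp add: algebra_simps power2_eq_square)
  qed
  finally show ?thesis by (simp add: mult.assoc[symmetric] Const_mult[symmetric])
qed

text \<open>Products over the edges of increasing forests: the head of the list is the youngest
  vertex and is joined to at most one of the older vertices in the tail. The second argument counts
  edges.\<close>

fun trees :: "nat list \<Rightarrow> nat \<Rightarrow> (nat \<times> nat \<Rightarrow> complex) cpoly set" where
  "trees [] d = (if d = 0 then {1} else {})"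
| "trees (c # bs) 0 = trees bs 0"
| "trees (c # bs) (Suc d) = trees bs (Suc d) \<union> (\<Union>a\<in>set bs. (*) (X a c) ` trees bs d)"

lemma trees_0 [simp]: "trees bs 0 = {1}"
  by (induction bs) auto

lemma trees_Cons: "trees bs d \<subseteq> trees (c # bs) d"
  by (cases d) auto

text \<open>A forest on m > 0 vertices has fewer than m edges. The empty list is excluded since it
  carries the empty product.\<close>

lemma trees_empty: "bs \<noteq> [] \<Longrightarrow> length bs \<le> d \<Longrightarrow> trees bs d = {}"
proof (induction bs arbitrary: d)
  case (Cons c bs)
  then obtain e where e: "d = Suc e" "length bs \<le> e" by (cases d) auto
  then have "bs \<noteq> [] \<Longrightarrow> trees bs (Suc e) = {}" "bs \<noteq> [] \<Longrightarrow> trees bs e = {}" using Cons by auto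
  then show ?case using e by (cases "bs = []") auto
qed auto

lemma finite_trees [simp]: "finite (trees bs d)"
  by (induction bs d rule: trees.induct) auto

text \<open>In a spanning tree the youngest vertex has to choose its parent among all older ones,
  which yields the factorial. Only a bound results, since distinct trees might give equal
  products.\<close>

lemma card_trees: "bs \<noteq> [] \<Longrightarrow> card (trees bs (length bs - 1)) \<le> fact (length bs - 1)"
proof (induction bs)
  case (Cons c bs)
  show ?case
  proof (cases "bs = []")
    case False
    then obtain e where e: "length bs = Suc e" by (cases bs) auto
    have "card (trees (c # bs) (Suc e)) \<le> card (\<Union>a\<in>set bs. (*) (X a c) ` trees bs e)"
      using trees_empty[OF False, of "Suc e"] e by simp
    also have "\<dots> \<le> (\<Sum>a\<in>set bs. card ((*) (X a c) ` trees bs e))"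
      by (rule card_UN_le) simp
    also have "\<dots> \<le> (\<Sum>a\<in>set bs. fact e)"
    proof (rule sum_mono)
      fix a
      show "card ((*) (X a c) ` trees bs e) \<le> fact e"
        using card_image_le[of "trees bs e" "(*) (X a c)"] Cons.IH[OF False] e by simp
    qed
    also have "\<dots> \<le> length bs * fact e" using card_length[of bs] by simp
    finally show ?thesis using e by simp
  qed simp
qed simp

text \<open>By induction on the list only the edges at the youngest vertex \<open>c\<close> matter.
  A second edge at \<open>c\<close> either repeats the first, giving a square, or is traded by the
  Arnold relation for an edge between the two older endpoints, which the induction hypothesis
  absorbs.\<close>

lemma trees_mult:
  assumes "distinct bs" "set bs \<subseteq> A" "a \<in> set bs" "b \<in> set bs" "p \<in> jspan (trees bs d)"
  shows "X a b * p \<in> jspan (trees bs (Suc d))"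
  using assms
proof (induction bs arbitrary: a b p d)
  case (Cons c bs)
  let ?T = "\<lambda>d. jspan (trees (c # bs) d)"
  have cA: "c \<in> A" and bsA: "set bs \<subseteq> A" and dist: "distinct bs" "c \<notin> set bs" using Cons.prems by auto
  have lift: "q \<in> ?T d" if "q \<in> jspan (trees bs d)" for q d
    by (rule jspan_mono[OF that]) (use trees_Cons[of bs d c] in \<open>auto intro: jspan.base\<close>)
  have Xc: "X e c * q \<in> ?T (Suc d)" if "q \<in> jspan (trees bs d)" "e \<in> set bs" for q d e
    by (rule jspan_mult[OF that(1)]) (use that bsA cA X_polys in \<open>auto intro!: jspan.base\<close>)
  have neg: "X b a * p \<in> jspan S" if "X a b * p \<in> jspan S" "p \<in> polys K" "a \<in> A" "b \<in> A" for a b p S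
  proof (rule jspan_cong[OF jspan_uminus[OF that(1)]])
    have "p * (X b a + X a b) \<in> J" by (intro J_mult X_neg that)
    then show "X b a * p - - (X a b * p) \<in> J" by (simp add: algebra_simps)
  qed
  have treesP: "p \<in> polys K" if "p \<in> trees bs d" "set bs \<subseteq> A" for p bs d
    using that by (induction bs d arbitrary: p rule: trees.induct) (auto split: if_splits intro!: polys_mult X_polys)
  have Xnew: "X a c * s \<in> ?T (Suc d)" if a: "a \<in> set bs" and s: "s \<in> trees (c # bs) d" for a s d
  proof -
    consider "s \<in> trees bs d" | e m d' where "d = Suc d'" "e \<in> set bs" "m \<in> trees bs d'" "s = X e c * m"
      using s by (cases d) auto
    then show ?thesis
    proof cases
      case 1
      then show ?thesis using Xc a jspan.base by blast
    next
      case 2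
      have mP: "m \<in> polys K" using treesP 2 bsA by blast
      have aA: "a \<in> A" "e \<in> A" using a 2 bsA by auto
      show ?thesis
      proof (cases "a = e")
        case True
        have "m * (X a c * X a c) \<in> J" by (intro J_mult X_square mP aA cA)
        then show ?thesis using True 2 by (intro jspan.ideal) (simp add: mult_ac)
      next
        case False
        have ea: "X e a * m \<in> jspan (trees bs d)"
          using Cons.IH[OF dist(1) bsA _ a jspan.base] 2 by blast
        \<comment> \<open>The Arnold relation for \<open>a\<close>, \<open>c\<close>,
          \<open>e\<close>, with \<open>X c e\<close> replaced by the negative of
          \<open>X e c\<close>, rewrites the product of the two edges at \<open>c\<close> as a
          difference of products with a single edge at \<open>c\<close>.\<close>
        let ?r = "X a c * (X e a * m) - X e c * (X e a * m)"
        have r: "?r \<in> ?T (Suc d)" by (intro jspan_diff Xc ea a 2)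
        have "m * (X a c * X c e + X c e * X e a + X e a * X a c) - m * X a c * (X c e + X e c)
          - m * X e a * (X c e + X e c) \<in> J"
          using False dist a 2 aA cA mP
          by (intro J_diff J_mult X_arnold X_neg polys_mult X_polys) auto
        then have "- (m * (X a c * X c e + X c e * X e a + X e a * X a c) - m * X a c * (X c e + X e c)
          - m * X e a * (X c e + X e c)) \<in> J" by (rule J_uminus)
        also have "- (m * (X a c * X c e + X c e * X e a + X e a * X a c) - m * X a c * (X c e + X e c)
          - m * X e a * (X c e + X e c)) = X a c * s - ?r"
          unfolding 2(4) by (simp add: algebra_simps)
        finally show ?thesis by (rule jspan_cong[OF r])
      qed
    qed
  qed
  have old: "X a b * s \<in> ?T (Suc d)" if "a \<in> set bs" "b \<in> set bs" and s: "s \<in> trees (c # bs) d" for a b s d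
  proof -
    consider "s \<in> trees bs d" | e m d' where "d = Suc d'" "e \<in> set bs" "m \<in> trees bs d'" "s = X e c * m"
      using s by (cases d) auto
    then show ?thesis
    proof cases
      case 1
      then show ?thesis using lift Cons.IH[OF dist(1) bsA that(1,2)] jspan.base by blast
    next
      case 2
      have "X a b * m \<in> jspan (trees bs d)"
        using Cons.IH[OF dist(1) bsA that(1,2) jspan.base] 2 by blast
      from Xc[OF this 2(2)] show ?thesis using 2 by (simp add: mult_ac)
    qed
  qed
  have gen: "X a b * s \<in> ?T (Suc d)" if s: "s \<in> trees (c # bs) d" for s
  proof -
    have sP: "s \<in> polys K" using treesP[OF s] Cons.prems by blast
    consider "a = c" "b = c" | "a \<in> set bs" "b = c" | "a = c" "b \<in> set bs" | "a \<in> set bs" "b \<in> set bs"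
      using Cons.prems by auto
    then show ?thesis
    proof cases
      case 1
      then have "s * X a b \<in> J" by (auto intro: J_mult sP X_same cA)
      then show ?thesis by (intro jspan.ideal) (simp add: mult.commute)
    next
      case 2
      then show ?thesis using Xnew s by blast
    next
      case 3
      have "X c b * s \<in> ?T (Suc d)"
        by (rule neg[OF Xnew[OF 3(2) s] sP]) (use 3 cA bsA in auto)
      then show ?thesis using 3 by simp
    next
      case 4
      then show ?thesis using old s by blast
    qed
  qed
  have abP: "X a b \<in> polys K" using Cons.prems X_polys by (meson subsetD)
  show ?case by (rule jspan_mult[OF Cons.prems(5) abP gen])
qed auto

text \<open>Expanding \<open>u\<close> in triangles through \<open>j\<close>, those with another
  vertex equal to \<open>j\<close> lie in the ideal and the remaining nonzero coefficients belong to
  edges inside \<open>bs\<close>. Admitting a short list \<open>bs\<close> keeps the powers of a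
  flow within forests on its own support.\<close>

lemma Var_mult_trees:
  assumes bs: "distinct bs" "set bs \<subseteq> A" and u: "u \<in> K"
    and supp: "\<And>a b. a \<in> A \<Longrightarrow> b \<in> A \<Longrightarrow> antisym_part u a b \<noteq> 0 \<Longrightarrow> a = j \<or> a \<in> set bs"
    and p: "p \<in> jspan (trees bs d)" "p \<in> polys K"
  shows "Var u * p \<in> jspan (trees bs (Suc d))"
proof -
  let ?I = "A \<times> A"
  let ?c = "\<lambda>(a, b). antisym_part u a b / 2" and ?f = "\<lambda>(a, b). tri j a b"
  let ?s = "\<Sum>i\<in>?I. Const (?c i) * Var (?f i)"
  have "Var (\<lambda>e. \<Sum>i\<in>?I. ?c i * ?f i e) - ?s \<in> J"
    by (rule Var_sum) (auto intro!: tri_K jA)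
  also have "(\<lambda>e. \<Sum>i\<in>?I. ?c i * ?f i e) = u"
    using K_tri_expand[OF u jA] by (simp add: sum.cartesian_product case_prod_beta)
  finally have d: "Var u - ?s \<in> J" .
  have "?s * p = (\<Sum>i\<in>?I. Const (?c i) * (Var (?f i) * p))"
    by (simp add: sum_distrib_right mult.assoc)
  also have "\<dots> \<in> jspan (trees bs (Suc d))"
  proof (intro jspan_sum)
    fix i assume "i \<in> ?I"
    then obtain a b where ab: "i = (a, b)" "a \<in> A" "b \<in> A" by auto
    consider "antisym_part u a b = 0" | "a = j" | "b = j" | "a \<in> set bs" "b \<in> set bs"
      using supp[OF ab(2,3)] supp[OF ab(3,2)] antisym_part_swap[of u a b] by fastforce
    then show "Const (?c i) * (Var (?f i) * p) \<in> jspan (trees bs (Suc d))"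
    proof cases
      case 1
      then show ?thesis using ab by (auto intro: jspan.ideal J_zero)
    next
      case 2
      then have "p * X a b \<in> J" using X_base ab p by (auto intro: J_mult)
      then show ?thesis using ab by (intro jspan.scale jspan.ideal) (simp add: mult.commute)
    next
      case 3
      then have "p * X a b \<in> J" using X_base ab p by (auto intro: J_mult)
      then show ?thesis using ab by (intro jspan.scale jspan.ideal) (simp add: mult.commute)
    next
      case 4
      then show ?thesis using ab trees_mult[OF bs 4 p(1)] by (intro jspan.scale) simp
    qed
  qed
  finally have s: "?s * p \<in> jspan (trees bs (Suc d))" .
  have "p * (Var u - ?s) \<in> J" by (intro J_mult d p)
  then show ?thesis by (intro jspan_cong[OF s]) (simp add: algebra_simps)
qed

lemma Var_power_trees:
  assumes bs: "distinct bs" "set bs \<subseteq> A" and u: "u \<in> K"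
    and supp: "\<And>a b. a \<in> A \<Longrightarrow> b \<in> A \<Longrightarrow> antisym_part u a b \<noteq> 0 \<Longrightarrow> a = j \<or> a \<in> set bs"
    and p: "p \<in> jspan (trees bs d)" "p \<in> polys K"
  shows "Var u ^ k * p \<in> jspan (trees bs (k + d))"
proof (induction k)
  case (Suc k)
  then show ?case
    using Var_mult_trees[OF bs u supp Suc] u p by (simp add: mult.assoc)
qed (use p in simp)

lemma homogeneous_trees:
  assumes bs: "distinct bs" "set bs = A - {j}" and p: "p \<in> polys K" "homogeneous d p"
  shows "p \<in> jspan (trees bs d)"
proof -
  have mv: "(\<Prod>u\<in>S. Var u ^ k u) \<in> jspan (trees bs (\<Sum>u\<in>S. k u))" if "finite S" "S \<subseteq> K" for S and k :: "_ \<Rightarrow> nat"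
    using that
  proof (induction S rule: finite_induct)
    case empty
    then show ?case by (auto intro: jspan.base)
  next
    case (insert u S)
    have "Var u ^ k u * (\<Prod>u\<in>S. Var u ^ k u) \<in> jspan (trees bs (k u + (\<Sum>u\<in>S. k u)))"
      by (rule Var_power_trees) (use bs insert in \<open>auto intro!: polys_prod polys_power polys_Var\<close>)
    then show ?case using insert by simp
  qed
  have "(\<Sum>m\<in>pkeys p. Const (plook p m) * mono_val Var m) \<in> jspan (trees bs d)"
  proof (intro jspan_sum jspan.scale)
    fix m assume m: "m \<in> pkeys p"
    then have "mdeg m = d" "pkeys m \<subseteq> K" using p by (auto simp: homogeneous_def polys_def)
    then show "mono_val Var m \<in> jspan (trees bs d)"
      using mv[of "pkeys m" "plook m"] by (simp add: mono_val_def)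
  qed
  then show ?thesis using poly_expand[of p] by simp
qed

end

section \<open>Powers of flows and the support graph\<close>

lemma (in braid_words) rho_braid_dual:
  assumes "u \<in> K"
  shows "rho (braid_dual n) u = card {e \<in> idx. u e \<noteq> 0}"
proof -
  have "filter_mset (\<lambda>H. u \<notin> H) (braid_dual n) =
    image_mset (\<lambda>e. {u \<in> K. u e = 0}) (filter_mset (\<lambda>e. u \<notin> {u \<in> K. u e = 0}) (mset_set idx))"
    by (simp add: braid_dual_def filter_mset_image_mset)
  also have "filter_mset (\<lambda>e. u \<notin> {u \<in> K. u e = 0}) (mset_set idx) = mset_set {e \<in> idx. u e \<noteq> 0}"
    using assms by (simp add: filter_mset_mset_set)
  finally show ?thesis by (simp add: rho_def)
qed

text \<open>Every vertex of the support graph of a flow has degree at least two.\<close>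

lemma (in braid_words) card_support_vertices:
  assumes u: "u \<in> K"
  defines "S \<equiv> {a \<in> A. \<exists>b\<in>A. antisym_part u a b \<noteq> 0}"
  shows "card S \<le> rho (braid_dual n) u"
proof -
  let ?E = "{e \<in> idx. u e \<noteq> 0}"
  define N where "N = (\<lambda>a. {b \<in> A. antisym_part u a b \<noteq> 0})"
  have finE: "finite ?E" by simp
  have N2: "2 \<le> card (N a)" if a: "a \<in> S" for a
  proof -
    obtain b where b: "b \<in> N a" using a by (auto simp: S_def N_def)
    \<comment> \<open>A single edge at \<open>a\<close> cannot carry a balanced flow.\<close>
    have "N a \<noteq> {b}"
    proof
      assume e: "N a = {b}"
      have "(\<Sum>c\<in>A. antisym_part u a c) = (\<Sum>c\<in>N a. antisym_part u a c)"
        by (rule sum.mono_neutral_right) (auto simp: N_def)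
      also have "\<dots> = antisym_part u a b" unfolding e by simp
      finally show False using K_row_sum[OF u, of a] a b by (simp add: S_def N_def)
    qed
    then have "{b} \<subset> N a" using b by blast
    moreover have "finite (N a)" by (simp add: N_def)
    ultimately have "card {b} < card (N a)" by (intro psubset_card_mono)
    then show ?thesis by simp
  qed
  \<comment> \<open>Double counting of the pairs of adjacent vertices: each edge occurs in its two
    orientations.\<close>
  have "2 * card S = (\<Sum>a\<in>S. 2)" by simp
  also have "\<dots> \<le> (\<Sum>a\<in>S. card (N a))" by (rule sum_mono) (rule N2)
  also have "\<dots> = card (Sigma S N)" by (rule card_SigmaI[symmetric]) (auto simp: S_def N_def)
  also have "\<dots> \<le> card (?E \<union> prod.swap ` ?E)"
  proof (rule card_mono)
    show "Sigma S N \<subseteq> ?E \<union> prod.swap ` ?E"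
    proof
      fix e assume "e \<in> Sigma S N"
      then obtain a b where e: "e = (a, b)" "u (a, b) - u (b, a) \<noteq> 0" by (auto simp: N_def antisym_part_def)
      then have "u (a, b) \<noteq> 0 \<or> u (b, a) \<noteq> 0" by auto
      then show "e \<in> ?E \<union> prod.swap ` ?E"
      proof
        assume "u (a, b) \<noteq> 0"
        then have "(a, b) \<in> ?E" using K_off[OF u] by blast
        then show ?thesis using e by blast
      next
        assume "u (b, a) \<noteq> 0"
        then have "(b, a) \<in> ?E" using K_off[OF u] by blast
        then have "prod.swap (b, a) \<in> prod.swap ` ?E" by (rule imageI)
        then show ?thesis using e by simp
      qed
    qed
  qed simp
  also have "\<dots> \<le> card ?E + card (prod.swap ` ?E)" by (rule card_Un_le)
  also have "\<dots> \<le> card ?E + card ?E" by (intro add_left_mono card_image_le finE)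
  finally show ?thesis using rho_braid_dual[OF u] by simp
qed

text \<open>The base vertex is taken in the support of \<open>u\<close> and so depends on
  \<open>u\<close>. It leaves \<open>card S - 1\<close> vertices for the forests, and the exponent
  is at least this number, so no forest has enough edges.\<close>

lemma (in triangle_ideal) Var_power_rho:
  assumes u: "u \<in> K" and u0: "u \<noteq> (\<lambda>e. 0)"
  shows "Var u ^ (rho (braid_dual n) u - 1) \<in> J"
proof -
  define S where "S = {a \<in> A. \<exists>b\<in>A. antisym_part u a b \<noteq> 0}"
  obtain e where e: "u e \<noteq> 0" using u0 by (metis ext)
  then have ei: "e \<in> idx" using K_off[OF u] by blast
  define j k where "j = fst e" and "k = snd e"
  have jk: "j \<in> A" "k \<in> A" "j \<noteq> k" using idx_mem[OF ei] ei by (auto simp: j_def k_def braid_index_def)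
  have a: "antisym_part u j k \<noteq> 0" using antisym_part_eq[OF ei K_off[OF u]] e by (simp add: j_def k_def)
  then have a': "antisym_part u k j \<noteq> 0" using antisym_part_swap[of u k j] by simp
  have jS: "j \<in> S" and kS: "k \<in> S" unfolding S_def using jk a a' by blast+
  interpret star_base n J j by unfold_locales (rule jk(1))
  have finS: "finite S" by (simp add: S_def)
  define bs where "bs = sorted_list_of_set (S - {j})"
  have bs: "distinct bs" "set bs = S - {j}" using finS by (simp_all add: bs_def)
  have "k \<in> set bs" unfolding bs(2) using kS jk(3) by simp
  then have ne: "bs \<noteq> []" by (metis empty_iff list.set(1))
  have len: "length bs = card S - 1" using distinct_card[OF bs(1)] bs(2) jS finS by simp
  have "Var u ^ (rho (braid_dual n) u - 1) * 1 \<in> jspan (trees bs (rho (braid_dual n) u - 1 + 0))"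
  proof (rule Var_power_trees[OF bs(1) _ u])
    show "set bs \<subseteq> A" unfolding bs(2) S_def by blast
    show "1 \<in> jspan (trees bs 0)" by (rule jspan.base) simp
    fix a b assume "a \<in> A" "b \<in> A" "antisym_part u a b \<noteq> 0"
    then show "a = j \<or> a \<in> set bs" unfolding bs(2) S_def by blast
  qed simp
  moreover have "trees bs (rho (braid_dual n) u - 1 + 0) = {}"
  proof (rule trees_empty[OF ne])
    have "card S \<le> rho (braid_dual n) u" using card_support_vertices[OF u] unfolding S_def .
    then show "length bs \<le> rho (braid_dual n) u - 1 + 0" using len by simp
  qed
  ultimately show ?thesis using jspan_empty by simp
qed

section \<open>The top degree functional\<close>

context braid_words
begin

definition evp :: "nat list \<Rightarrow> (nat \<times> nat \<Rightarrow> complex) cpoly \<Rightarrow> complex poly" where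
  "evp l p = insertion (\<lambda>c. [:c:]) (\<lambda>u. [:0, eps l u:]) p"

text \<open>A polynomial on \<open>K\<close> is evaluated at the functionals \<open>t * eps l\<close>, one for each cyclic word \<open>l\<close>,
  which take the values \<open>t\<close> and \<open>- t\<close> on triangles. A triangle squared contributes \<open>t\<^sup>2\<close>, so
  what remains of its multiples has too low a degree for the Lie polynomial.\<close>

definition T :: "(nat \<times> nat \<Rightarrow> complex) cpoly \<Rightarrow> nat list \<Rightarrow> complex" where
  "T p w = (if w \<in> W then lie (butlast w) (\<lambda>y. coeff (evp (y @ [last w]) p) (n - 2)) else 0)"

lemma T_add: "T (p + q) = (\<lambda>w. T p w + T q w)"
  by (rule ext) (simp add: T_def evp_def monom0.insertion_add lie_add)

lemma T_Const: "T (Const c * p) = (\<lambda>w. c * T p w)"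
  by (rule ext) (simp add: T_def evp_def monom0.insertion_mult lie_scale)

lemma T_zero: "T 0 = (\<lambda>w. 0)"
  by (rule ext) (simp add: T_def evp_def)

lemma T_diff: "T (p - q) = (\<lambda>w. T p w - T q w)"
  using T_add[of "p - q" q] by (auto simp: fun_eq_iff)

lemma T_sum: "T (\<Sum>i\<in>I. f i) = (\<lambda>w. \<Sum>i\<in>I. T (f i) w)"
  by (induction I rule: infinite_finite_induct) (auto simp: T_add T_zero)

lemma Low_coeff_mult:
  assumes "\<And>d. Low B (Suc d) (\<lambda>y. coeff (f y) d)" "\<And>d. Low B (Suc d) (\<lambda>y. coeff (g y) d)"
  shows "Low B (Suc d) (\<lambda>y. coeff (f y * g y) d)"
  unfolding coeff_mult
proof (rule Low_sum)
  fix i assume "i \<in> {..d}"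
  then have "i + (d - i) = d" by simp
  then show "Low B (Suc d) (\<lambda>y. coeff (f y) i * coeff (g y) (d - i))"
    using Low.mult[OF assms(1)[of i] assms(2)[of "d - i"]] by simp
qed

lemma Low_coeff_const: "Low B (Suc d) (\<lambda>y. coeff p d)"
  by (rule Low_const) simp

lemma Low_coeff_prod:
  "(\<And>i d. i \<in> I \<Longrightarrow> Low B (Suc d) (\<lambda>y. coeff (f i y) d)) \<Longrightarrow>
    Low B (Suc d) (\<lambda>y. coeff (\<Prod>i\<in>I. f i y) d)"
proof (induction I arbitrary: d rule: infinite_finite_induct)
  case (insert x F)
  have "Low B (Suc d) (\<lambda>y. coeff (f x y * (\<Prod>i\<in>F. f i y)) d)"
    by (rule Low_coeff_mult) (use insert in auto)
  then show ?case using insert by simp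
qed (use Low_coeff_const[of B _ 1] in auto)

text \<open>Each variable contributes one factor of the indeterminate together with one linear form
  in signs, so the coefficient of degree \<open>d\<close> is a polynomial of degree at most
  \<open>d\<close> in the signs.\<close>

lemma Low_coeff_evp:
  assumes "z \<in> A"
  shows "Low (A - {z}) (Suc d) (\<lambda>y. coeff (evp (y @ [z]) p) d)"
proof -
  have v: "Low (A - {z}) (Suc d) (\<lambda>y. coeff [:0, eps (y @ [z]) u:] d)" for u d
  proof -
    consider "d = 0" | "d = 1" | "d > 1" by linarith
    then show ?thesis
    proof cases
      case 2
      have "Low (A - {z}) (Suc (Suc 0)) (\<lambda>y. eps (y @ [z]) u)"
        unfolding eps_def using assms idx_mem by (intro Low_sum Low_scale Low_sg_snoc) auto
      moreover have "coeff [:0, eps (y @ [z]) u:] d = eps (y @ [z]) u" for y using 2 by simp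
      ultimately show ?thesis using 2 by (simp only: One_nat_def)
    next
      case 3
      then have "coeff [:0, eps (y @ [z]) u:] d = 0" for y
        by (intro coeff_eq_0) (simp add: degree_pCons_eq_if)
      then show ?thesis by (simp only: Low_zero)
    qed (simp add: Low_zero)
  qed
  have pw: "Low (A - {z}) (Suc d) (\<lambda>y. coeff ([:0, eps (y @ [z]) u:] ^ k) d)" for u k d
  proof (induction k arbitrary: d)
    case 0
    show ?case unfolding power_0 by (rule Low_coeff_const)
  next
    case (Suc k)
    show ?case unfolding power_Suc by (rule Low_coeff_mult[OF v Suc])
  qed
  have "Low (A - {z}) (Suc d) (\<lambda>y. coeff ([:plook p m:] * mono_val (\<lambda>u. [:0, eps (y @ [z]) u:]) m) d)" for m
    unfolding mono_val_def by (rule Low_coeff_mult[OF Low_coeff_const Low_coeff_prod[OF pw]])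
  then show ?thesis unfolding evp_def insertion_def coeff_sum by (rule Low_sum)
qed

lemma sg_cyclic_square:
  assumes "l \<in> W" "a \<in> A" "b \<in> A" "c \<in> A" "distinct [a, b, c]"
  shows "(sg l a b + sg l b c + sg l c a) ^ 2 = 1"
proof -
  have r: "rot_to c l \<in> W" by (rule rot_to_words[OF assms(1,4)])
  have "a \<in> set (rot_to c l)" using r assms(2) by (simp add: words_def)
  then have v: "sg (rot_to c l) a b = 1 \<or> sg (rot_to c l) a b = - 1"
    using assms(5) by (intro sg_cases) auto
  have e: "sg (rot_to c l) a b = sg l a b + sg l b c + sg l c a"
    by (rule sg_rot_to[OF assms(1-4)]) (use assms(5) in auto)
  show ?thesis unfolding e[symmetric] using v by auto
qed

lemma T_tri:
  assumes "a \<in> A" "b \<in> A" "c \<in> A" "distinct [a, b, c]"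
  shows "T (q * Var (tri a b c) ^ 2) w = 0"
proof (cases "w \<in> W")
  case True
  let ?z = "last w"
  have z: "?z \<in> A" using words_last_in[OF True] n3 by auto
  have wb: "butlast w \<in> words (A - {?z})" using words_butlast[OF True] n3 by auto
  have ev: "evp l (q * Var (tri a b c) ^ 2) = monom 1 2 * evp l q" if "l \<in> W" for l
  proof -
    have "[:0, x::complex:] ^ 2 = monom (x ^ 2) 2" for x
      by (simp add: power2_eq_square monom_altdef numeral_2_eq_2)
    then have "[:0, eps l (tri a b c):] ^ 2 = monom 1 2"
      using eps_tri[OF assms(1-3)] sg_cyclic_square[OF that assms] by simp
    then show ?thesis by (simp add: evp_def monom0.insertion_mult monom0.insertion_power mult.commute)
  qed
  \<comment> \<open>For \<open>n = 3\<close> the square of the indeterminate already exceeds the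
    degree \<open>n - 2\<close>; truncated subtraction makes this a case of its own.\<close>
  have "T (q * Var (tri a b c) ^ 2) w = lie (butlast w) (\<lambda>y. if n - 2 < 2 then 0 else coeff (evp (y @ [?z]) q) (n - 2 - 2))"
    unfolding T_def if_P[OF True]
  proof (rule lie_cong)
    fix y assume "y \<in> words (set (butlast w))"
    then have "y @ [?z] \<in> W" using wb words_snoc'[OF z] by (simp add: words_def)
    then show "coeff (evp (y @ [?z]) (q * Var (tri a b c) ^ 2)) (n - 2) =
        (if n - 2 < 2 then 0 else coeff (evp (y @ [?z]) q) (n - 2 - 2))"
      by (simp add: ev coeff_monom_mult)
  qed (use wb in \<open>simp add: words_def\<close>)
  also have "\<dots> = 0"
  proof (cases "n - 2 < 2")
    case False
    have "lie (butlast w) (\<lambda>y. coeff (evp (y @ [?z]) q) (n - 2 - 2)) = 0"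
      by (rule lie_Low[where d = "Suc (n - 2 - 2)"])
        (use wb Low_coeff_evp[OF z, of "n - 2 - 2" q] False W_length[OF True] in \<open>auto simp: words_def\<close>)
    then show ?thesis using False by simp
  qed simp
  finally show ?thesis .
qed (simp add: T_def)

text \<open>The generators come with an arbitrary polynomial factor instead of a closure rule for
  multiplication: \<open>T\<close> is additive but not multiplicative, so its vanishing can be
  propagated by induction only in this form.\<close>

inductive_set tideal :: "(nat \<times> nat \<Rightarrow> complex) cpoly set" where
  lin_add: "q \<in> polys K \<Longrightarrow> u \<in> K \<Longrightarrow> v \<in> K \<Longrightarrow> q * (Var (\<lambda>e. u e + v e) - (Var u + Var v)) \<in> tideal"
| lin_scale: "q \<in> polys K \<Longrightarrow> u \<in> K \<Longrightarrow> q * (Var (\<lambda>e. z * u e) - Const z * Var u) \<in> tideal"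
| tri_square: "q \<in> polys K \<Longrightarrow> a \<in> A \<Longrightarrow> b \<in> A \<Longrightarrow> c \<in> A \<Longrightarrow> distinct [a, b, c] \<Longrightarrow>
    q * Var (tri a b c) ^ 2 \<in> tideal"
| add: "p \<in> tideal \<Longrightarrow> q \<in> tideal \<Longrightarrow> p + q \<in> tideal"

lemma tideal_polys: "p \<in> tideal \<Longrightarrow> p \<in> polys K"
  by (induction rule: tideal.induct)
    (auto intro!: polys_mult polys_diff polys_add polys_power polys_Var K_add K_scale tri_K)

lemma tideal_mult: "p \<in> tideal \<Longrightarrow> q \<in> polys K \<Longrightarrow> q * p \<in> tideal"
proof (induction rule: tideal.induct)
  case (lin_add r u v)
  then show ?case using tideal.lin_add[of "q * r" u v] by (simp add: mult.assoc polys_mult)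
next
  case (lin_scale r u z)
  then show ?case using tideal.lin_scale[of "q * r" u z] by (simp add: mult.assoc polys_mult)
next
  case (tri_square r a b c)
  then show ?case using tideal.tri_square[of "q * r" a b c] by (simp add: mult.assoc polys_mult)
next
  case (add p r)
  then show ?case by (simp add: distrib_left tideal.add)
qed

sublocale tri: triangle_ideal n tideal
proof
  show "Var (\<lambda>e. u e + v e) - (Var u + Var v) \<in> tideal" if "u \<in> K" "v \<in> K" for u v
    using tideal.lin_add[OF polys_one that] by simp
  show "Var (\<lambda>e. z * u e) - Const z * Var u \<in> tideal" if "u \<in> K" for u z
    using tideal.lin_scale[OF polys_one that] by simp
  show "Var (tri a b c) ^ 2 \<in> tideal" if "a \<in> A" "b \<in> A" "c \<in> A" "distinct [a, b, c]" for a b c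
    using tideal.tri_square[OF polys_one that] by simp
qed (auto intro: tideal_polys tideal_mult tideal.add)

lemma T_tideal: "p \<in> tideal \<Longrightarrow> T p = (\<lambda>w. 0)"
proof (induction rule: tideal.induct)
  case (tri_square q a b c)
  then show ?case using T_tri by (intro ext) blast
next
  case (add p q)
  then show ?case by (simp add: T_add)
qed (rule ext; simp add: T_def evp_def monom0.insertion_mult monom0.insertion_diff monom0.insertion_add
    eps_add eps_scale)+

lemma T_rename:
  assumes g: "g permutes A" and w: "w \<in> W"
  shows "T (rename_vars (kact g) p) w = T p (map (Hilbert_Choice.inv g) w)"
proof -
  let ?h = "Hilbert_Choice.inv g"
  have h: "?h permutes A" using g by (rule permutes_inv)
  have hw: "map ?h w \<in> W"
    using w h permutes_image[OF h] permutes_inj_on[OF h] by (simp add: words_def distinct_map)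
  have ev: "evp l (rename_vars (kact g) p) = evp (map ?h l) p" for l
    by (simp add: evp_def rename_vars_eq monom0.insertion_insertion eps_kact[OF g])
  show ?thesis using w hw W_ne[OF w]
    by (simp add: T_def map_butlast[symmetric] last_map lie_map ev)
qed

text \<open>The path visiting the letters of \<open>w\<close> but the last, which serves as base
  vertex: n - 2 triangles, one for each edge. Such paths are preimages, up to a scalar, of the
  functions \<open>Q w\<close> under \<open>T\<close>.\<close>

definition chain_poly :: "nat list \<Rightarrow> (nat \<times> nat \<Rightarrow> complex) cpoly" where
  "chain_poly w = (\<Prod>i<n - 2. Var (tri (last w) (w ! i) (w ! Suc i)))"

lemma chain_poly_nth:
  assumes "w \<in> W" "i < n - 2"
  shows "last w \<in> A" "w ! i \<in> A" "w ! Suc i \<in> A" "w ! i \<noteq> last w" "w ! Suc i \<noteq> last w" "w ! i \<noteq> w ! Suc i"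
proof -
  have l: "length w = n" "distinct w" "set w = A" "w \<noteq> []" using W_length W_ne assms by (auto simp: words_def)
  have k: "last w = w ! (n - 1)" using l by (simp add: last_conv_nth)
  show "last w \<in> A" using l last_in_set by blast
  show "w ! i \<in> A" "w ! Suc i \<in> A" using l assms nth_mem[of i w] nth_mem[of "Suc i" w] by auto
  show "w ! i \<noteq> last w" "w ! Suc i \<noteq> last w" "w ! i \<noteq> w ! Suc i"
    using l assms k by (auto simp: nth_eq_iff_index_eq)
qed

lemma chain_poly_polys: "w \<in> W \<Longrightarrow> chain_poly w \<in> polys K"
  unfolding chain_poly_def by (intro polys_prod polys_Var tri_K chain_poly_nth) auto

lemma chain_poly_homogeneous: "homogeneous (n - 2) (chain_poly w)"
  using homogeneous_prod_Var[of "{..<n - 2}"] by (simp add: chain_poly_def)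

text \<open>Only leading terms matter: replacing each factor \<open>2 * b - 1\<close> by
  \<open>2 * b\<close> costs terms of lower degree. This is the origin of the power of 2 relating
  signs to indicators.\<close>

lemma Low_prod_affine:
  assumes "\<And>i. i < k \<Longrightarrow> Low B (Suc (Suc 0)) (b i)"
  shows "Low B k (\<lambda>y. (\<Prod>i<k. 2 * b i y - 1) - 2 ^ k * (\<Prod>i<k. b i y))"
  using assms
proof (induction k)
  case (Suc k)
  let ?P = "\<lambda>y. \<Prod>i<k. 2 * b i y - 1" and ?B = "\<lambda>y. \<Prod>i<k. b i y"
  have b: "Low B (Suc (Suc 0)) (\<lambda>y. 2 * b k y - 1)"
    using Suc.prems by (intro Low_diff Low_scale Low_const) auto
  have "Low B (Suc (\<Sum>i<k. 1)) (\<lambda>y. \<Prod>i<k. b i y)"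
    by (rule Low_prod) (use Suc.prems in auto)
  then have "Low B (Suc k) (\<lambda>y. 2 ^ k * ?B y)" by (intro Low_scale) simp
  moreover have "Low B (Suc k) (\<lambda>y. (2 * b k y - 1) * (?P y - 2 ^ k * ?B y))"
    using Low_mult_0[OF b Suc.IH] Suc.prems by simp
  ultimately have "Low B (Suc k) (\<lambda>y. (2 * b k y - 1) * (?P y - 2 ^ k * ?B y) - 2 ^ k * ?B y)"
    by (rule Low_diff[rotated])
  then show ?case by (simp add: algebra_simps)
qed (simp add: Low_zero)

text \<open>The product of the factors \<open>(1 + x\<^sub>i) / 2\<close>, with \<open>x\<^sub>i\<close> the value of the \<open>i\<close>-th triangle,
  is the indicator function of the cyclic word \<open>w\<close>; the lower order terms are killed by the Lie
  polynomial.\<close>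

lemma T_chain_poly:
  assumes w: "w \<in> W" and x: "x \<in> W"
  shows "T (chain_poly w) x = 2 ^ (n - 2) * Q w x"
proof -
  let ?z = "last x" and ?j = "last w"
  define b where "b = (\<lambda>i y. before (w ! i) (w ! Suc i) (rot_to ?j (y @ [?z])))"
  have z: "?z \<in> A" using words_last_in[OF x] n3 by auto
  have j: "?j \<in> A" using words_last_in[OF w] n3 by auto
  have xb: "butlast x \<in> words (A - {?z})" using words_butlast[OF x] n3 by auto
  have lowb: "Low (A - {?z}) (Suc (Suc 0)) (b i)" if "i < n - 2" for i
    unfolding b_def before_def by (intro Low_before chain_poly_nth[OF w that] z)
  have c: "coeff (evp (y @ [?z]) (chain_poly w)) (n - 2) = (\<Prod>i<n - 2. 2 * b i y - 1)"
    if "y \<in> words (A - {?z})" for y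
  proof -
    have yz: "y @ [?z] \<in> W" using words_snoc'[OF z that] .
    have r: "rot_to ?j (y @ [?z]) \<in> W" by (rule rot_to_words[OF yz j])
    have P: "(\<Prod>i<k. [:0, f i:]) = monom (\<Prod>i<k. f i) k" for f :: "nat \<Rightarrow> complex" and k
    proof (induction k)
      case (Suc k)
      have x: "[:0, f k:] = monom (f k) 1" by (simp add: monom_Suc monom_0)
      show ?case unfolding prod.lessThan_Suc Suc x mult_monom by simp
    qed simp
    have "evp (y @ [?z]) (chain_poly w) = monom (\<Prod>i<n - 2. eps (y @ [?z]) (tri ?j (w ! i) (w ! Suc i))) (n - 2)"
      by (simp add: evp_def chain_poly_def monom0.insertion_prod P)
    moreover have "eps (y @ [?z]) (tri ?j (w ! i) (w ! Suc i)) = 2 * b i y - 1" if i: "i < n - 2" for i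
    proof -
      note h = chain_poly_nth[OF w i]
      have "eps (y @ [?z]) (tri ?j (w ! i) (w ! Suc i)) = sg (rot_to ?j (y @ [?z])) (w ! i) (w ! Suc i)"
        unfolding sg_rot_to[OF yz h(2,3,1,4,5,6)] eps_tri[OF h(1,2,3)] by simp
      moreover have "w ! i \<in> set (rot_to ?j (y @ [?z]))" using r h(2) by (simp add: words_def)
      then have "sg (rot_to ?j (y @ [?z])) (w ! i) (w ! Suc i) = 1 \<or> sg (rot_to ?j (y @ [?z])) (w ! i) (w ! Suc i) = - 1"
        using h(6) by (intro sg_cases) auto
      ultimately show ?thesis by (auto simp: b_def before_def)
    qed
    ultimately show ?thesis by simp
  qed
  have ind: "(\<Prod>i<n - 2. b i y) = of_bool (rot_to ?z w = y @ [?z])" if "y \<in> words (A - {?z})" for y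
  proof -
    have yz: "y @ [?z] \<in> W" using words_snoc'[OF z that] .
    let ?r = "rot_to ?j (y @ [?z])"
    have r: "?r \<in> W" by (rule rot_to_words[OF yz j])
    have lw: "length w = n" "w \<noteq> []" using W_length[OF w] W_ne[OF w] by auto
    have "(\<Prod>i<n - 2. b i y) = of_bool (\<forall>i<n - 2. sg ?r (w ! i) (w ! Suc i) = 1)"
      unfolding b_def by (subst prod_before) auto
    \<comment> \<open>The missing comparison, \<open>i = n - 2\<close>, is with the letter
      \<open>?j\<close> in which the rotated word ends.\<close>
    also have "(\<forall>i<n - 2. sg ?r (w ! i) (w ! Suc i) = 1) \<longleftrightarrow> (\<forall>i. Suc i < n \<longrightarrow> sg ?r (w ! i) (w ! Suc i) = 1)"
    proof (intro iffI allI impI)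
      fix i assume a: "\<forall>i<n - 2. sg ?r (w ! i) (w ! Suc i) = 1" "Suc i < n"
      show "sg ?r (w ! i) (w ! Suc i) = 1"
      proof (cases "i < n - 2")
        case False
        then have i: "i = n - 2" using a(2) by simp
        have "w ! Suc i = ?j" using lw i n3 by (simp add: last_conv_nth Suc_diff_Suc numeral_2_eq_2)
        moreover have "w ! i \<in> A" "w ! i \<noteq> w ! Suc i"
          using w lw a(2) nth_mem[of i w] by (auto simp: words_def nth_eq_iff_index_eq)
        ultimately show ?thesis using sg_last[OF r last_rot_to] by simp
      qed (use a in auto)
    qed auto
    also have "\<dots> \<longleftrightarrow> ?r = w" using word_eq_iff_consecutive[OF r w] lw by simp
    also have "\<dots> \<longleftrightarrow> rot_to ?z w = y @ [?z]"
      using rot_to_rot_to[OF w z j refl] rot_to_rot_to[OF yz j z] by auto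
    finally show ?thesis .
  qed
  have dist: "distinct (butlast x)" and sx: "set (butlast x) = A - {?z}" using xb by (auto simp: words_def)
  have "T (chain_poly w) x = lie (butlast x) (\<lambda>y. \<Prod>i<n - 2. 2 * b i y - 1)"
    unfolding T_def if_P[OF x] by (rule lie_cong[OF dist]) (simp add: c sx)
  also have "\<dots> = lie (butlast x) (\<lambda>y. ((\<Prod>i<n - 2. 2 * b i y - 1) - 2 ^ (n - 2) * (\<Prod>i<n - 2. b i y))
      + 2 ^ (n - 2) * (\<Prod>i<n - 2. b i y))"
    by simp
  also have "\<dots> = 2 ^ (n - 2) * lie (butlast x) (\<lambda>y. \<Prod>i<n - 2. b i y)"
  proof -
    have "lie (butlast x) (\<lambda>y. (\<Prod>i<n - 2. 2 * b i y - 1) - 2 ^ (n - 2) * (\<Prod>i<n - 2. b i y)) = 0"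
      by (rule lie_Low[OF dist, where d = "n - 2"])
        (use sx Low_prod_affine[OF lowb] W_length[OF x] n3 in auto)
    then show ?thesis unfolding lie_add lie_scale by simp
  qed
  also have "lie (butlast x) (\<lambda>y. \<Prod>i<n - 2. b i y) = Q w x"
    unfolding Q_def by (rule lie_cong[OF dist]) (simp add: ind sx)
  finally show ?thesis .
qed

end

section \<open>The internal zonotopal algebra as a quotient of polynomials\<close>

lemma (in cring) idealI_mult:
  assumes "H \<subseteq> carrier R" "\<zero> \<in> H" "\<And>x y. x \<in> H \<Longrightarrow> y \<in> H \<Longrightarrow> x \<oplus> y \<in> H"
    "\<And>x a. x \<in> carrier R \<Longrightarrow> a \<in> H \<Longrightarrow> x \<otimes> a \<in> H"
  shows "ideal H R"
proof (rule idealI[OF ring_axioms])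
  have "\<ominus> a \<in> H" if "a \<in> H" for a
    using assms(4)[of "\<ominus> \<one>" a] that assms(1) by (auto simp: l_minus)
  then show "subgroup H (add_monoid R)"
    using assms by (intro add.group_l_invI add.subgroupI) (auto simp: a_inv_def)
  fix a x assume a: "a \<in> H" "x \<in> carrier R"
  show "x \<otimes> a \<in> H" using a assms(4) by blast
  then show "a \<otimes> x \<in> H" using a assms(1) m_comm by (metis subsetD)
qed

text \<open>Scalars act through multiplication by ring elements. This makes scalar multiplication on
  cosets well defined, and it passes to quotients, so the same locale covers both quotient
  steps.\<close>

locale scalar_cring = cring A for A :: "(complex, 'a) module" (structure) +
  assumes scalar: "\<exists>k\<in>carrier A. \<forall>x\<in>carrier A. smult A c x = k \<otimes> x"

locale quot_alg = scalar_cring A + ideal I A for A :: "(complex, 'a) module" (structure) and I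
begin

abbreviation "Qt \<equiv> quot_algebra A I"

lemma quot_carrier: "carrier Qt = (\<lambda>x. I +> x) ` carrier A"
  by (auto simp: quot_algebra_def FactRing_def A_RCOSETS_def' )

lemma quot_add: "x \<in> carrier A \<Longrightarrow> y \<in> carrier A \<Longrightarrow> (I +> x) \<oplus>\<^bsub>Qt\<^esub> (I +> y) = I +> (x \<oplus> y)"
  by (simp add: quot_algebra_def FactRing_def a_rcos_sum)

lemma quot_mult: "x \<in> carrier A \<Longrightarrow> y \<in> carrier A \<Longrightarrow> (I +> x) \<otimes>\<^bsub>Qt\<^esub> (I +> y) = I +> (x \<otimes> y)"
  by (simp add: quot_algebra_def FactRing_def rcoset_mult_add)

lemma quot_one: "\<one>\<^bsub>Qt\<^esub> = I +> \<one>"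
  by (simp add: quot_algebra_def FactRing_def)

lemma quot_eq: "x \<in> carrier A \<Longrightarrow> y \<in> carrier A \<Longrightarrow> I +> x = I +> y \<longleftrightarrow> x \<ominus> y \<in> I"
  using quotient_eq_iff_same_a_r_cos[OF ideal_axioms] by simp

lemma quot_zero: "\<zero>\<^bsub>Qt\<^esub> = I +> \<zero>"
proof -
  have "I +> \<zero> = I" using a_coset_add_zero[OF a_subset] by simp
  then show ?thesis by (simp add: quot_algebra_def FactRing_def)
qed

lemma quot_cring: "cring Qt"
proof -
  have Q: "cring (A Quot I)" by (rule quotient_is_cring) (rule is_cring)
  note r = cring.cring_simprules[OF Q]
  have inv: "\<exists>y\<in>carrier (A Quot I). y \<oplus>\<^bsub>A Quot I\<^esub> x = \<zero>\<^bsub>A Quot I\<^esub>" if "x \<in> carrier (A Quot I)" for x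
    using r(3,9) that by blast
  show ?thesis
  proof (rule cringI)
    show "abelian_group Qt"
      by (rule abelian_groupI) (use r inv in \<open>simp_all add: quot_algebra_def\<close>)
    show "comm_monoid Qt"
      by (rule comm_monoidI) (use r in \<open>simp_all add: quot_algebra_def\<close>)
  qed (use r in \<open>simp add: quot_algebra_def\<close>)
qed

lemma rcos_mem: "y \<in> I +> x \<longleftrightarrow> (\<exists>i\<in>I. y = i \<oplus> x)"
  by (auto simp: a_r_coset_def')

text \<open>Scalar multiplication in the quotient is a union over all representatives. The cosets
  united are all equal, since the scaled representatives differ by a multiple of an element of
  \<open>I\<close>.\<close>

lemma quot_smult: "x \<in> carrier A \<Longrightarrow> smult Qt c (I +> x) = I +> smult A c x"
proof -
  assume x: "x \<in> carrier A"
  from scalar[of c] obtain k where k: "k \<in> carrier A" "\<forall>x\<in>carrier A. smult A c x = k \<otimes> x" by (elim bexE)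
  have "I +> smult A c y = I +> smult A c x" if "y \<in> I +> x" for y
  proof -
    from that obtain i where i: "i \<in> I" "y = i \<oplus> x" unfolding rcos_mem by (elim bexE)
    have iA: "i \<in> carrier A" by (rule a_Hcarr[OF i(1)])
    have "smult A c y \<ominus> smult A c x = k \<otimes> i"
      using i(2) iA x k by (simp add: r_distr a_assoc a_minus_def r_neg)
    moreover have "k \<otimes> i \<in> I" by (rule I_l_closed[OF i(1) k(1)])
    ultimately show ?thesis using quot_eq k x iA i(2) by simp
  qed
  then have "(\<Union>y\<in>I +> x. I +> smult A c y) = (\<Union>y\<in>I +> x. I +> smult A c x)"
    by (rule SUP_cong[OF refl])
  also have "I +> x \<noteq> {}" using a_rcos_self[OF x] by (metis empty_iff)
  then have "(\<Union>y\<in>I +> x. I +> smult A c x) = I +> smult A c x" by (simp only: UN_constant if_False)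
  finally have "(\<Union>y\<in>I +> x. I +> smult A c y) = I +> smult A c x" .
  then show ?thesis by (simp add: quot_algebra_def)
qed

lemma quot_scalar_cring: "scalar_cring Qt"
proof (rule scalar_cring.intro[OF quot_cring], unfold_locales)
  fix c
  from scalar[of c] obtain k where k: "k \<in> carrier A" "\<forall>x\<in>carrier A. smult A c x = k \<otimes> x" by (elim bexE)
  show "\<exists>k\<in>carrier Qt. \<forall>x\<in>carrier Qt. smult Qt c x = k \<otimes>\<^bsub>Qt\<^esub> x"
    unfolding quot_carrier using k by (auto simp: quot_smult quot_mult intro!: bexI[of _ "k"])
qed

text \<open>The action on a quotient is defined by taking images of cosets. That such an image is
  again a full coset requires \<open>f\<close> to map the ideal onto itself.\<close>

lemma image_rcos:
  assumes "\<And>x y. x \<in> carrier A \<Longrightarrow> y \<in> carrier A \<Longrightarrow> f (x \<oplus> y) = f x \<oplus> f y" "f ` I = I" "x \<in> carrier A"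
  shows "f ` (I +> x) = I +> f x"
proof (intro equalityI subsetI)
  fix y assume "y \<in> f ` (I +> x)"
  then obtain i where i: "i \<in> I" "y = f (i \<oplus> x)" using rcos_mem by auto
  then have "y = f i \<oplus> f x" using assms(1,3) a_subset by blast
  then show "y \<in> I +> f x" using i(1) assms(2) rcos_mem by blast
next
  fix y assume "y \<in> I +> f x"
  then obtain i' where i': "i' \<in> I" "y = i' \<oplus> f x" using rcos_mem by blast
  then obtain i where i: "i \<in> I" "i' = f i" using assms(2) by blast
  have "y = f (i \<oplus> x)" using i i' assms(1,3) a_subset by auto
  then show "y \<in> f ` (I +> x)" using i(1) rcos_mem by blast
qed

end

context braid_words
begin

abbreviation "U \<equiv> braid_kernel n"
abbreviation "R \<equiv> poly_algebra K"
abbreviation "L \<equiv> linearity_ideal U"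
abbreviation "SymU \<equiv> Sym U"
abbreviation "II \<equiv> internal_ideal U (braid_dual n)"

lemma R_simps [simp]: "carrier R = polys K" "add R = (+)" "mult R = (*)" "zero R = 0" "one R = 1"
  "smult R c p = Const c * p"
  by (simp_all add: poly_algebra_def polys_def)

lemma R_cring: "cring R"
proof (rule cringI)
  show "abelian_group R"
  proof (rule abelian_groupI)
    fix x assume "x \<in> carrier R"
    then show "\<exists>y\<in>carrier R. y \<oplus>\<^bsub>R\<^esub> x = \<zero>\<^bsub>R\<^esub>" by (intro bexI[of _ "- x"]) auto
  qed (auto simp: algebra_simps)
  show "comm_monoid R" by (rule comm_monoidI) (auto simp: algebra_simps)
qed (auto simp: algebra_simps)

sublocale R: scalar_cring R
  by (rule scalar_cring.intro[OF R_cring], unfold_locales) (auto intro!: bexI[of _ "Const _"])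

lemma R_minus: "x \<in> polys K \<Longrightarrow> y \<in> polys K \<Longrightarrow> x \<ominus>\<^bsub>R\<^esub> y = x - y"
proof -
  assume a: "x \<in> polys K" "y \<in> polys K"
  then have "\<ominus>\<^bsub>R\<^esub> y = - y" by (intro R.minus_equality) auto
  then show ?thesis by (simp add: a_minus_def)
qed

abbreviation "lin_rels \<equiv> {Var (u \<oplus>\<^bsub>U\<^esub> v) - (Var u + Var v) | u v. u \<in> K \<and> v \<in> K} \<union>
      {Var (c \<odot>\<^bsub>U\<^esub> u) - Const c * Var u | c u. u \<in> K}"

lemma lin_rels_polys: "lin_rels \<subseteq> carrier R"
  by (auto intro!: polys_diff polys_add polys_mult polys_Var K_add K_scale)

lemma L_ideal: "ideal L R"
  unfolding linearity_ideal_def by (rule R.genideal_ideal[OF lin_rels_polys])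

lemma L_gen: "lin_rels \<subseteq> L"
  unfolding linearity_ideal_def by (rule R.genideal_self[OF lin_rels_polys])

lemma L_minimal: "ideal M R \<Longrightarrow> lin_rels \<subseteq> M \<Longrightarrow> L \<subseteq> M"
  unfolding linearity_ideal_def by (rule R.genideal_minimal)

sublocale S: quot_alg R L
  by (intro quot_alg.intro R.scalar_cring_axioms L_ideal)

sublocale S: scalar_cring SymU
  unfolding Sym_def by (rule S.quot_scalar_cring)

lemma L_polys: "p \<in> L \<Longrightarrow> p \<in> polys K"
  using S.a_subset by auto

lemma L_zero: "0 \<in> L"
  using additive_subgroup.zero_closed[OF ideal.axioms(1)[OF L_ideal]] by simp

lemma L_add: "p \<in> L \<Longrightarrow> q \<in> L \<Longrightarrow> p + q \<in> L"
  using additive_subgroup.a_closed[OF ideal.axioms(1)[OF L_ideal], of p q] by simp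

lemma L_mult: "q \<in> polys K \<Longrightarrow> p \<in> L \<Longrightarrow> q * p \<in> L"
  using ideal.I_l_closed[OF L_ideal, of p q] by simp

abbreviation pi1 where "pi1 \<equiv> sym_class U"

lemma pi1_eq: "p \<in> polys K \<Longrightarrow> q \<in> polys K \<Longrightarrow> pi1 p = pi1 q \<longleftrightarrow> p - q \<in> L"
  using S.quot_eq[of p q] R_minus by (simp add: sym_class_def)

lemma pi1_add: "p \<in> polys K \<Longrightarrow> q \<in> polys K \<Longrightarrow> pi1 p \<oplus>\<^bsub>SymU\<^esub> pi1 q = pi1 (p + q)"
  using S.quot_add[of p q] by (simp add: sym_class_def Sym_def)

lemma pi1_mult: "p \<in> polys K \<Longrightarrow> q \<in> polys K \<Longrightarrow> pi1 p \<otimes>\<^bsub>SymU\<^esub> pi1 q = pi1 (p * q)"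
  using S.quot_mult[of p q] by (simp add: sym_class_def Sym_def)

lemma pi1_smult: "p \<in> polys K \<Longrightarrow> c \<odot>\<^bsub>SymU\<^esub> pi1 p = pi1 (Const c * p)"
  using S.quot_smult[of p c] by (simp add: sym_class_def Sym_def)

lemma pi1_zero: "\<zero>\<^bsub>SymU\<^esub> = pi1 0"
  using S.quot_zero by (simp add: sym_class_def Sym_def)

lemma pi1_one: "\<one>\<^bsub>SymU\<^esub> = pi1 1"
  using S.quot_one by (simp add: sym_class_def Sym_def)

lemma SymU_carrier: "carrier SymU = pi1 ` polys K"
  using S.quot_carrier by (simp add: sym_class_def Sym_def)

lemma pi1_power: "p \<in> polys K \<Longrightarrow> pi1 p [^]\<^bsub>SymU\<^esub> (k::nat) = pi1 (p ^ k)"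
  by (induction k) (simp_all add: pi1_one pi1_mult polys_power mult.commute)

lemma pi1_minus: "p \<in> polys K \<Longrightarrow> q \<in> polys K \<Longrightarrow> pi1 p \<ominus>\<^bsub>SymU\<^esub> pi1 q = pi1 (p - q)"
proof -
  assume a: "p \<in> polys K" "q \<in> polys K"
  have "\<ominus>\<^bsub>SymU\<^esub> pi1 q = pi1 (- q)"
    using a by (intro S.minus_equality) (auto simp: pi1_add SymU_carrier pi1_zero)
  then show ?thesis using a by (simp add: a_minus_def pi1_add)
qed

abbreviation "int_gens \<equiv> {sym_incl U u [^]\<^bsub>SymU\<^esub> (rho (braid_dual n) u - 1) | u. u \<in> K \<and> u \<noteq> \<zero>\<^bsub>U\<^esub>}"

lemma int_gens_carrier: "int_gens \<subseteq> carrier SymU"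
  by (auto simp: sym_incl_def pi1_power SymU_carrier)

lemma II_ideal: "ideal II SymU"
  unfolding internal_ideal_def by (rule S.genideal_ideal[OF int_gens_carrier])

lemma II_gen: "u \<in> K \<Longrightarrow> u \<noteq> (\<lambda>e. 0) \<Longrightarrow> pi1 (Var u ^ (rho (braid_dual n) u - 1)) \<in> II"
proof -
  assume u: "u \<in> K" "u \<noteq> (\<lambda>e. 0)"
  have "sym_incl U u [^]\<^bsub>SymU\<^esub> (rho (braid_dual n) u - 1) \<in> int_gens" using u by auto
  then have "sym_incl U u [^]\<^bsub>SymU\<^esub> (rho (braid_dual n) u - 1) \<in> II"
    unfolding internal_ideal_def using S.genideal_self[OF int_gens_carrier] by blast
  then show ?thesis using u by (simp add: sym_incl_def pi1_power)
qed

sublocale I: quot_alg SymU II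
  by (intro quot_alg.intro S.scalar_cring_axioms II_ideal)

lemma L_sub_tideal: "L \<subseteq> tideal"
proof (rule L_minimal)
  show "ideal tideal R"
    by (rule R.idealI_mult) (auto intro: tideal_polys tri.J_zero tideal.add tideal_mult)
  show "lin_rels \<subseteq> tideal" by (auto intro: tri.J_lin_add tri.J_lin_scale)
qed

lemma tri_nonzero: "a \<in> A \<Longrightarrow> b \<in> A \<Longrightarrow> c \<in> A \<Longrightarrow> distinct [a, b, c] \<Longrightarrow> tri a b c \<noteq> (\<lambda>e. 0)"
proof
  assume a: "distinct [a, b, c]" "tri a b c = (\<lambda>e. 0)"
  have "antisym_part (tri a b c) a b = antisym_part (hvec a b) a b + antisym_part (hvec b c) a b + antisym_part (hvec c a) a b"
    by (simp add: tri_def antisym_part_def algebra_simps)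
  also have "\<dots> = 1" using a(1) by (simp add: antisym_part_hvec)
  finally show False using a(2) by (simp add: antisym_part_def)
qed

text \<open>The support has at most three edges, so the exponent in the internal ideal is at most 2
  and the square of a triangle is a multiple of a generator.\<close>

lemma rho_tri: "a \<in> A \<Longrightarrow> b \<in> A \<Longrightarrow> c \<in> A \<Longrightarrow> rho (braid_dual n) (tri a b c) \<le> 3"
proof -
  assume a: "a \<in> A" "b \<in> A" "c \<in> A"
  let ?S = "{(min a b, max a b), (min b c, max b c), (min c a, max c a)}"
  have h: "e = (min i j, max i j)" if "hvec i j e \<noteq> 0" for i j e
    using that by (auto simp: hvec_def min_def max_def of_bool_def split: if_splits)
  have "{e \<in> idx. tri a b c e \<noteq> 0} \<subseteq> ?S"
  proof
    fix e assume "e \<in> {e \<in> idx. tri a b c e \<noteq> 0}"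
    then have "hvec a b e \<noteq> 0 \<or> hvec b c e \<noteq> 0 \<or> hvec c a e \<noteq> 0" by (auto simp: tri_def)
    then show "e \<in> ?S" using h by blast
  qed
  then have "card {e \<in> idx. tri a b c e \<noteq> 0} \<le> card ?S" by (intro card_mono) auto
  also have "\<dots> \<le> 3" by (simp add: card_insert_if)
  finally show ?thesis using rho_braid_dual[OF tri_K[OF a]] by simp
qed

lemma tideal_imp_II: "p \<in> tideal \<Longrightarrow> pi1 p \<in> II"
proof (induction rule: tideal.induct)
  case (lin_add q u v)
  have "Var (\<lambda>e. u e + v e) - (Var u + Var v) \<in> lin_rels" using lin_add by auto
  then have "Var (\<lambda>e. u e + v e) - (Var u + Var v) \<in> L" by (rule subsetD[OF L_gen])
  then have "q * (Var (\<lambda>e. u e + v e) - (Var u + Var v)) \<in> L"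
    using S.I_l_closed[of _ q] lin_add(1) by simp
  then have "pi1 (q * (Var (\<lambda>e. u e + v e) - (Var u + Var v))) = pi1 0"
    using pi1_eq[OF L_polys polys_zero] by simp
  then show ?case using I.zero_closed pi1_zero by simp
next
  case (lin_scale q u z)
  have "Var (\<lambda>e. z * u e) - Const z * Var u \<in> lin_rels" using lin_scale by auto
  then have "Var (\<lambda>e. z * u e) - Const z * Var u \<in> L" by (rule subsetD[OF L_gen])
  then have "q * (Var (\<lambda>e. z * u e) - Const z * Var u) \<in> L"
    using S.I_l_closed[of _ q] lin_scale(1) by simp
  then have "pi1 (q * (Var (\<lambda>e. z * u e) - Const z * Var u)) = pi1 0"
    using pi1_eq[OF L_polys polys_zero] by simp
  then show ?case using I.zero_closed pi1_zero by simp
next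
  case (tri_square q a b c)
  let ?t = "tri a b c" and ?r = "rho (braid_dual n) (tri a b c) - 1"
  have t: "?t \<in> K" by (rule tri_K[OF tri_square(2-4)])
  have "?r \<le> 2" using rho_tri[OF tri_square(2-4)] by simp
  then have "Var ?t ^ 2 = Var ?t ^ (2 - ?r) * Var ?t ^ ?r" by (simp add: power_add[symmetric])
  then have "pi1 (q * Var ?t ^ 2) = pi1 (q * Var ?t ^ (2 - ?r)) \<otimes>\<^bsub>SymU\<^esub> pi1 (Var ?t ^ ?r)"
    using tri_square(1) t by (simp add: pi1_mult mult.assoc polys_mult polys_power)
  also have "\<dots> \<in> II"
    using II_gen[OF t tri_nonzero[OF tri_square(2-5)]] tri_square(1) t
    by (intro I.I_l_closed) (auto simp: SymU_carrier)
  finally show ?case .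
next
  case (add p q)
  then show ?case using pi1_add[OF tideal_polys tideal_polys] I.a_closed by (metis)
qed

lemma II_sub: "II \<subseteq> pi1 ` tideal"
  unfolding internal_ideal_def
proof (rule S.genideal_minimal)
  show "ideal (pi1 ` tideal) SymU"
  proof (rule S.idealI_mult)
    show "pi1 ` tideal \<subseteq> carrier SymU" using tideal_polys by (auto simp: SymU_carrier)
    show "\<zero>\<^bsub>SymU\<^esub> \<in> pi1 ` tideal" using tri.J_zero by (simp add: pi1_zero)
    fix x y assume "x \<in> pi1 ` tideal" "y \<in> pi1 ` tideal"
    then show "x \<oplus>\<^bsub>SymU\<^esub> y \<in> pi1 ` tideal" by (auto simp: pi1_add tideal_polys intro: tideal.add)
  next
    fix x a assume "x \<in> carrier SymU" "a \<in> pi1 ` tideal"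
    then show "x \<otimes>\<^bsub>SymU\<^esub> a \<in> pi1 ` tideal"
      unfolding SymU_carrier by (auto simp: pi1_mult tideal_polys intro: tideal_mult)
  qed
  show "int_gens \<subseteq> pi1 ` tideal"
    by (auto simp: sym_incl_def pi1_power simp del: One_nat_def intro!: imageI tri.Var_power_rho)
qed

lemma II_eq: "II = pi1 ` tideal"
  using II_sub tideal_imp_II by blast

text \<open>A preimage in \<open>tideal\<close> differs from \<open>p\<close> by an element of the
  linearity ideal, which is contained in \<open>tideal\<close>. Hence the two successive quotients
  amount to one quotient of polynomials by \<open>tideal\<close>.\<close>

lemma pi1_in_II: "p \<in> polys K \<Longrightarrow> pi1 p \<in> II \<longleftrightarrow> p \<in> tideal"
proof
  assume p: "p \<in> polys K" "pi1 p \<in> II"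
  then obtain q where q: "q \<in> tideal" "pi1 p = pi1 q" using II_eq by blast
  then have "p - q \<in> tideal" using pi1_eq p tideal_polys L_sub_tideal by blast
  from tideal.add[OF this q(1)] show "p \<in> tideal" by simp
qed (rule tideal_imp_II)

definition cls where "cls p = II +>\<^bsub>SymU\<^esub> pi1 p"

abbreviation "IA \<equiv> internal_algebra U (braid_dual n)"

lemma cls_eq: "p \<in> polys K \<Longrightarrow> q \<in> polys K \<Longrightarrow> cls p = cls q \<longleftrightarrow> p - q \<in> tideal"
  using I.quot_eq[of "pi1 p" "pi1 q"] by (simp add: cls_def pi1_minus pi1_in_II SymU_carrier)

lemma cls_add: "p \<in> polys K \<Longrightarrow> q \<in> polys K \<Longrightarrow> cls p \<oplus>\<^bsub>IA\<^esub> cls q = cls (p + q)"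
  using I.quot_add[of "pi1 p" "pi1 q"] by (simp add: cls_def internal_algebra_def pi1_add SymU_carrier)

lemma cls_smult: "p \<in> polys K \<Longrightarrow> c \<odot>\<^bsub>IA\<^esub> cls p = cls (Const c * p)"
  using I.quot_smult[of "pi1 p" c] by (simp add: cls_def internal_algebra_def pi1_smult SymU_carrier)

lemma cls_zero: "\<zero>\<^bsub>IA\<^esub> = cls 0"
  using I.quot_zero by (simp add: cls_def internal_algebra_def pi1_zero)

lemma internal_component_eq:
  "internal_component U (braid_dual n) d = cls ` {p \<in> polys K. homogeneous d p}"
  by (simp add: internal_component_def Sym_component_def image_image cls_def)

lemma rename_polys_kact: "g permutes A \<Longrightarrow> p \<in> polys K \<Longrightarrow> rename_vars (kact g) p \<in> polys K"
  by (rule rename_polys) (auto intro: kact_K)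

lemma rename_kact_inv:
  assumes g: "g permutes A" and p: "p \<in> polys K"
  shows "rename_vars (kact g) (rename_vars (kact (Hilbert_Choice.inv g)) p) = p"
  unfolding rename_rename
proof (rule rename_id[OF p])
  fix u assume "u \<in> K"
  then show "kact g (kact (Hilbert_Choice.inv g) u) = u"
    using kact_kact[OF permutes_inv[OF g], of g u] permutes_inv_o(1)[OF g] kact_id by simp
qed

lemma kact_add: "kact g (\<lambda>e. u e + v e) = (\<lambda>e. kact g u e + kact g v e)"
  by (rule ext) (simp add: kact_def' distrib_right sum.distrib)

lemma kact_scale: "kact g (\<lambda>e. c * u e) = (\<lambda>e. c * kact g u e)"
  by (rule ext) (simp add: kact_def' sum_distrib_left mult.assoc)

lemma kact_tri:
  assumes "a \<in> A" "b \<in> A" "c \<in> A"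
  shows "kact g (tri a b c) = tri (g a) (g b) (g c)"
proof -
  have h: "kact g (hvec i j) = hvec (g i) (g j)" if "i \<in> A" "j \<in> A" for i j
  proof
    fix e
    show "kact g (hvec i j) e = hvec (g i) (g j) e"
      unfolding kact_def' by (rule hvec_expand[OF that, where F = "\<lambda>k l. hvec (g k) (g l) e"]) (rule hvec_swap)
  qed
  show ?thesis unfolding tri_def kact_add h[OF assms(1,2)] h[OF assms(2,3)] h[OF assms(3,1)] ..
qed

abbreviation "rn g \<equiv> rename_vars (kact g)"

lemma rn_simps: "rn g (p + q) = rn g p + rn g q" "rn g (p * q) = rn g p * rn g q"
  "rn g (p - q) = rn g p - rn g q" "rn g (Var u) = Var (kact g u)" "rn g (Const c) = Const c"
  "rn g (p ^ k) = rn g p ^ k" "rn g 0 = 0"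
  by (simp_all add: rename_vars_eq Const.insertion_add Const.insertion_mult Const.insertion_diff Const.insertion_power)

lemma rn_tideal:
  assumes g: "g permutes A"
  shows "p \<in> tideal \<Longrightarrow> rn g p \<in> tideal"
proof (induction rule: tideal.induct)
  case (lin_add q u v)
  then show ?case
    unfolding rn_simps kact_add by (intro tideal.lin_add rename_polys_kact[OF g] kact_K[OF g])
next
  case (lin_scale q u z)
  then show ?case
    unfolding rn_simps kact_scale by (intro tideal.lin_scale rename_polys_kact[OF g] kact_K[OF g])
next
  case (tri_square q a b c)
  have gA: "g a \<in> A" "g b \<in> A" "g c \<in> A" using tri_square(2-4) g permutes_in_image by metis+
  have "distinct [g a, g b, g c]" using tri_square(5) permutes_inj[OF g] by (auto dest: injD)
  then show ?case
    unfolding rn_simps kact_tri[OF tri_square(2-4)]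
    by (intro tideal.tri_square rename_polys_kact[OF g] tri_square(1) gA)
next
  case (add p q)
  then show ?case unfolding rn_simps by (intro tideal.add)
qed

text \<open>The polynomials whose renaming lies in \<open>L\<close> form an ideal, and it contains
  the linear relations because these are permuted by the action; minimality of \<open>L\<close> does
  the rest.\<close>

lemma rn_L:
  assumes g: "g permutes A"
  shows "p \<in> L \<Longrightarrow> rn g p \<in> L"
proof -
  let ?M = "{p \<in> polys K. rn g p \<in> L}"
  have "L \<subseteq> ?M"
  proof (rule L_minimal)
    show "ideal ?M R"
    proof (rule R.idealI_mult)
      show "\<zero>\<^bsub>R\<^esub> \<in> ?M" using L_zero by (simp add: rn_simps)
      fix x y assume "x \<in> ?M" "y \<in> ?M"
      then show "x \<oplus>\<^bsub>R\<^esub> y \<in> ?M" using L_add by (auto simp: rn_simps)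
    next
      fix x a assume "x \<in> carrier R" "a \<in> ?M"
      then show "x \<otimes>\<^bsub>R\<^esub> a \<in> ?M"
        using L_mult rename_polys_kact[OF g] by (auto simp: rn_simps)
    qed auto
    show "lin_rels \<subseteq> ?M"
    proof
      fix r assume r: "r \<in> lin_rels"
      then have rP: "r \<in> polys K" using lin_rels_polys by auto
      from r have "rn g r \<in> lin_rels"
      proof
        assume "r \<in> {Var (u \<oplus>\<^bsub>U\<^esub> v) - (Var u + Var v) | u v. u \<in> K \<and> v \<in> K}"
        then obtain u v where u: "r = Var (\<lambda>e. u e + v e) - (Var u + Var v)" "u \<in> K" "v \<in> K" by auto
        have "rn g r = Var (kact g u \<oplus>\<^bsub>U\<^esub> kact g v) - (Var (kact g u) + Var (kact g v))"
          by (simp add: u(1) rn_simps kact_add)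
        then show ?thesis using kact_K[OF g] u by blast
      next
        assume "r \<in> {Var (c \<odot>\<^bsub>U\<^esub> u) - Const c * Var u | c u. u \<in> K}"
        then obtain c u where u: "r = Var (\<lambda>e. c * u e) - Const c * Var u" "u \<in> K" by auto
        have "rn g r = Var (c \<odot>\<^bsub>U\<^esub> kact g u) - Const c * Var (kact g u)"
          by (simp add: u(1) rn_simps kact_scale)
        then show ?thesis using kact_K[OF g] u by blast
      qed
      then show "r \<in> ?M" using L_gen rP by blast
    qed
  qed
  then show "p \<in> L \<Longrightarrow> ?thesis" by blast
qed

lemma rn_image:
  assumes g: "g permutes A" and M: "M \<subseteq> polys K" "\<And>g p. g permutes A \<Longrightarrow> p \<in> M \<Longrightarrow> rn g p \<in> M"
  shows "rn g ` M = M"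
proof
  show "rn g ` M \<subseteq> M" using M g by blast
  show "M \<subseteq> rn g ` M"
  proof
    fix p assume p: "p \<in> M"
    have "rn g (rn (Hilbert_Choice.inv g) p) = p" using p M rename_kact_inv[OF g] by blast
    moreover have "rn (Hilbert_Choice.inv g) p \<in> M" using M(2)[OF permutes_inv[OF g] p] .
    ultimately show "p \<in> rn g ` M" by (metis imageI)
  qed
qed

lemma rn_pi1: "g permutes A \<Longrightarrow> p \<in> polys K \<Longrightarrow> rn g ` pi1 p = pi1 (rn g p)"
  unfolding sym_class_def
proof (rule S.image_rcos)
  assume g: "g permutes A"
  show "rn g ` L = L" by (rule rn_image[OF g]) (auto intro: L_polys rn_L)
qed (auto simp: rn_simps)

lemma rn_cls:
  assumes g: "g permutes A" and p: "p \<in> polys K"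
  shows "(\<lambda>x. rn g ` x) ` cls p = cls (rn g p)"
proof -
  have "(\<lambda>x. rn g ` x) ` (II +>\<^bsub>SymU\<^esub> pi1 p) = II +>\<^bsub>SymU\<^esub> (rn g ` pi1 p)"
  proof (rule I.image_rcos)
    fix x y assume "x \<in> carrier SymU" "y \<in> carrier SymU"
    then obtain p q where "x = pi1 p" "p \<in> polys K" "y = pi1 q" "q \<in> polys K"
      unfolding SymU_carrier by blast
    then show "rn g ` (x \<oplus>\<^bsub>SymU\<^esub> y) = rn g ` x \<oplus>\<^bsub>SymU\<^esub> rn g ` y"
      by (simp only: pi1_add rn_pi1[OF g] rename_polys_kact[OF g] polys_add rn_simps(1))
  next
    have "(\<lambda>x. rn g ` x) ` II = pi1 ` (rn g ` tideal)"
      unfolding II_eq image_image using rn_pi1[OF g] tideal_polys by (intro image_cong) auto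
    also have "rn g ` tideal = tideal" by (rule rn_image[OF g]) (auto intro: tideal_polys rn_tideal)
    finally show "(\<lambda>x. rn g ` x) ` II = II" by (simp add: II_eq)
  qed (use p in \<open>simp add: SymU_carrier\<close>)
  then show ?thesis by (simp add: cls_def rn_pi1[OF g p])
qed

end

section \<open>Linear algebra in spaces of functions\<close>

definition fscale :: "complex \<Rightarrow> ('b \<Rightarrow> complex) \<Rightarrow> 'b \<Rightarrow> complex" where
  "fscale c f = (\<lambda>x. c * f x)"

interpretation fv: vector_space "fscale :: complex \<Rightarrow> ('b \<Rightarrow> complex) \<Rightarrow> 'b \<Rightarrow> complex"
  by unfold_locales (auto simp: fscale_def fun_eq_iff algebra_simps)

lemma sum_apply: "(\<Sum>i\<in>I. f i) x = (\<Sum>i\<in>I. f i x)"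
  by (induction I rule: infinite_finite_induct) auto

lemma sum_fscale: "(\<Sum>i\<in>I. fscale (a i) (e i)) = (\<lambda>x. \<Sum>i\<in>I. a i * e i x)"
  by (rule ext) (simp add: sum_apply fscale_def)

lemma span_lincomb: "(\<And>i. i \<in> I \<Longrightarrow> e i \<in> fv.span S) \<Longrightarrow> (\<lambda>x. \<Sum>i\<in>I. a i * e i x) \<in> fv.span S"
  unfolding sum_fscale[symmetric] by (intro fv.span_sum fv.span_scale)

lemma independent_dual:
  assumes "finite M" and dual: "\<And>k k'. k \<in> M \<Longrightarrow> k' \<in> M \<Longrightarrow> d k (pt k') = of_bool (k = k')"
  shows "inj_on d M" "fv.independent (d ` M)"
proof -
  show inj: "inj_on d M"
  proof (rule inj_onI)
    fix k k' assume k: "k \<in> M" "k' \<in> M" "d k = d k'"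
    then have "d k (pt k') = 1" using dual by simp
    then show "k = k'" using dual[OF k(1,2)] by (simp split: if_splits)
  qed
  show "fv.independent (d ` M)"
  proof (rule fv.independent_if_scalars_zero)
    fix f x assume s: "(\<Sum>x\<in>d ` M. fscale (f x) x) = 0" and x: "x \<in> d ` M"
    obtain k where k: "k \<in> M" "x = d k" using x by blast
    have "0 = (\<Sum>x\<in>d ` M. fscale (f x) x) (pt k)" using s by simp
    also have "\<dots> = (\<Sum>k'\<in>M. f (d k') * d k' (pt k))"
      using inj by (simp add: sum_apply fscale_def sum.reindex)
    also have "\<dots> = (\<Sum>k'\<in>M. if k' = k then f (d k') else 0)"
      by (rule sum.cong) (use dual k in auto)
    also have "\<dots> = f x" using k assms(1) by simp
    finally show "f x = 0" by simp
  qed (use assms in simp)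
qed

text \<open>A family \<open>e\<close> of at most \<open>card M\<close> functions whose span contains \<open>card M\<close> functions with a dual
  system of evaluation points is linearly independent and has the same span.\<close>

lemma spanning_family:
  fixes e :: "'i \<Rightarrow> 'b \<Rightarrow> complex"
  assumes fin: "finite I" "finite M" and card: "card I \<le> card M"
    and dual: "\<And>k k'. k \<in> M \<Longrightarrow> k' \<in> M \<Longrightarrow> d k (pt k') = of_bool (k = k')"
    and sp: "\<And>k. k \<in> M \<Longrightarrow> d k \<in> fv.span (e ` I)"
  shows "(\<lambda>x. \<Sum>i\<in>I. c i * e i x) = (\<lambda>x. 0) \<Longrightarrow> i \<in> I \<Longrightarrow> c i = 0"
    and "i \<in> I \<Longrightarrow> e i \<in> fv.span (d ` M)"
proof -
  note ind = independent_dual[where d = d and M = M and pt = pt, OF fin(2) dual]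
  show "c i = 0" if z: "(\<lambda>x. \<Sum>i\<in>I. c i * e i x) = (\<lambda>x. 0)" and i: "i \<in> I"
  proof (rule ccontr)
    assume c: "c i \<noteq> 0"
    have "e i = (\<lambda>x. \<Sum>k\<in>I - {i}. (- c k / c i) * e k x)"
    proof
      fix x
      have "0 = (\<Sum>i\<in>I. c i * e i x)" using z by (metis)
      also have "\<dots> = c i * e i x + (\<Sum>k\<in>I - {i}. c k * e k x)" by (rule sum.remove[OF fin(1) i])
      finally have "e i x = - (\<Sum>k\<in>I - {i}. c k * e k x) / c i"
        using c by (simp add: field_simps eq_neg_iff_add_eq_0)
      also have "\<dots> = (\<Sum>k\<in>I - {i}. (- c k / c i) * e k x)"
        by (simp add: sum_divide_distrib sum_negf)
      finally show "e i x = (\<Sum>k\<in>I - {i}. (- c k / c i) * e k x)" .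
    qed
    moreover have "(\<lambda>x. \<Sum>k\<in>I - {i}. (- c k / c i) * e k x) \<in> fv.span (e ` (I - {i}))"
      by (intro span_lincomb fv.span_base) simp
    ultimately have "e i \<in> fv.span (e ` (I - {i}))" by simp
    moreover have "e k \<in> fv.span (e ` (I - {i}))" if "k \<in> I" "k \<noteq> i" for k
      using that by (intro fv.span_base imageI) simp
    ultimately have "e k \<in> fv.span (e ` (I - {i}))" if "k \<in> I" for k using that by (cases "k = i") auto
    then have "e ` I \<subseteq> fv.span (e ` (I - {i}))" by (rule image_subsetI)
    then have "fv.span (e ` I) \<subseteq> fv.span (e ` (I - {i}))"
      by (rule fv.span_minimal[OF _ fv.subspace_span])
    moreover have "d ` M \<subseteq> fv.span (e ` I)" by (rule image_subsetI) (rule sp)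
    ultimately have "d ` M \<subseteq> fv.span (e ` (I - {i}))" by (rule subset_trans[rotated])
    then have "card (d ` M) \<le> card (e ` (I - {i}))"
      using fv.independent_span_bound[OF _ ind(2)] fin by simp
    also have "\<dots> \<le> card (I - {i})" using fin by (intro card_image_le) simp
    also have "\<dots> < card I" using i fin by (intro card_Diff1_less)
    finally show False using card card_image[OF ind(1)] by simp
  qed
  show "e i \<in> fv.span (d ` M)" if i: "i \<in> I"
  proof (rule ccontr)
    assume n: "e i \<notin> fv.span (d ` M)"
    have "fv.independent (insert (e i) (d ` M))" by (rule fv.independent_insertI[OF n ind(2)])
    moreover have "insert (e i) (d ` M) \<subseteq> fv.span (e ` I)"
      by (intro insert_subsetI image_subsetI sp fv.span_base imageI i)
    ultimately have "card (insert (e i) (d ` M)) \<le> card (e ` I)"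
      using fv.independent_span_bound[OF finite_imageI[OF fin(1)]] by (metis (no_types))
    also have "\<dots> \<le> card I" using fin by (intro card_image_le)
    finally have "card (insert (e i) (d ` M)) \<le> card I" .
    moreover have "e i \<notin> d ` M" using n fv.span_base[of "e i" "d ` M"] by (rule contrapos_nn)
    then have "card (insert (e i) (d ` M)) = Suc (card M)" using fin card_image[OF ind(1)] by simp
    ultimately show False using card by simp
  qed
qed

section \<open>Representations embedded in spaces of functions\<close>

text \<open>The representations to be compared consist of cosets of cosets and of functions valued
  in functions. An injective map into complex functions that turns the operations into pointwise
  ones, and the action into a common \<open>\<rho>\<close>, yields the module laws and reduces
  isomorphism to equality of images.\<close>

locale embedded_rep =
  fixes G :: "('g, 'm) monoid_scheme" and V :: "('g, 'v) rep"
    and f :: "'v \<Rightarrow> 'b \<Rightarrow> complex" and \<rho> :: "'g \<Rightarrow> ('b \<Rightarrow> complex) \<Rightarrow> 'b \<Rightarrow> complex"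
  assumes grp: "group G"
    and inj: "inj_on f (carrier V)"
    and zero_in: "zero V \<in> carrier V"
    and add_in: "x \<in> carrier V \<Longrightarrow> y \<in> carrier V \<Longrightarrow> add V x y \<in> carrier V"
    and smult_in: "x \<in> carrier V \<Longrightarrow> smult V c x \<in> carrier V"
    and act_in: "g \<in> carrier G \<Longrightarrow> x \<in> carrier V \<Longrightarrow> act V g x \<in> carrier V"
    and f_zero: "f (zero V) = (\<lambda>b. 0)"
    and f_add: "x \<in> carrier V \<Longrightarrow> y \<in> carrier V \<Longrightarrow> f (add V x y) = (\<lambda>b. f x b + f y b)"
    and f_smult: "x \<in> carrier V \<Longrightarrow> f (smult V c x) = (\<lambda>b. c * f x b)"
    and f_act: "g \<in> carrier G \<Longrightarrow> x \<in> carrier V \<Longrightarrow> f (act V g x) = \<rho> g (f x)"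
    and \<rho>_add: "g \<in> carrier G \<Longrightarrow> \<rho> g (\<lambda>b. u b + v b) = (\<lambda>b. \<rho> g u b + \<rho> g v b)"
    and \<rho>_scale: "g \<in> carrier G \<Longrightarrow> \<rho> g (\<lambda>b. c * u b) = (\<lambda>b. c * \<rho> g u b)"
    and \<rho>_one: "x \<in> carrier V \<Longrightarrow> \<rho> (one G) (f x) = f x"
    and \<rho>_mult: "g \<in> carrier G \<Longrightarrow> h \<in> carrier G \<Longrightarrow> \<rho> (monoid.mult G g h) u = \<rho> g (\<rho> h u)"
begin

lemma eqI: "x \<in> carrier V \<Longrightarrow> y \<in> carrier V \<Longrightarrow> f x = f y \<Longrightarrow> x = y"
  using inj by (rule inj_onD)

lemma linear_rep: "linear_rep G V"
proof -
  interpret G: group G by (rule grp)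
  have cr: "cring cplx"
  proof (rule cringI)
    show "abelian_group cplx"
      by (rule abelian_groupI) (auto simp: cplx_def intro: exI[of _ "- _"] add.left_inverse)
    show "comm_monoid cplx"
      by (rule comm_monoidI) (auto simp: cplx_def)
  qed (auto simp: cplx_def algebra_simps)
  have ag: "abelian_group V"
  proof (rule abelian_groupI)
    fix x assume x: "x \<in> carrier V"
    have "add V (smult V (- 1) x) x = zero V"
      by (rule eqI) (use x in \<open>auto simp: add_in smult_in zero_in f_add f_smult f_zero\<close>)
    then show "\<exists>y\<in>carrier V. add V y x = zero V" using smult_in[OF x] by blast
  next
    fix x y z assume "x \<in> carrier V" "y \<in> carrier V" "z \<in> carrier V"
    then show "add V (add V x y) z = add V x (add V y z)"
      by (intro eqI) (auto simp: add_in f_add add.assoc)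
  next
    fix x y assume "x \<in> carrier V" "y \<in> carrier V"
    then show "add V x y = add V y x"
      by (intro eqI) (auto simp: add_in f_add add.commute)
  next
    fix x assume "x \<in> carrier V"
    then show "add V (zero V) x = x"
      by (intro eqI) (auto simp: add_in zero_in f_add f_zero)
  qed (auto intro: add_in zero_in)
  have m: "module cplx V"
  proof (rule moduleI[OF cr ag])
    fix a b x y assume "x \<in> carrier V" "y \<in> carrier V"
    then show "smult V (add cplx a b) x = add V (smult V a x) (smult V b x)"
      and "smult V a (add V x y) = add V (smult V a x) (smult V a y)"
      and "smult V (monoid.mult cplx a b) x = smult V a (smult V b x)"
      and "smult V (one cplx) x = x" and "smult V a x \<in> carrier V"
      by (auto intro!: eqI simp: add_in smult_in f_add f_smult cplx_def algebra_simps)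
  qed
  show ?thesis unfolding linear_rep_def
  proof (intro conjI ballI allI)
    show "group G" by (rule grp)
    show "module cplx V" by (rule m)
  next
    fix g x assume "g \<in> carrier G" "x \<in> carrier V"
    then show "act V g x \<in> carrier V" by (rule act_in)
  next
    fix g x y assume "g \<in> carrier G" "x \<in> carrier V" "y \<in> carrier V"
    then show "act V g (add V x y) = add V (act V g x) (act V g y)"
      by (intro eqI) (auto simp: act_in add_in f_act f_add \<rho>_add)
  next
    fix g c x assume "g \<in> carrier G" "x \<in> carrier V"
    then show "act V g (smult V c x) = smult V c (act V g x)"
      by (intro eqI) (auto simp: act_in smult_in f_act f_smult \<rho>_scale)
  next
    fix x assume "x \<in> carrier V"
    then show "act V (one G) x = x"
      by (intro eqI) (auto simp: act_in f_act \<rho>_one)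
  next
    fix g h x assume "g \<in> carrier G" "h \<in> carrier G" "x \<in> carrier V"
    then show "act V (monoid.mult G g h) x = act V g (act V h x)"
      by (intro eqI) (auto simp: act_in f_act \<rho>_mult)
  qed
qed

end

lemma rep_iso_embedded:
  assumes V: "embedded_rep G V f \<rho>" and W: "embedded_rep G W f' \<rho>"
    and img: "f ` carrier V = f' ` carrier W"
  shows "rep_iso G V W"
proof -
  interpret V: embedded_rep G V f \<rho> by (rule V)
  interpret W: embedded_rep G W f' \<rho> by (rule W)
  define k where "k = (\<lambda>x. inv_into (carrier W) f' (f x))"
  have k: "k x \<in> carrier W" "f' (k x) = f x" if "x \<in> carrier V" for x
  proof -
    have "f x \<in> f' ` carrier W" using that img by blast
    then show "k x \<in> carrier W" "f' (k x) = f x"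
      unfolding k_def by (rule inv_into_into, rule f_inv_into_f)
  qed
  show ?thesis unfolding rep_iso_def
  proof (intro conjI V.linear_rep W.linear_rep exI[of _ k] ballI allI)
    show "bij_betw k (carrier V) (carrier W)"
    proof (rule bij_betw_imageI)
      show "inj_on k (carrier V)"
        by (rule inj_onI) (metis V.eqI k(2))
      show "k ` carrier V = carrier W"
      proof
        show "k ` carrier V \<subseteq> carrier W" using k by blast
        show "carrier W \<subseteq> k ` carrier V"
        proof
          fix y assume y: "y \<in> carrier W"
          then obtain x where x: "x \<in> carrier V" "f x = f' y" using img by (metis imageE imageI)
          then have "k x = y" using W.eqI[OF k(1)[OF x(1)] y] k(2)[OF x(1)] by simp
          then show "y \<in> k ` carrier V" using x by blast
        qed
      qed
    qed
  next
    fix x y assume "x \<in> carrier V" "y \<in> carrier V"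
    then show "k (add V x y) = add W (k x) (k y)"
      by (intro W.eqI) (auto simp: k V.add_in W.add_in V.f_add W.f_add)
  next
    fix c x assume "x \<in> carrier V"
    then show "k (smult V c x) = smult W c (k x)"
      by (intro W.eqI) (auto simp: k V.smult_in W.smult_in V.f_smult W.f_smult)
  next
    fix g x assume g: "g \<in> carrier G" and x: "x \<in> carrier V"
    have "f' (k (act V g x)) = f' (act W g (k x))"
      by (simp only: k(2)[OF V.act_in[OF g x]] V.f_act[OF g x] W.f_act[OF g k(1)[OF x]] k(2)[OF x])
    then show "k (act V g x) = act W g (k x)"
      by (rule W.eqI[OF k(1)[OF V.act_in[OF g x]] W.act_in[OF g k(1)[OF x]]])
  qed
qed

section \<open>Induced representations as spaces of functions on the group\<close>

lemma sym_group_mult [simp]: "monoid.mult (sym_group k) = (\<circ>)"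
  by (simp add: sym_group_def)

lemma sym_group_one [simp]: "one (sym_group k) = id"
  by (simp add: sym_group_def)

lemma sym_group_inv: "p permutes {1..k} \<Longrightarrow> m_inv (sym_group k) p = Hilbert_Choice.inv p"
  using sym_group_inv_equality[of p k] by (simp add: sym_group_carrier)

lemma map_std_cycle: "map (std_cycle k) [1..<Suc k] = rotate1 [1..<Suc k]"
  using cyclic_rotation[of "[1..<Suc k]" 1] by (simp add: std_cycle_def del: upt_Suc)

lemma std_cycle_permutes: "std_cycle k permutes {1..k}"
  using cycle_permutes[of "[1..<Suc k]"] by (simp add: std_cycle_def atLeastLessThanSuc_atLeastAtMost del: upt_Suc)

lemma std_cycle_pow_1: "k \<ge> 1 \<Longrightarrow> (std_cycle k ^^ l) 1 = Suc (l mod k)"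
proof -
  assume k: "k \<ge> 1"
  have "map (std_cycle k ^^ l) [1..<Suc k] = rotate l [1..<Suc k]"
    unfolding std_cycle_def by (rule cyclic_rotation) simp
  then have "map (std_cycle k ^^ l) [1..<Suc k] ! 0 = rotate l [1..<Suc k] ! 0" by simp
  with k show ?thesis by (simp add: nth_rotate del: upt_Suc)
qed

lemma pow_sym_group: "p [^]\<^bsub>sym_group k\<^esub> (l::nat) = p ^^ l"
proof (induction l)
  case (Suc l)
  then show ?case by (simp add: funpow_Suc_right del: funpow.simps)
qed (simp add: nat_pow_def)

definition unit_root :: "nat \<Rightarrow> complex" where "unit_root k = exp (2 * pi * \<i> / k)"

lemma unit_root_nonzero [simp]: "unit_root k \<noteq> 0"
  by (simp add: unit_root_def)

lemma unit_root_pow: "k \<ge> 1 \<Longrightarrow> unit_root k ^ k = 1"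
  by (simp add: unit_root_def exp_of_nat_mult[symmetric])

lemma unit_root_pow_neq_1: "0 < i \<Longrightarrow> i < k \<Longrightarrow> unit_root k ^ i \<noteq> 1"
proof
  assume a: "0 < i" "i < k" "unit_root k ^ i = 1"
  have "unit_root k = cis (2 * pi / k)" by (simp add: unit_root_def cis_conv_exp mult_ac)
  then have "cis (i * (2 * pi / k)) = 1" using a(3) by (simp only: DeMoivre)
  then have "cos (i * (2 * pi / k)) = 1" by (metis cis.sel(1) one_complex.sel(1))
  then obtain m :: int where m: "real i * (2 * pi / real k) = of_int m * 2 * pi" unfolding cos_one_2pi_int by blast
  then have "real i / real k = of_int m" using a by (simp add: field_simps)
  then have "real i = of_int m * real k" using a by (simp add: field_simps)
  then have e: "int i = m * int k" by (metis of_int_eq_iff of_int_mult of_int_of_nat_eq)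
  have "0 < m * int k" using e a by simp
  then have "m \<ge> 1" using a by (simp add: zero_less_mult_iff)
  then have "1 * int k \<le> m * int k" by (rule mult_right_mono) simp
  then have "int k \<le> int i" unfolding e by simp
  then show False using a by simp
qed

text \<open>The character takes the powers of the cycle to powers of the root of unity, so the
  condition at the generator implies the others by iteration. Right translation by the cycle thus
  multiplies \<open>F\<close> by the inverse root, which is why Klyachko's weights are taken at the
  inverse.\<close>

lemma Lie_carrier:
  assumes k: "k \<ge> 1"
  shows "carrier (Lie k) = {F \<in> carrier (sym_group k) \<rightarrow>\<^sub>E UNIV.
    \<forall>g\<in>carrier (sym_group k). unit_root k * F (g \<circ> std_cycle k) = F g}"
proof -
  let ?G = "sym_group k" and ?c = "std_cycle k"
  interpret G: group ?G by (rule sym_group_is_group)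
  have c: "?c \<in> carrier ?G" using std_cycle_permutes[of k] by (simp only: sym_group_carrier)
  have fin: "finite (carrier ?G)"
    using finite_permutations[of "{1..k}"] by (simp add: sym_group_def)
  have gen: "generate ?G {?c} = {?c ^^ l | l. True}"
    using G.generate_pow_on_finite_carrier[OF fin c] by (simp add: pow_sym_group)
  have z: "zeta k (?c ^^ l) = unit_root k ^ l" for l
    using zeta_std_cycle_power[OF k, of l] by (simp add: unit_root_def exp_of_nat_mult[symmetric] mult_ac)
  have cl: "?c ^^ l \<in> carrier ?G" for l
    using G.nat_pow_closed[OF c, of l] by (simp only: pow_sym_group)
  show ?thesis
  proof (intro equalityI subsetI)
    fix F assume F: "F \<in> carrier (Lie k)"
    have "?c ^^ 1 \<in> generate ?G {?c}" unfolding gen by blast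
    then have "zeta k (?c ^^ 1) * F (g \<circ> ?c ^^ 1) = F g" if "g \<in> carrier ?G" for g
      using F that unfolding Lie_def induced_rep_def character_rep_def by simp
    then show "F \<in> {F \<in> carrier ?G \<rightarrow>\<^sub>E UNIV. \<forall>g\<in>carrier ?G. unit_root k * F (g \<circ> ?c) = F g}"
      using F unfolding z by (simp add: Lie_def induced_rep_def character_rep_def)
  next
    fix F assume F: "F \<in> {F \<in> carrier ?G \<rightarrow>\<^sub>E UNIV. \<forall>g\<in>carrier ?G. unit_root k * F (g \<circ> ?c) = F g}"
    have "unit_root k ^ l * F (g \<circ> ?c ^^ l) = F g" if g: "g \<in> carrier ?G" for g l
    proof (induction l)
      case (Suc l)
      have "g \<circ> ?c ^^ l \<in> carrier ?G" using G.m_closed[OF g cl] by simp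
      then have "unit_root k * F ((g \<circ> ?c ^^ l) \<circ> ?c) = F (g \<circ> ?c ^^ l)" using F by blast
      then have "unit_root k ^ l * (unit_root k * F ((g \<circ> ?c ^^ l) \<circ> ?c)) = unit_root k ^ l * F (g \<circ> ?c ^^ l)"
        by (rule arg_cong)
      also have "\<dots> = F g" by (rule Suc)
      finally have "unit_root k ^ l * (unit_root k * F ((g \<circ> ?c ^^ l) \<circ> ?c)) = F g" .
      moreover have "g \<circ> ?c ^^ Suc l = (g \<circ> ?c ^^ l) \<circ> ?c" by (simp only: funpow_Suc_right comp_assoc)
      ultimately show ?case by (simp only: power_Suc2 mult.assoc)
    qed simp
    then have "\<forall>h\<in>generate ?G {?c}. zeta k h * F (g \<circ> h) = F g" if "g \<in> carrier ?G" for g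
      using that unfolding gen by (auto simp: z)
    then show "F \<in> carrier (Lie k)"
      using F by (simp add: Lie_def induced_rep_def character_rep_def)
  qed
qed

section \<open>From functions on the group to functions on words\<close>

context braid_words
begin

abbreviation "G \<equiv> carrier (sym_group n)"
abbreviation "iv \<equiv> Hilbert_Choice.inv"

lemma G_iff: "g \<in> G \<longleftrightarrow> g permutes A"
  by (simp only: sym_group_carrier)

lemma finite_G [simp]: "finite G"
  using finite_permutations[of A] by (simp add: sym_group_def)

lemma card_G: "card G = fact n"
  using card_permutations[of A n] by (simp add: sym_group_def)

lemma G_comp: "g \<in> G \<Longrightarrow> h \<in> G \<Longrightarrow> g \<circ> h \<in> G"
  unfolding G_iff by (rule permutes_compose)

lemma G_inv: "g \<in> G \<Longrightarrow> iv g \<in> G"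
  unfolding G_iff by (rule permutes_inv)

lemma G_id: "id \<in> G"
  unfolding G_iff by (rule permutes_id)

lemma G_inj: "g \<in> G \<Longrightarrow> inj g"
  unfolding G_iff by (rule permutes_inj)

lemma G_in: "g \<in> G \<Longrightarrow> i \<in> A \<Longrightarrow> g i \<in> A"
  using permutes_in_image[of g A i] unfolding G_iff by blast

lemma G_inv_o: "g \<in> G \<Longrightarrow> g \<circ> iv g = id" "g \<in> G \<Longrightarrow> iv g \<circ> g = id"
  unfolding G_iff by (rule permutes_inv_o(1), assumption) (rule permutes_inv_o(2), assumption)

lemma n_in: "n \<in> A" "1 \<in> A"
  using n3 by auto

abbreviation word :: "(nat \<Rightarrow> nat) \<Rightarrow> nat list" where "word g \<equiv> map g idw"

lemma map_W: "g \<in> G \<Longrightarrow> w \<in> W \<Longrightarrow> map g w \<in> W"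
  using permutes_image[of g A] inj_on_subset[OF G_inj[of g], of A]
  by (simp add: words_def distinct_map G_iff)

lemma word_W: "g \<in> G \<Longrightarrow> word g \<in> W"
  by (rule map_W[OF _ idw_W])

lemma map_inv_cancel: "g \<in> G \<Longrightarrow> map (iv g) (map g w) = w" "g \<in> G \<Longrightarrow> map g (map (iv g) w) = w"
  using G_inv_o[of g] by simp_all

lemma last_word: "last (word g) = g n"
  using n3 by (simp add: last_map)

lemma hd_word: "hd (word g) = g 1"
  using n3 by (simp add: hd_map hd_upt del: upt_Suc)

lemma word_inj: "g \<in> G \<Longrightarrow> h \<in> G \<Longrightarrow> word g = word h \<Longrightarrow> g = h"
proof
  fix i assume g: "g \<in> G" "h \<in> G" "word g = word h"
  show "g i = h i"
  proof (cases "i \<in> A")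
    case True
    then have "i \<in> set idw" by (simp del: upt_Suc)
    then show ?thesis using g(3) unfolding map_eq_conv by blast
  next
    case False
    then show ?thesis using g(1,2) permutes_not_in[of g A i] permutes_not_in[of h A i]
      unfolding G_iff by simp
  qed
qed

lemma word_surj:
  assumes w: "w \<in> W"
  shows "\<exists>g\<in>G. word g = w"
proof -
  define g where "g = (\<lambda>i. if i \<in> A then w ! (i - 1) else i)"
  have l: "length w = n" "distinct w" "set w = A" using w W_length by (auto simp: words_def)
  have "bij_betw (\<lambda>i. i - 1) A {..<n}"
    by (rule bij_betw_byWitness[where f' = Suc]) auto
  moreover have "bij_betw ((!) w) {..<n} A" using l by (intro bij_betw_nth) auto
  ultimately have "bij_betw ((!) w \<circ> (\<lambda>i. i - 1)) A A" by (rule bij_betw_trans)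
  then have "bij_betw g A A" by (rule iffD2[OF bij_betw_cong, rotated]) (simp add: g_def)
  then have "g \<in> G" unfolding G_iff by (rule bij_imp_permutes) (simp only: g_def if_False)
  moreover have "word g = w"
    by (rule nth_equalityI) (use l in \<open>auto simp: g_def simp del: upt_Suc\<close>)
  ultimately show ?thesis by blast
qed

lemma sum_word: "(\<Sum>g\<in>G. f (word g)) = (\<Sum>w\<in>W. f w)"
proof -
  have "inj_on word G" using word_inj by (meson inj_onI)
  moreover have "word ` G = W"
  proof
    show "word ` G \<subseteq> W" by (rule image_subsetI) (rule word_W)
    show "W \<subseteq> word ` G"
    proof
      fix w assume "w \<in> W"
      from word_surj[OF this] obtain g where "g \<in> G" "word g = w" by (elim bexE)
      then show "w \<in> word ` G" by (metis imageI)
    qed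
  qed
  ultimately show ?thesis using sum.reindex[of word G f] by (simp add: comp_def)
qed

lemma Q_shift: "h \<in> G \<Longrightarrow> x \<in> W \<Longrightarrow> Q (map h l) x = Q l (map (iv h) x)"
proof -
  assume h: "h \<in> G" and x: "x \<in> W"
  have "map (iv h) x \<noteq> []" using W_ne[OF x] by simp
  from Q_map[OF G_inj[OF h] this, of l] show ?thesis by (simp only: map_inv_cancel[OF h])
qed

text \<open>The tensor Q_w \<otimes> e_j in V \<otimes> \<complex>^n, realised as a function of an
  argument word and an index.\<close>

definition qv :: "nat list \<Rightarrow> nat \<Rightarrow> nat list \<times> nat \<Rightarrow> complex" where
  "qv w j = (\<lambda>(x, i). if x \<in> W \<and> i = j then Q w x else 0)"

definition Y :: "(nat list \<times> nat \<Rightarrow> complex) set" where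
  "Y = fv.span {qv w j | w j. w \<in> W \<and> j \<in> A}"

lemma qv_Y: "w \<in> W \<Longrightarrow> j \<in> A \<Longrightarrow> qv w j \<in> Y"
  unfolding Y_def by (rule fv.span_base) blast

lemma qv_rot_to: "w \<in> W \<Longrightarrow> k \<in> A \<Longrightarrow> qv (rot_to k w) j = qv w j"
  by (rule ext) (auto simp: qv_def Q_rot_to)

definition \<rho> :: "(nat \<Rightarrow> nat) \<Rightarrow> (nat list \<times> nat \<Rightarrow> complex) \<Rightarrow> nat list \<times> nat \<Rightarrow> complex" where
  "\<rho> g y = (\<lambda>(x, i). y (map (iv g) x, iv g i))"

lemma \<rho>_comp: "g \<in> G \<Longrightarrow> h \<in> G \<Longrightarrow> \<rho> (g \<circ> h) y = \<rho> g (\<rho> h y)"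
proof -
  assume "g \<in> G" "h \<in> G"
  then have e: "iv (g \<circ> h) = iv h \<circ> iv g" unfolding G_iff by (intro o_inv_distrib permutes_bij)
  show ?thesis unfolding \<rho>_def e by (simp add: case_prod_beta)
qed

lemma \<rho>_id: "\<rho> id y = y"
  by (simp add: \<rho>_def inv_id)

lemma qv_act:
  assumes h: "h \<in> G"
  shows "qv (map h w) (h j) = \<rho> h (qv w j)"
proof (rule ext, clarify)
  fix x i
  have "x \<in> W \<longleftrightarrow> map (iv h) x \<in> W"
    using map_W[OF h, of "map (iv h) x"] map_W[OF G_inv[OF h], of x] map_inv_cancel[OF h] by metis
  moreover have "i = h j \<longleftrightarrow> iv h i = j"
    using h permutes_inv_eq[of h A i j] unfolding G_iff by auto
  ultimately show "qv (map h w) (h j) (x, i) = \<rho> h (qv w j) (x, i)"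
    using Q_shift[OF h, of x w] by (simp add: qv_def \<rho>_def)
qed

text \<open>Defined on all functions on the group at once. The maps from \<open>Lie n\<close> and
  from the induced representation are its restrictions to functions transforming under the n-cycle
  and under the (n-1)-cycle.\<close>

definition Phi :: "((nat \<Rightarrow> nat) \<Rightarrow> complex) \<Rightarrow> nat list \<times> nat \<Rightarrow> complex" where
  "Phi F = (\<lambda>b. \<Sum>g\<in>G. F g * qv (word g) (g n) b)"

lemma Y_lincomb: "(\<And>i. i \<in> I \<Longrightarrow> e i \<in> Y) \<Longrightarrow> (\<lambda>x. \<Sum>i\<in>I. a i * e i x) \<in> Y"
  unfolding Y_def by (rule span_lincomb)

lemma Phi_Y: "Phi F \<in> Y"
  unfolding Phi_def
proof (rule Y_lincomb)
  fix g assume g: "g \<in> G"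
  show "qv (word g) (g n) \<in> Y" by (rule qv_Y[OF word_W[OF g] G_in[OF g n_in(1)]])
qed

lemma Phi_cong: "(\<And>g. g \<in> G \<Longrightarrow> F g = F' g) \<Longrightarrow> Phi F = Phi F'"
  unfolding Phi_def by (intro ext sum.cong) auto

lemma Phi_add: "Phi (\<lambda>g. F g + F' g) = (\<lambda>b. Phi F b + Phi F' b)"
  by (rule ext) (simp add: Phi_def distrib_right sum.distrib)

lemma Phi_scale: "Phi (\<lambda>g. c * F g) = (\<lambda>b. c * Phi F b)"
  by (rule ext) (simp add: Phi_def sum_distrib_left mult.assoc)

lemma Phi_zero: "Phi (\<lambda>g. 0) = (\<lambda>b. 0)"
  by (rule ext) (simp add: Phi_def)

lemma Phi_translate:
  assumes h: "h \<in> G"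
  shows "Phi (\<lambda>k. F (iv h \<circ> k)) = \<rho> h (Phi F)"
proof
  fix b
  have "Phi (\<lambda>k. F (iv h \<circ> k)) b = (\<Sum>g\<in>G. F g * qv (word (h \<circ> g)) ((h \<circ> g) n) b)"
    unfolding Phi_def
  proof (rule sum.reindex_bij_witness[where i = "\<lambda>g. h \<circ> g" and j = "\<lambda>k. iv h \<circ> k"])
    fix k assume k: "k \<in> G"
    show e: "h \<circ> (iv h \<circ> k) = k" using G_inv_o[OF h] by (simp add: comp_assoc[symmetric])
    show "iv h \<circ> k \<in> G" by (rule G_comp[OF G_inv[OF h] k])
    show "F (iv h \<circ> k) * qv (word (h \<circ> (iv h \<circ> k))) ((h \<circ> (iv h \<circ> k)) n) b =
      F (iv h \<circ> k) * qv (word k) (k n) b" by (simp only: e)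
  next
    fix g assume g: "g \<in> G"
    show "iv h \<circ> (h \<circ> g) = g" using G_inv_o[OF h] by (simp add: comp_assoc[symmetric])
    show "h \<circ> g \<in> G" by (rule G_comp[OF h g])
  qed
  also have "\<dots> = (\<Sum>g\<in>G. F g * \<rho> h (qv (word g) (g n)) b)"
    by (simp only: map_map[symmetric] comp_apply qv_act[OF h])
  also have "\<dots> = \<rho> h (Phi F) b"
    by (simp add: \<rho>_def Phi_def case_prod_beta)
  finally show "Phi (\<lambda>k. F (iv h \<circ> k)) b = \<rho> h (Phi F) b" .
qed

text \<open>Index set for words that end in \<open>n - 1\<close>, \<open>n\<close>, with an
  arbitrary tensor factor e_j. By \<open>Q_indicator\<close> these n (n-2)! vectors have dual
  evaluation points, which bounds the dimension of \<open>Y\<close> from below.\<close>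

definition M :: "((nat \<Rightarrow> nat) \<times> nat) set" where
  "M = {s. s permutes {1..n - 2}} \<times> A"

lemma finite_M [simp]: "finite M" and card_M: "card M = fact (n - 2) * n"
  using finite_permutations[of "{1..n - 2}"] card_permutations[of "{1..n - 2}" "n - 2"]
  by (simp_all add: M_def card_cartesian_product)

lemma small_perm_G: "s permutes {1..n - 2} \<Longrightarrow> s \<in> G"
  unfolding G_iff by (rule permutes_subset) auto

lemma Q_small_perm:
  assumes s: "s permutes {1..n - 2}" and t: "t permutes {1..n - 2}"
  shows "Q (word s) (word t) = of_bool (s = t)"
proof -
  obtain k where k: "n = Suc (Suc k)" using n3 by (metis add_2_eq_Suc le_Suc_ex numeral_3_eq_3 Suc_leD add_Suc numeral_2_eq_2)
  have w: "word p = map p [1..<n - 1] @ [n - 1, n]" if "p permutes {1..n - 2}" for p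
  proof -
    have "n - 1 \<notin> {1..n - 2}" "n \<notin> {1..n - 2}" using n3 by auto
    then have "p (n - 1) = n - 1" "p n = n" using permutes_not_in[OF that] by blast+
    moreover have "idw = [1..<n - 1] @ [n - 1, n]" using k n3 by simp
    ultimately show ?thesis by simp
  qed
  have sub: "p i \<in> {1..n - 2}" if "p permutes {1..n - 2}" "i \<in> {1..n - 2}" for p i
    using permutes_in_image[OF that(1), of i] that(2) by blast
  have notin: "n - 1 \<notin> set (map p [1..<n - 1])" "n \<notin> set (map p [1..<n - 1] @ [n - 1])"
    if "p permutes {1..n - 2}" for p
  proof -
    have "set (map p [1..<n - 1]) \<subseteq> {1..n - 2}" using sub[OF that] n3 by force
    then show "n - 1 \<notin> set (map p [1..<n - 1])" "n \<notin> set (map p [1..<n - 1] @ [n - 1])" using n3 by auto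
  qed
  have "Q (word s) (word t) = of_bool (map t [1..<n - 1] = map s [1..<n - 1])"
    unfolding w[OF s] w[OF t] by (rule Q_indicator[OF notin(1)[OF t] notin(2)[OF t] notin(2)[OF s]])
  also have "map t [1..<n - 1] = map s [1..<n - 1] \<longleftrightarrow> s = t"
    using w[OF s] w[OF t] word_inj[OF small_perm_G[OF s] small_perm_G[OF t]] by auto
  finally show ?thesis .
qed

lemma qv_dual:
  assumes "k \<in> M" "k' \<in> M"
  shows "(\<lambda>(s, j). qv (word s) j) k ((\<lambda>(s, j). (word s, j)) k') = of_bool (k = k')"
proof -
  obtain s j t i where k: "k = (s, j)" "k' = (t, i)" "s permutes {1..n - 2}" "t permutes {1..n - 2}"
    using assms unfolding M_def by blast
  show ?thesis
    using Q_small_perm[OF k(3,4)] word_W[OF small_perm_G[OF k(4)]] unfolding k(1,2)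
    by (simp add: qv_def del: upt_Suc)
qed

lemma qv_M_Y:
  assumes "k \<in> M"
  shows "(\<lambda>(s, j). qv (word s) j) k \<in> Y"
proof -
  obtain s j where k: "k = (s, j)" "s permutes {1..n - 2}" "j \<in> A"
    using assms unfolding M_def by blast
  show ?thesis using qv_Y[OF word_W[OF small_perm_G[OF k(2)]] k(3)] unfolding k(1) by simp
qed

end

text \<open>Functions on the symmetric group which transform by a root of unity under right multiplication
  by the cycle on \<open>1, \<dots>, m\<close>; each orbit contains one \<open>g\<close> with \<open>g 1 = \<tau> g\<close>.\<close>

locale cyclic_functions = braid_words +
  fixes m :: nat and \<tau> :: "(nat \<Rightarrow> nat) \<Rightarrow> nat"
  assumes m1: "m \<ge> 1" and mn: "m \<le> n"
    and \<tau>_cycle: "g \<in> G \<Longrightarrow> \<tau> (g \<circ> std_cycle m) = \<tau> g"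
    and \<tau>_in: "g \<in> G \<Longrightarrow> \<exists>p\<in>{1..m}. g p = \<tau> g"
begin

abbreviation "c \<equiv> std_cycle m"
abbreviation "\<omega> \<equiv> unit_root m"

definition Z where "Z = {F. \<forall>g\<in>G. \<omega> * F (g \<circ> c) = F g}"

definition Reps where "Reps = {g \<in> G. g 1 = \<tau> g}"

lemma c_G: "c \<in> G"
  unfolding G_iff by (rule permutes_subset[OF std_cycle_permutes]) (use mn in auto)

lemma c_pow_G: "c ^^ i \<in> G"
  by (induction i) (simp_all only: funpow.simps G_id G_comp c_G)

lemma finite_Reps [simp]: "finite Reps"
  by (simp add: Reps_def)

lemma \<tau>_pow: "g \<in> G \<Longrightarrow> \<tau> (g \<circ> c ^^ i) = \<tau> g"
proof (induction i)
  case (Suc i)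
  have "\<tau> ((g \<circ> c ^^ i) \<circ> c) = \<tau> (g \<circ> c ^^ i)" by (rule \<tau>_cycle[OF G_comp[OF Suc.prems c_pow_G]])
  then show ?case using Suc by (simp only: funpow_Suc_right comp_assoc)
qed simp

text \<open>Since \<open>c ^^ i\<close> sends 1 to \<open>Suc i\<close> for \<open>i < m\<close>,
  the value at 1 of the translates of \<open>g\<close> runs once through \<open>g 1\<close>, ...,
  \<open>g m\<close>, while the marked value \<open>\<tau> g\<close> stays fixed.\<close>

lemma Reps_unique:
  assumes g: "g \<in> G"
  shows "\<exists>p<m. \<forall>i<m. g \<circ> c ^^ i \<in> Reps \<longleftrightarrow> i = p"
proof -
  obtain q where q: "q \<in> {1..m}" "g q = \<tau> g" using \<tau>_in[OF g] by (elim bexE)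
  have "g \<circ> c ^^ i \<in> Reps \<longleftrightarrow> i = q - 1" if "i < m" for i
  proof -
    have "g \<circ> c ^^ i \<in> Reps \<longleftrightarrow> (g \<circ> c ^^ i) 1 = \<tau> (g \<circ> c ^^ i)"
      using G_comp[OF g c_pow_G] by (simp only: Reps_def mem_Collect_eq simp_thms)
    also have "\<dots> \<longleftrightarrow> g (Suc i) = g q"
      using that by (simp only: \<tau>_pow[OF g] comp_apply std_cycle_pow_1[OF m1] mod_less q(2))
    also have "\<dots> \<longleftrightarrow> Suc i = q" by (rule inj_eq[OF G_inj[OF g]])
    also have "\<dots> \<longleftrightarrow> i = q - 1" using q(1) by auto
    finally show ?thesis .
  qed
  moreover have "q - 1 < m" using q(1) by auto
  ultimately show ?thesis by blast
qed

lemma Z_pow: "F \<in> Z \<Longrightarrow> g \<in> G \<Longrightarrow> F g = \<omega> ^ i * F (g \<circ> c ^^ i)"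
proof (induction i)
  case (Suc i)
  have "\<omega> * F ((g \<circ> c ^^ i) \<circ> c) = F (g \<circ> c ^^ i)"
    using Suc.prems G_comp[OF Suc.prems(2) c_pow_G] by (simp only: Z_def mem_Collect_eq)
  moreover have "g \<circ> c ^^ Suc i = (g \<circ> c ^^ i) \<circ> c" by (simp only: funpow_Suc_right comp_assoc)
  ultimately show ?case using Suc by (simp only: power_Suc2 mult.assoc)
qed simp

lemma Z_zero:
  assumes F: "F \<in> Z" "\<And>r. r \<in> Reps \<Longrightarrow> F r = 0" and g: "g \<in> G"
  shows "F g = 0"
proof -
  from Reps_unique[OF g] obtain p where p: "p < m" "\<forall>i<m. g \<circ> c ^^ i \<in> Reps \<longleftrightarrow> i = p" by (elim exE conjE)
  then have "g \<circ> c ^^ p \<in> Reps" by simp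
  then show ?thesis using Z_pow[OF F(1) g, of p] F(2) by simp
qed

text \<open>The pairs of a group element and an exponent below \<open>m\<close> whose translate is a
  representative are counted in two ways.\<close>

lemma card_Reps: "m * card Reps = fact n"
proof -
  have "(fact n :: nat) = (\<Sum>g\<in>G. 1)" by (simp add: card_G)
  also have "\<dots> = (\<Sum>g\<in>G. \<Sum>i<m. of_bool (g \<circ> c ^^ i \<in> Reps))"
  proof (rule sum.cong[OF refl])
    fix g assume g: "g \<in> G"
    from Reps_unique[OF g] obtain p where p: "p < m" "\<forall>i<m. g \<circ> c ^^ i \<in> Reps \<longleftrightarrow> i = p" by (elim exE conjE)
    have "(\<Sum>i<m. of_bool (g \<circ> c ^^ i \<in> Reps)) = (\<Sum>i<m. if i = p then 1 else 0 :: nat)"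
      by (rule sum.cong) (use p(2) in auto)
    then show "1 = (\<Sum>i<m. of_bool (g \<circ> c ^^ i \<in> Reps) :: nat)" using p(1) by simp
  qed
  also have "\<dots> = (\<Sum>i<m. \<Sum>g\<in>G. of_bool (g \<circ> c ^^ i \<in> Reps))" by (rule sum.swap)
  also have "\<dots> = (\<Sum>i<m. card Reps)"
  proof (rule sum.cong[OF refl])
    fix i
    have "(\<Sum>g\<in>G. of_bool (g \<circ> c ^^ i \<in> Reps)) = (\<Sum>g\<in>G. of_bool (g \<in> Reps) :: nat)"
    proof (rule sum.reindex_bij_witness[where i = "\<lambda>g. g \<circ> iv (c ^^ i)" and j = "\<lambda>g. g \<circ> c ^^ i"])
      fix g assume g: "g \<in> G"
      show "g \<circ> c ^^ i \<circ> iv (c ^^ i) = g" "g \<circ> iv (c ^^ i) \<circ> c ^^ i = g"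
        using G_inv_o[OF c_pow_G[of i]] by (simp_all only: comp_assoc comp_id)
      show "g \<circ> c ^^ i \<in> G" "g \<circ> iv (c ^^ i) \<in> G" by (intro G_comp g c_pow_G G_inv)+
    qed auto
    also have "\<dots> = (\<Sum>g\<in>Reps. 1)" by (rule sum.mono_neutral_cong_right) (auto simp: Reps_def)
    finally show "(\<Sum>g\<in>G. of_bool (g \<circ> c ^^ i \<in> Reps)) = card Reps" by simp
  qed
  finally show ?thesis by simp
qed

text \<open>The image of the element of \<open>Z\<close> that is supported on the orbit of
  \<open>r\<close> and takes the value 1 at \<open>r\<close>.\<close>

definition orbit_vec :: "(nat \<Rightarrow> nat) \<Rightarrow> nat list \<times> nat \<Rightarrow> complex" where
  "orbit_vec r = Phi (\<lambda>g. \<Sum>i<m. of_bool (g \<circ> c ^^ i = r) * \<omega> ^ i)"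

lemma Phi_Reps:
  assumes F: "F \<in> Z"
  shows "Phi F = (\<lambda>b. \<Sum>r\<in>Reps. F r * orbit_vec r b)"
proof -
  have e: "F g = (\<Sum>r\<in>Reps. F r * (\<Sum>i<m. of_bool (g \<circ> c ^^ i = r) * \<omega> ^ i))" if g: "g \<in> G" for g
  proof -
    from Reps_unique[OF g] obtain p where p: "p < m" "\<forall>i<m. g \<circ> c ^^ i \<in> Reps \<longleftrightarrow> i = p" by (elim exE conjE)
    have "(\<Sum>r\<in>Reps. F r * (\<Sum>i<m. of_bool (g \<circ> c ^^ i = r) * \<omega> ^ i)) =
      (\<Sum>r\<in>Reps. \<Sum>i<m. if r = g \<circ> c ^^ i then F r * \<omega> ^ i else 0)"
      unfolding sum_distrib_left by (intro sum.cong) auto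
    also have "\<dots> = (\<Sum>i<m. \<Sum>r\<in>Reps. if r = g \<circ> c ^^ i then F r * \<omega> ^ i else 0)" by (rule sum.swap)
    also have "\<dots> = (\<Sum>i<m. if g \<circ> c ^^ i \<in> Reps then F (g \<circ> c ^^ i) * \<omega> ^ i else 0)"
      by (intro sum.cong refl sum.delta) simp
    also have "\<dots> = (\<Sum>i<m. if i = p then F (g \<circ> c ^^ p) * \<omega> ^ p else 0)"
      by (rule sum.cong) (use p(2) in auto)
    also have "\<dots> = F (g \<circ> c ^^ p) * \<omega> ^ p" using p(1) by simp
    also have "\<dots> = F g" using Z_pow[OF F g, of p] by (simp only: mult.commute)
    finally show ?thesis by (rule sym)
  qed
  have "Phi F = Phi (\<lambda>g. \<Sum>r\<in>Reps. F r * (\<Sum>i<m. of_bool (g \<circ> c ^^ i = r) * \<omega> ^ i))"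
    by (rule Phi_cong) (rule e)
  also have "\<dots> = (\<lambda>b. \<Sum>r\<in>Reps. F r * orbit_vec r b)"
  proof
    fix b
    have "Phi (\<lambda>g. \<Sum>r\<in>Reps. F r * (\<Sum>i<m. of_bool (g \<circ> c ^^ i = r) * \<omega> ^ i)) b =
      (\<Sum>g\<in>G. \<Sum>r\<in>Reps. F r * ((\<Sum>i<m. of_bool (g \<circ> c ^^ i = r) * \<omega> ^ i) * qv (word g) (g n) b))"
      by (simp only: Phi_def sum_distrib_right[of _ Reps] mult.assoc)
    also have "\<dots> = (\<Sum>r\<in>Reps. \<Sum>g\<in>G. F r * ((\<Sum>i<m. of_bool (g \<circ> c ^^ i = r) * \<omega> ^ i) * qv (word g) (g n) b))"
      by (rule sum.swap)
    also have "\<dots> = (\<Sum>r\<in>Reps. F r * orbit_vec r b)"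
      by (simp only: orbit_vec_def Phi_def sum_distrib_left)
    finally show "Phi (\<lambda>g. \<Sum>r\<in>Reps. F r * (\<Sum>i<m. of_bool (g \<circ> c ^^ i = r) * \<omega> ^ i)) b =
      (\<Sum>r\<in>Reps. F r * orbit_vec r b)" .
  qed
  finally show ?thesis .
qed

lemma Z_add: "F \<in> Z \<Longrightarrow> F' \<in> Z \<Longrightarrow> (\<lambda>g. F g + F' g) \<in> Z"
  by (simp add: Z_def distrib_left)

lemma Z_scale: "F \<in> Z \<Longrightarrow> (\<lambda>g. a * F g) \<in> Z"
  by (simp add: Z_def mult.left_commute)

lemma Z_zero_fun: "(\<lambda>g. 0) \<in> Z"
  by (simp add: Z_def)

lemma Z_translate: "F \<in> Z \<Longrightarrow> h \<in> G \<Longrightarrow> (\<lambda>k. F (iv h \<circ> k)) \<in> Z"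
  using G_comp[OF G_inv] by (simp add: Z_def comp_assoc[symmetric])

end

section \<open>Klyachko weights as functions on the group\<close>

lemma klyachko_snoc:
  assumes "l \<in> words {1..m}"
  shows "klyachko w m (l @ [x]) = klyachko w m l"
  unfolding klyachko_def
proof (rule prod.cong[OF refl])
  fix i assume "i \<in> {1..<m}"
  then have "i \<in> set l" using assms by (simp add: words_def)
  then show "(if sg (l @ [x]) i (Suc i) = 1 then 1 else w ^ i) = (if sg l i (Suc i) = 1 then 1 else w ^ i)"
    by (simp add: sg_append)
qed

lemma klyachko_constant_nonzero:
  "k \<le> m \<Longrightarrow> (\<Prod>i\<in>{1..<k}. 1 - inverse (unit_root m) ^ i) \<noteq> 0"
  using unit_root_pow_neq_1[of _ m] by (auto simp: power_inverse inverse_eq_1_iff)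

context braid_words
begin

lemma word_comp_cycle: "word (g \<circ> std_cycle n) = rotate1 (word g)"
proof -
  have "word (g \<circ> std_cycle n) = map g (map (std_cycle n) idw)" by (simp only: map_map)
  then show ?thesis by (simp only: map_std_cycle rotate1_map)
qed

lemma short_cycle_n: "std_cycle (n - 1) n = n"
  by (rule permutes_not_in[OF std_cycle_permutes]) (use n3 in auto)

lemma idw_snoc: "idw = [1..<Suc (n - 1)] @ [n]"
  using n3 by simp

lemma word_snoc: "word g = map g [1..<Suc (n - 1)] @ [g n]"
  by (simp only: idw_snoc map_append list.map)

lemma word_comp_short_cycle:
  "word (g \<circ> std_cycle (n - 1)) = rotate1 (map g [1..<Suc (n - 1)]) @ [g n]"
proof -
  have "word (g \<circ> std_cycle (n - 1)) = map g (map (std_cycle (n - 1)) [1..<Suc (n - 1)]) @ [g (std_cycle (n - 1) n)]"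
    by (simp only: idw_snoc map_append list.map map_map comp_apply)
  then show ?thesis by (simp only: map_std_cycle rotate1_map short_cycle_n)
qed

text \<open>The first \<open>n - 1\<close> positions take every value except \<open>g n\<close>; the
  marked value is the least of these, hence 2 when \<open>g n = 1\<close>.\<close>

sublocale short: cyclic_functions n "n - 1" "\<lambda>g. if g n = 1 then 2 else 1"
proof
  show "1 \<le> n - 1" "n - 1 \<le> n" using n3 by auto
  fix g assume g: "g \<in> G"
  show "(if (g \<circ> std_cycle (n - 1)) n = 1 then 2 else 1) = (if g n = 1 then 2 else (1::nat))"
    by (simp only: comp_apply short_cycle_n)
  let ?t = "if g n = 1 then 2 else (1::nat)"
  have t: "?t \<in> A" "g n \<noteq> ?t" using n3 by auto
  have e: "g (iv g ?t) = ?t" using fun_cong[OF G_inv_o(1)[OF g], of ?t] by (simp only: comp_apply id_apply)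
  have "iv g ?t \<in> A" by (rule G_in[OF G_inv[OF g] t(1)])
  moreover have "iv g ?t \<noteq> n"
  proof
    assume "iv g ?t = n"
    then show False using e t(2) by simp
  qed
  ultimately have "iv g ?t \<in> {1..n - 1}" by auto
  then show "\<exists>p\<in>{1..n - 1}. g p = ?t" using e by blast
qed

sublocale long: cyclic_functions n n "\<lambda>g. 1"
proof
  show "1 \<le> n" "n \<le> n" using n3 by auto
  fix g assume g: "g \<in> G"
  have "g (iv g 1) = 1" using fun_cong[OF G_inv_o(1)[OF g], of 1] by (simp only: comp_apply id_apply)
  then show "\<exists>p\<in>A. g p = 1" using G_in[OF G_inv[OF g] n_in(2)] by blast
qed (rule refl)

lemma qv_sum: "(\<Sum>g\<in>G. f (word g) * qv (word g) (g n) (x, i)) =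
    (if x \<in> W then \<Sum>v\<in>W. f v * (Q v x * of_bool (last v = i)) else 0)"
proof -
  have "(\<Sum>g\<in>G. f (word g) * qv (word g) (g n) (x, i)) =
    (\<Sum>g\<in>G. f (word g) * qv (word g) (last (word g)) (x, i))" by (simp only: last_word)
  also have "\<dots> = (\<Sum>v\<in>W. f v * qv v (last v) (x, i))"
    by (rule sum_word[of "\<lambda>v. f v * qv v (last v) (x, i)"])
  also have "\<dots> = (if x \<in> W then \<Sum>v\<in>W. f v * (Q v x * of_bool (last v = i)) else 0)"
    by (auto simp: qv_def intro!: sum.cong)
  finally show ?thesis .
qed

text \<open>Klyachko weights supported on the stabilizer of \<open>n\<close> are mapped to a
  multiple of \<open>qv idw n\<close>, and the multiple is nonzero because the root of unity is
  primitive. Translation reaches the other vectors, since \<open>w\<close> may be rotated so as to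
  end in \<open>j\<close>.\<close>

lemma qv_in_short_image:
  assumes w: "w \<in> W" and j: "j \<in> A"
  shows "\<exists>F\<in>short.Z. Phi F = qv w j"
proof -
  let ?w = "inverse (unit_root (n - 1))"
  define C where "C = (\<Prod>i\<in>{1..<n - 1}. 1 - ?w ^ i)"
  have C0: "C \<noteq> 0" unfolding C_def by (rule klyachko_constant_nonzero) simp
  define k where "k = (\<lambda>v. if last v = n then klyachko ?w (n - 1) v / C else 0)"
  define F where "F = (\<lambda>g. k (word g))"
  have FZ: "F \<in> short.Z" unfolding short.Z_def
  proof (intro CollectI ballI)
    fix g assume g: "g \<in> G"
    show "unit_root (n - 1) * F (g \<circ> std_cycle (n - 1)) = F g"
    proof (cases "g n = n")
      case True
      let ?l = "map g [1..<Suc (n - 1)]"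
      have "g \<in> point_stabilizer n" unfolding point_stabilizer_def using g True by blast
      then have "g permutes {1..n - 1}"
        using point_stabilizer_eq[of n] n3 by (simp only: sym_group_carrier)
      then have "g ` {1..n - 1} = {1..n - 1}" "inj_on g {1..n - 1}"
        by (rule permutes_image, rule permutes_inj_on)
      then have l: "?l \<in> words {1..n - 1}"
        by (simp add: words_def distinct_map atLeastLessThanSuc_atLeastAtMost del: upt_Suc)
      then have rl: "rotate1 ?l \<in> words {1..n - 1}" by (simp add: words_def)
      have "klyachko ?w (n - 1) (rotate1 ?l) = ?w * klyachko ?w (n - 1) ?l"
        by (rule klyachko_rotate1[OF l]) (use n3 in \<open>auto simp: power_inverse unit_root_pow\<close>)
      then show ?thesis
        unfolding F_def k_def word_comp_short_cycle word_snoc[of g] klyachko_snoc[OF l] klyachko_snoc[OF rl]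
        using True by simp
    next
      case False
      then show ?thesis unfolding F_def k_def word_comp_short_cycle word_snoc[of g] by simp
    qed
  qed
  have PF: "Phi F = qv idw n"
  proof (rule ext, clarify)
    fix x i
    have "Phi F (x, i) = (if x \<in> W then \<Sum>v\<in>W. k v * (Q v x * of_bool (last v = i)) else 0)"
      unfolding Phi_def F_def by (rule qv_sum)
    also have "\<dots> = qv idw n (x, i)"
    proof (cases "x \<in> W")
      case True
      have "(\<Sum>v\<in>W. k v * (Q v x * of_bool (last v = i))) =
          (\<Sum>v\<in>W. if last v = n then of_bool (i = n) / C * (klyachko ?w (n - 1) v * Q v x) else 0)"
        by (rule sum.cong) (auto simp: k_def)
      also have "\<dots> = (\<Sum>v | v \<in> W \<and> last v = n. of_bool (i = n) / C * (klyachko ?w (n - 1) v * Q v x))"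
        by (simp only: sum.inter_filter[OF finite_words[OF finite_atLeastAtMost]])
      also have "\<dots> = of_bool (i = n) / C * (C * Q idw x)"
        unfolding sum_distrib_left[symmetric] klyachko_short[OF True] C_def ..
      finally show ?thesis using True C0 by (simp add: qv_def del: upt_Suc)
    qed (simp add: qv_def)
    finally show "Phi F (x, i) = qv idw n (x, i)" .
  qed
  have rw: "rot_to j w \<in> W" by (rule rot_to_words[OF w j])
  from word_surj[OF rw] obtain h where h: "h \<in> G" "word h = rot_to j w" by (elim bexE)
  have hn: "h n = j" using last_word[of h] unfolding h(2) by simp
  have "Phi (\<lambda>k. F (iv h \<circ> k)) = \<rho> h (qv idw n)" unfolding Phi_translate[OF h(1)] PF ..
  also have "\<dots> = qv w j" unfolding qv_act[OF h(1), symmetric] h(2) hn by (rule qv_rot_to[OF w j])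
  finally show ?thesis using short.Z_translate[OF FZ h(1)] by blast
qed

lemma short_image: "y \<in> Y \<Longrightarrow> \<exists>F\<in>short.Z. Phi F = y"
proof -
  have "Y \<subseteq> Phi ` short.Z"
    unfolding Y_def
  proof (rule fv.span_minimal)
    show "{qv w j | w j. w \<in> W \<and> j \<in> A} \<subseteq> Phi ` short.Z"
    proof
      fix y assume "y \<in> {qv w j | w j. w \<in> W \<and> j \<in> A}"
      then obtain w j where "y = qv w j" "w \<in> W" "j \<in> A" by blast
      then show "y \<in> Phi ` short.Z" using qv_in_short_image[of w j] by force
    qed
    show "fv.subspace (Phi ` short.Z)"
    proof (rule fv.subspaceI)
      have "0 = Phi (\<lambda>g. 0)" by (simp only: Phi_zero zero_fun_def)
      then show "0 \<in> Phi ` short.Z" using short.Z_zero_fun by (rule image_eqI)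
      fix x y assume "x \<in> Phi ` short.Z" "y \<in> Phi ` short.Z"
      then obtain F F' where F: "x = Phi F" "F \<in> short.Z" "y = Phi F'" "F' \<in> short.Z" by blast
      have "x + y = Phi (\<lambda>g. F g + F' g)" by (simp only: F Phi_add plus_fun_def)
      then show "x + y \<in> Phi ` short.Z" using short.Z_add[OF F(2,4)] by (rule image_eqI)
    next
      fix a x assume "x \<in> Phi ` short.Z"
      then obtain F where F: "x = Phi F" "F \<in> short.Z" by blast
      have "fscale a x = Phi (\<lambda>g. a * F g)" by (simp only: F Phi_scale fscale_def)
      then show "fscale a x \<in> Phi ` short.Z" using short.Z_scale[OF F(2)] by (rule image_eqI)
    qed
  qed
  then show "y \<in> Y \<Longrightarrow> ?thesis" by blast
qed

abbreviation "dM \<equiv> \<lambda>(s, j). qv (word s) j"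
abbreviation "pM \<equiv> \<lambda>(s :: nat \<Rightarrow> nat, j :: nat). (word s, j)"

lemma fact_n: "fact n = n * ((n - 1) * fact (n - 2))"
proof -
  from le_Suc_ex[OF n3] obtain k where "n = 3 + k" by (elim exE)
  then have "n = Suc (Suc (Suc k))" by simp
  then show ?thesis by simp
qed

text \<open>There are n!/(n-1) = n (n-2)! orbits, as many as elements of \<open>M\<close>. Their
  vectors span the independent family indexed by \<open>M\<close>, so they are independent
  themselves.\<close>

lemma short_kernel:
  assumes F: "F \<in> short.Z" and z: "Phi F = (\<lambda>b. 0)" and g: "g \<in> G"
  shows "F g = 0"
proof (rule short.Z_zero[OF F _ g])
  fix r assume r: "r \<in> short.Reps"
  show "F r = 0"
  proof (rule spanning_family(1)[where I = short.Reps and M = M and d = dM and pt = pM and e = short.orbit_vec and c = F and i = r])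
    have "(n - 1) * card short.Reps = (n - 1) * card M"
      unfolding short.card_Reps card_M fact_n by simp
    then show "card short.Reps \<le> card M" using n3 by simp
    show "dM k (pM k') = of_bool (k = k')" if "k \<in> M" "k' \<in> M" for k k' by (rule qv_dual[OF that])
    show "dM k \<in> fv.span (short.orbit_vec ` short.Reps)" if k: "k \<in> M" for k
    proof -
      from short_image[OF qv_M_Y[OF k]] obtain F' where F': "F' \<in> short.Z" "Phi F' = dM k" by (elim bexE)
      show ?thesis unfolding F'(2)[symmetric] short.Phi_Reps[OF F'(1)]
        by (intro span_lincomb fv.span_base imageI)
    qed
    show "(\<lambda>x. \<Sum>i\<in>short.Reps. F i * short.orbit_vec i x) = (\<lambda>x. 0)"
      unfolding short.Phi_Reps[OF F, symmetric] by (rule z)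
  qed (rule short.finite_Reps finite_M r)+
qed

text \<open>For each index let S and H be the weighted sums over words with that last, respectively
  first, letter. Rotation makes them proportional, and Klyachko's identity gives their difference;
  together these determine S.\<close>

lemma long_difference:
  "\<exists>F\<in>long.Z. Phi F = (\<lambda>b. qv idw n b - qv idw 1 b)"
proof -
  let ?w = "inverse (unit_root n)"
  define C where "C = (\<Prod>i\<in>{1..<n}. 1 - ?w ^ i)"
  have C0: "C \<noteq> 0" unfolding C_def by (rule klyachko_constant_nonzero) simp
  have w1: "1 - unit_root n \<noteq> 0" using unit_root_pow_neq_1[of 1 n] n3 by simp
  \<comment> \<open>Since H is \<open>unit_root n\<close> times S, the difference of S and H is
    \<open>1 - unit_root n\<close> times S; dividing by the constant \<open>C\<close> of Klyachko's
    identity normalises the result.\<close>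
  define a where "a = (1 - unit_root n) / C"
  define F where "F = (\<lambda>g. a * klyachko ?w n (word g))"
  have rot: "klyachko ?w n (rotate1 v) = ?w * klyachko ?w n v" if "v \<in> W" for v
    by (rule klyachko_rotate1[OF that]) (use n3 in \<open>auto simp: power_inverse unit_root_pow\<close>)
  have FZ: "F \<in> long.Z" unfolding long.Z_def
  proof (intro CollectI ballI)
    fix g assume g: "g \<in> G"
    show "unit_root n * F (g \<circ> std_cycle n) = F g"
      unfolding F_def word_comp_cycle rot[OF word_W[OF g]] by (simp add: mult_ac)
  qed
  have "Phi F = (\<lambda>b. qv idw n b - qv idw 1 b)"
  proof (rule ext, clarify)
    fix x i
    have P: "Phi F (x, i) = (if x \<in> W then \<Sum>v\<in>W. (a * klyachko ?w n v) * (Q v x * of_bool (last v = i)) else 0)"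
      unfolding Phi_def F_def by (rule qv_sum)
    show "Phi F (x, i) = qv idw n (x, i) - qv idw 1 (x, i)"
    proof (cases "x \<in> W")
      case x: True
      define S where "S = (\<Sum>v\<in>W. klyachko ?w n v * (Q v x * of_bool (last v = i)))"
      define H where "H = (\<Sum>v\<in>W. klyachko ?w n v * (Q v x * of_bool (hd v = i)))"
      have "S = (\<Sum>v\<in>W. ?w * (klyachko ?w n v * (Q v x * of_bool (hd v = i))))"
        unfolding S_def
      proof (rule sum.reindex_bij_witness[where i = rotate1 and j = "\<lambda>v. last v # butlast v"])
        fix v assume v: "v \<in> W"
        have e: "v = butlast v @ [last v]" using W_ne[OF v] by simp
        show r: "rotate1 (last v # butlast v) = v" using e by simp
        have "b # l \<in> W" if "l @ [b] \<in> W" for b l using that by (simp add: words_def)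
        from this[of "butlast v" "last v"] show lv: "last v # butlast v \<in> W" using v e by simp
        have "klyachko ?w n v = ?w * klyachko ?w n (last v # butlast v)"
          using rot[OF lv] unfolding r .
        moreover have "Q v x = Q (last v # butlast v) x"
          using Q_rotate1[OF lv x] n3 unfolding r by simp
        ultimately show "?w * (klyachko ?w n (last v # butlast v) * (Q (last v # butlast v) x * of_bool (hd (last v # butlast v) = i))) =
          klyachko ?w n v * (Q v x * of_bool (last v = i))" by simp
      next
        fix v assume v: "v \<in> W"
        then obtain b r where "v = b # r" using W_ne[OF v] by (cases v) auto
        then show "last (rotate1 v) # butlast (rotate1 v) = v" by simp
        show "rotate1 v \<in> W" using v by (simp add: words_def)
      qed
      then have SH: "S = ?w * H" by (simp only: H_def sum_distrib_left)
      then have HS: "H = unit_root n * S" by simp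
      have D: "S - H = C * (Q idw x * (of_bool (n = i) - of_bool (1 = i)))" if "i \<in> A"
        using klyachko_long[OF x that, of ?w]
        unfolding S_def H_def C_def by (simp only: right_diff_distrib sum_subtractf)
      have S0: "a * S = Q idw x * (of_bool (n = i) - of_bool (1 = i))"
      proof (cases "i \<in> A")
        case True
        have "C * (a * S) = (1 - unit_root n) * S" using C0 by (simp add: a_def)
        also have "\<dots> = S - H" unfolding HS by (simp add: left_diff_distrib)
        also have "\<dots> = C * (Q idw x * (of_bool (n = i) - of_bool (1 = i)))" by (rule D[OF True])
        finally show ?thesis by (rule iffD1[OF mult_left_cancel[OF C0]])
      next
        case False
        have "S = (\<Sum>v\<in>W. 0)" unfolding S_def
        proof (rule sum.cong[OF refl])
          fix v assume "v \<in> W"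
          then have "last v \<in> A" using words_last_in[of v A] n3 by auto
          then show "klyachko ?w n v * (Q v x * of_bool (last v = i)) = 0" using False by auto
        qed
        moreover have "i \<noteq> n" "i \<noteq> 1" using False n_in by auto
        ultimately show ?thesis by simp
      qed
      have "Phi F (x, i) = a * S" unfolding P if_P[OF x] S_def sum_distrib_left mult.assoc ..
      then show ?thesis using x S0 by (auto simp: qv_def algebra_simps simp del: upt_Suc)
    qed (simp add: P qv_def)
  qed
  then show ?thesis using FZ by blast
qed

end

section \<open>Surjectivity from the top component and \<open>Lie n\<close> together\<close>

context braid_words
begin

definition Hom where "Hom = {p \<in> polys K. homogeneous (n - 2) p}"

definition lift :: "(nat list \<Rightarrow> complex) \<Rightarrow> nat list \<times> nat \<Rightarrow> complex" where
  "lift t = (\<lambda>(x, i). if i \<in> A then t x else 0)"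

lemma lift_add: "lift (\<lambda>x. s x + t x) = (\<lambda>b. lift s b + lift t b)"
  by (rule ext, clarify) (simp add: lift_def)

lemma lift_scale: "lift (\<lambda>x. a * s x) = (\<lambda>b. a * lift s b)"
  by (rule ext, clarify) (simp add: lift_def)

lemma lift_zero: "lift (\<lambda>x. 0) = (\<lambda>b. 0)"
  by (rule ext, clarify) (simp add: lift_def)

lemma lift_sum: "lift (\<lambda>x. \<Sum>i\<in>I. a i * s i x) = (\<lambda>b. \<Sum>i\<in>I. a i * lift (s i) b)"
proof (rule ext, clarify)
  fix x k
  show "lift (\<lambda>x. \<Sum>i\<in>I. a i * s i x) (x, k) = (\<Sum>i\<in>I. a i * lift (s i) (x, k))"
    by (cases "k \<in> A") (simp_all only: lift_def prod.case if_True if_False mult_zero_right sum.neutral_const)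
qed

lemma Hom_zero: "0 \<in> Hom"
  by (simp add: Hom_def homogeneous_zero)

lemma Hom_add: "p \<in> Hom \<Longrightarrow> q \<in> Hom \<Longrightarrow> p + q \<in> Hom"
  by (simp add: Hom_def homogeneous_add)

lemma Hom_scale: "p \<in> Hom \<Longrightarrow> Const a * p \<in> Hom"
  by (simp add: Hom_def homogeneous_Const_mult)

lemma Hom_rn: "g \<in> G \<Longrightarrow> p \<in> Hom \<Longrightarrow> rn g p \<in> Hom"
  unfolding Hom_def G_iff by (simp add: homogeneous_rename rename_polys_kact)

lemma chain_poly_Hom: "w \<in> W \<Longrightarrow> chain_poly w \<in> Hom"
  unfolding Hom_def using chain_poly_polys chain_poly_homogeneous by blast

definition Img where "Img = {\<lambda>b. lift (T p) b + Phi F b | p F. p \<in> Hom \<and> F \<in> long.Z}"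

lemma ImgI: "p \<in> Hom \<Longrightarrow> F \<in> long.Z \<Longrightarrow> (\<lambda>b. lift (T p) b + Phi F b) \<in> Img"
  unfolding Img_def by blast

lemma Img_subspace: "fv.subspace Img"
proof (rule fv.subspaceI)
  have "0 = (\<lambda>b. lift (T 0) b + Phi (\<lambda>g. 0) b)" by (simp add: T_zero lift_zero Phi_zero zero_fun_def)
  then show "0 \<in> Img" using ImgI[OF Hom_zero long.Z_zero_fun] by simp
next
  fix x y assume "x \<in> Img" "y \<in> Img"
  then obtain p F q F' where e: "x = (\<lambda>b. lift (T p) b + Phi F b)" "p \<in> Hom" "F \<in> long.Z"
    "y = (\<lambda>b. lift (T q) b + Phi F' b)" "q \<in> Hom" "F' \<in> long.Z" unfolding Img_def by blast
  have "x + y = (\<lambda>b. lift (T (p + q)) b + Phi (\<lambda>g. F g + F' g) b)"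
    by (simp add: e T_add lift_add Phi_add plus_fun_def algebra_simps)
  then show "x + y \<in> Img" using ImgI[OF Hom_add[OF e(2,5)] long.Z_add[OF e(3,6)]] by simp
next
  fix a x assume "x \<in> Img"
  then obtain p F where e: "x = (\<lambda>b. lift (T p) b + Phi F b)" "p \<in> Hom" "F \<in> long.Z"
    unfolding Img_def by blast
  have "fscale a x = (\<lambda>b. lift (T (Const a * p)) b + Phi (\<lambda>g. a * F g) b)"
    by (simp only: e T_Const lift_scale Phi_scale fscale_def distrib_left)
  then show "fscale a x \<in> Img" using ImgI[OF Hom_scale[OF e(2)] long.Z_scale[OF e(3)]] by simp
qed

lemma Phi_Img: "F \<in> long.Z \<Longrightarrow> Phi F \<in> Img"
  using ImgI[OF Hom_zero, of F] by (simp add: T_zero lift_zero)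

lemma lift_Img: "p \<in> Hom \<Longrightarrow> lift (T p) \<in> Img"
  using ImgI[OF _ long.Z_zero_fun, of p] by (simp add: Phi_zero)

lemma \<rho>_diff: "\<rho> h (\<lambda>b. u b - v b) = (\<lambda>b. \<rho> h u b - \<rho> h v b)"
  by (rule ext, clarify) (simp add: \<rho>_def)

lemma qv_ends_Img:
  assumes w: "w \<in> W"
  shows "qv w (last w) - qv w (hd w) \<in> Img"
proof -
  from long_difference obtain F where F: "F \<in> long.Z" "Phi F = (\<lambda>b. qv idw n b - qv idw 1 b)" by (elim bexE)
  from word_surj[OF w] obtain h where h: "h \<in> G" "word h = w" by (elim bexE)
  have "Phi (\<lambda>k. F (iv h \<circ> k)) = (\<lambda>b. qv w (h n) b - qv w (h 1) b)"
    unfolding Phi_translate[OF h(1)] F(2) \<rho>_diff qv_act[OF h(1), symmetric] h(2) ..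
  moreover have "h n = last w" "h 1 = hd w" using last_word[of h] hd_word[of h] unfolding h(2) by simp_all
  ultimately have "Phi (\<lambda>k. F (iv h \<circ> k)) = qv w (last w) - qv w (hd w)"
    by (simp add: fun_eq_iff)
  then show ?thesis using Phi_Img[OF long.Z_translate[OF F(1) h(1)]] by simp
qed

lemma qv_rotate: "w \<in> W \<Longrightarrow> qv (rotate k w) j = qv w j"
proof (induction k)
  case (Suc k)
  have r: "rotate k w \<in> W" using Suc.prems by (simp add: words_def)
  have "A \<noteq> {}" using n3 by simp
  then have "Q (rotate1 (rotate k w)) x = Q (rotate k w) x" if "x \<in> W" for x
    by (rule Q_rotate1[OF r that])
  then have "qv (rotate1 (rotate k w)) j = qv (rotate k w) j"
    unfolding qv_def by (intro ext) (simp only: case_prod_beta cong: if_cong conj_cong)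
  then show ?case using Suc by simp
qed simp

text \<open>Rotating \<open>w\<close> leaves \<open>qv w j\<close> unchanged but makes any two
  neighbouring letters the last and the first one. The differences obtained in this way telescope
  along the word.\<close>

lemma qv_nth_Img:
  assumes w: "w \<in> W"
  shows "k < n \<Longrightarrow> qv w (last w) - qv w (w ! k) \<in> Img"
proof (induction k)
  case 0
  show ?case using qv_ends_Img[OF w] unfolding hd_conv_nth[OF W_ne[OF w]] .
next
  case (Suc k)
  have l: "length w = n" by (rule W_length[OF w])
  let ?r = "rotate (Suc k) w"
  have r: "?r \<in> W" using w by (simp add: words_def)
  have hd: "hd ?r = w ! Suc k" using hd_rotate_conv_nth[OF W_ne[OF w], of "Suc k"] Suc.prems l by simp
  have last: "last ?r = w ! k"
  proof -
    have "last ?r = ?r ! (n - 1)" using W_ne[OF r] l by (simp add: last_conv_nth)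
    also have "\<dots> = w ! ((Suc k + (n - 1)) mod n)" using l n3 by (subst nth_rotate) auto
    also have "(Suc k + (n - 1)) mod n = k" using Suc.prems n3 by simp
    finally show ?thesis .
  qed
  have "qv w (w ! k) - qv w (w ! Suc k) \<in> Img"
    using qv_ends_Img[OF r] unfolding qv_rotate[OF w] hd last .
  moreover have "qv w (last w) - qv w (w ! k) \<in> Img" by (rule Suc.IH[OF Suc_lessD[OF Suc.prems]])
  ultimately have "(qv w (last w) - qv w (w ! k)) + (qv w (w ! k) - qv w (w ! Suc k)) \<in> Img"
    by (intro fv.subspace_add[OF Img_subspace])
  then show ?case by (simp only: add_diff_eq diff_add_cancel)
qed

lemma lift_chain_poly:
  assumes w: "w \<in> W"
  shows "lift (T (chain_poly w)) = fscale (2 ^ (n - 2)) (\<Sum>j\<in>A. qv w j)"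
proof (rule ext, clarify)
  fix x i
  have "(\<Sum>j\<in>A. qv w j) (x, i) = (\<Sum>j\<in>A. if j = i then (if x \<in> W then Q w x else 0) else 0)"
    unfolding sum_apply by (rule sum.cong) (auto simp: qv_def)
  also have "\<dots> = (if i \<in> A then if x \<in> W then Q w x else 0 else 0)"
    by (rule sum.delta) simp
  finally have s: "(\<Sum>j\<in>A. qv w j) (x, i) = (if i \<in> A then if x \<in> W then Q w x else 0 else 0)" .
  have t: "T (chain_poly w) x = (if x \<in> W then 2 ^ (n - 2) * Q w x else 0)"
    using T_chain_poly[OF w, of x] by (cases "x \<in> W") (simp_all only: if_True if_False T_def)
  show "lift (T (chain_poly w)) (x, i) = fscale (2 ^ (n - 2)) (\<Sum>j\<in>A. qv w j) (x, i)"
    unfolding fscale_def s lift_def prod.case t by simp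
qed

text \<open>The differences of the \<open>qv w j\<close> come from \<open>Lie n\<close>, their sum over \<open>j\<close> from the top component.\<close>

lemma qv_Img:
  assumes w: "w \<in> W" and j: "j \<in> A"
  shows "qv w j \<in> Img"
proof -
  have d: "qv w (last w) - qv w i \<in> Img" if "i \<in> A" for i
  proof -
    have "i \<in> set w" using that w by (simp add: words_def)
    then obtain k where "k < n" "w ! k = i" using W_length[OF w] by (metis in_set_conv_nth)
    then show ?thesis using qv_nth_Img[OF w, of k] by (simp only:)
  qed
  have diff: "(x - y) - (x - z) = z - y" for x y z :: "nat list \<times> nat \<Rightarrow> complex" by (rule ext) simp
  have d': "qv w j - qv w i \<in> Img" if "i \<in> A" for i
    using fv.subspace_diff[OF Img_subspace d[OF that] d[OF j]] unfolding diff .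
  have "fscale (1 / 2 ^ (n - 2)) (lift (T (chain_poly w))) \<in> Img"
    by (rule fv.subspace_scale[OF Img_subspace lift_Img[OF chain_poly_Hom[OF w]]])
  then have s: "(\<Sum>i\<in>A. qv w i) \<in> Img"
    unfolding lift_chain_poly[OF w] by (simp add: fv.scale_scale)
  \<comment> \<open>Adding the sum of all \<open>qv w i\<close> to these differences leaves
    \<open>n\<close> copies of \<open>qv w j\<close>.\<close>
  have "(\<Sum>i\<in>A. qv w j - qv w i) \<in> Img" by (rule fv.subspace_sum[OF Img_subspace]) (rule d')
  from fv.subspace_add[OF Img_subspace this s] have "(\<Sum>i\<in>A. qv w j) \<in> Img"
    by (simp only: sum_subtractf diff_add_cancel)
  then have "fscale (1 / of_nat n) (\<Sum>i\<in>A. qv w j) \<in> Img" by (rule fv.subspace_scale[OF Img_subspace])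
  moreover have "fscale (1 / of_nat n) (\<Sum>i\<in>A. qv w j) = qv w j"
    using n3 by (simp add: fscale_def sum_apply fun_eq_iff)
  ultimately show ?thesis by simp
qed

lemma Y_sub_Img: "Y \<subseteq> Img"
  unfolding Y_def
proof (rule fv.span_minimal[OF _ Img_subspace])
  show "{qv w j | w j. w \<in> W \<and> j \<in> A} \<subseteq> Img" using qv_Img by blast
qed

section \<open>Dimension count for the top component and \<open>Lie n\<close>\<close>

sublocale star: star_base n tideal n
  by unfold_locales (rule n_in(1))

abbreviation "base_list \<equiv> [1..<n]"

lemma base_list: "distinct base_list" "set base_list = A - {n}" "base_list \<noteq> []" "length base_list = n - 1"
  using n3 by auto

abbreviation "TR \<equiv> star.trees base_list (n - 2)"

lemma card_TR: "card TR \<le> fact (n - 2)"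
proof -
  have e: "length base_list - 1 = n - 2" using n3 by simp
  show ?thesis using star.card_trees[OF base_list(3)] unfolding e .
qed

lemma Hom_TR:
  assumes "p \<in> Hom"
  shows "\<exists>a. p - (\<Sum>s\<in>TR. Const (a s) * s) \<in> tideal"
proof (rule tri.jspan_coeffs)
  show "p \<in> tri.jspan TR"
    by (rule star.homogeneous_trees[OF base_list(1,2)]) (use assms in \<open>auto simp: Hom_def\<close>)
qed (rule star.finite_trees)

lemma T_TR: "p - (\<Sum>s\<in>TR. Const (a s) * s) \<in> tideal \<Longrightarrow> T p = (\<lambda>x. \<Sum>s\<in>TR. a s * T s x)"
  using T_tideal[of "p - (\<Sum>s\<in>TR. Const (a s) * s)"] by (simp add: T_diff T_sum T_Const fun_eq_iff)

text \<open>Trees and orbit representatives together, at most (n-2)! + (n-1)! = n (n-2)! indices. A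
  sum type is used because different indices are not known in advance to give different
  functions.\<close>

definition fam :: "(nat \<times> nat \<Rightarrow> complex) cpoly + (nat \<Rightarrow> nat) \<Rightarrow> nat list \<times> nat \<Rightarrow> complex" where
  "fam = case_sum (\<lambda>s. lift (T s)) long.orbit_vec"

lemma fam_sum:
  assumes t: "T p = (\<lambda>x. \<Sum>s\<in>TR. a s * T s x)" and F: "F \<in> long.Z"
  shows "(\<lambda>b. lift (T p) b + Phi F b) = (\<lambda>b. \<Sum>i\<in>TR <+> long.Reps. case_sum a F i * fam i b)"
proof
  fix b
  have "lift (T p) b + Phi F b = (\<Sum>s\<in>TR. a s * lift (T s) b) + (\<Sum>r\<in>long.Reps. F r * long.orbit_vec r b)"
    unfolding t lift_sum long.Phi_Reps[OF F] ..
  also have "\<dots> = (\<Sum>i\<in>TR <+> long.Reps. case_sum a F i * fam i b)"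
    by (subst sum.Plus[OF star.finite_trees long.finite_Reps]) (simp only: comp_def fam_def sum.case)
  finally show "lift (T p) b + Phi F b = (\<Sum>i\<in>TR <+> long.Reps. case_sum a F i * fam i b)" .
qed

lemma fam_card: "card (TR <+> long.Reps) \<le> card M"
proof -
  have "n * card long.Reps = n * ((n - 1) * fact (n - 2))"
    unfolding long.card_Reps fact_n ..
  then have "card long.Reps = (n - 1) * fact (n - 2)" using n3 by simp
  then have "card (TR <+> long.Reps) \<le> fact (n - 2) + (n - 1) * fact (n - 2)"
    unfolding card_Plus[OF star.finite_trees long.finite_Reps] using card_TR by simp
  also have "\<dots> = Suc (n - 1) * fact (n - 2)" by simp
  also have "\<dots> = card M" using n3 by (simp add: card_M mult.commute)
  finally show ?thesis .
qed

lemma fam_span: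
  assumes k: "k \<in> M"
  shows "dM k \<in> fv.span (fam ` (TR <+> long.Reps))"
proof -
  have "dM k \<in> Img" by (rule subsetD[OF Y_sub_Img qv_M_Y[OF k]])
  then obtain p F where e: "dM k = (\<lambda>b. lift (T p) b + Phi F b)" "p \<in> Hom" "F \<in> long.Z"
    unfolding Img_def by blast
  from Hom_TR[OF e(2)] obtain a where a: "p - (\<Sum>s\<in>TR. Const (a s) * s) \<in> tideal" by (elim exE)
  show ?thesis unfolding e(1) fam_sum[OF T_TR[OF a] e(3)]
    by (intro span_lincomb fv.span_base imageI)
qed

lemma finite_fam: "finite (TR <+> long.Reps)"
  by (rule finite_Plus[OF star.finite_trees long.finite_Reps])

text \<open>A family of at most \<open>card M\<close> functions spanning \<open>card M\<close>
  independent ones is independent, so the coefficients of the trees and the values of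
  \<open>F\<close> at the representatives all vanish. Injectivity on both summands and directness of
  the sum come out at once.\<close>

lemma Img_kernel:
  assumes p: "p \<in> Hom" and F: "F \<in> long.Z" and z: "(\<lambda>b. lift (T p) b + Phi F b) = (\<lambda>b. 0)"
  shows "p \<in> tideal" and "g \<in> G \<Longrightarrow> F g = 0"
proof -
  from Hom_TR[OF p] obtain a where a: "p - (\<Sum>s\<in>TR. Const (a s) * s) \<in> tideal" by (elim exE)
  have c: "case_sum a F i = 0" if "i \<in> TR <+> long.Reps" for i
    by (rule spanning_family(1)[where I = "TR <+> long.Reps" and M = M and d = dM and pt = pM
          and e = fam and c = "case_sum a F" and i = i,
          OF finite_fam finite_M fam_card qv_dual fam_span _ that])
      (simp_all only: fam_sum[OF T_TR[OF a] F, symmetric] z)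
  have "a s = 0" if "s \<in> TR" for s using c[OF InlI[OF that]] by simp
  then have "(\<Sum>s\<in>TR. Const (a s) * s) = 0" by simp
  then show "p \<in> tideal" using a by simp
  show "F g = 0" if "g \<in> G"
    by (rule long.Z_zero[OF F _ that]) (use c[OF InrI] in simp)
qed

text \<open>That \<open>T p\<close> is a combination of functions \<open>Q\<close> is not visible
  from its definition. It too follows by counting: a further vector outside the span of the family
  indexed by \<open>M\<close> would exceed the dimension available.\<close>

lemma Img_eq_Y: "Img = Y"
proof
  show "Img \<subseteq> Y"
  proof
    fix y assume "y \<in> Img"
    then obtain p F where e: "y = (\<lambda>b. lift (T p) b + Phi F b)" "p \<in> Hom" "F \<in> long.Z"
      unfolding Img_def by blast
    from Hom_TR[OF e(2)] obtain a where a: "p - (\<Sum>s\<in>TR. Const (a s) * s) \<in> tideal" by (elim exE)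
    have "fv.span (dM ` M) \<subseteq> Y"
      using fv.span_minimal[of "dM ` M" Y] qv_M_Y unfolding Y_def by (metis (no_types, lifting) fv.subspace_span image_subsetI)
    then have "fam i \<in> Y" if "i \<in> TR <+> long.Reps" for i
      using spanning_family(2)[where I = "TR <+> long.Reps" and M = M and d = dM and pt = pM
          and e = fam and i = i, OF finite_fam finite_M fam_card qv_dual fam_span that] by blast
    then show "y \<in> Y" unfolding e(1) fam_sum[OF T_TR[OF a] e(3)] by (rule Y_lincomb)
  qed
qed (rule Y_sub_Img)

end

section \<open>The isomorphism\<close>

context braid_words
begin

abbreviation "V \<equiv> internal_top U (braid_dual n)"
abbreviation "G' \<equiv> carrier (sym_group (n - 1))"

lemma Hom_polys: "p \<in> Hom \<Longrightarrow> p \<in> polys K"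
  by (simp add: Hom_def)

text \<open>Nonvanishing in degree \<open>n - 2\<close> is seen on the path of the identity word,
  where \<open>T\<close> takes the value \<open>2 ^ (n - 2)\<close>. Above it there are no forests
  on \<open>n - 1\<close> vertices.\<close>

lemma top_degree_braid: "top_degree U (braid_dual n) = n - 2"
  unfolding top_degree_def
proof (rule Greatest_equality)
  show "internal_component U (braid_dual n) (n - 2) \<noteq> {\<zero>\<^bsub>IA\<^esub>}"
  proof
    assume "internal_component U (braid_dual n) (n - 2) = {\<zero>\<^bsub>IA\<^esub>}"
    then have "cls (chain_poly idw) = cls 0"
      unfolding internal_component_eq cls_zero using chain_poly_Hom[OF idw_W] unfolding Hom_def by blast
    then have "chain_poly idw - 0 \<in> tideal"
      using cls_eq[OF chain_poly_polys[OF idw_W] polys_zero] by blast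
    then have "T (chain_poly idw) idw = 0" using T_tideal by simp
    then have "Q idw idw = 0" using T_chain_poly[OF idw_W idw_W] by simp
    moreover have "Q (word id) (word id) = of_bool (id = (id :: nat \<Rightarrow> nat))"
      by (rule Q_small_perm[OF permutes_id permutes_id])
    ultimately show False by (simp del: upt_Suc)
  qed
next
  fix d assume d: "internal_component U (braid_dual n) d \<noteq> {\<zero>\<^bsub>IA\<^esub>}"
  show "d \<le> n - 2"
  proof (rule ccontr)
    assume "\<not> d \<le> n - 2"
    then have "star.trees base_list d = {}" by (intro star.trees_empty) (use n3 in auto)
    then have "p \<in> tideal" if "p \<in> polys K" "homogeneous d p" for p
      using star.homogeneous_trees[OF base_list(1,2) that] tri.jspan_empty by simp
    then have "cls p = cls 0" if "p \<in> polys K" "homogeneous d p" for p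
      using cls_eq[OF that(1) polys_zero] that by simp
    moreover have "0 \<in> {p \<in> polys K. homogeneous d p}" by (simp add: homogeneous_zero)
    ultimately have "internal_component U (braid_dual n) d = {cls 0}"
      unfolding internal_component_eq by blast
    then show False using d cls_zero by simp
  qed
qed

lemma V_carrier: "carrier V = cls ` Hom"
  by (simp add: internal_top_def top_degree_braid internal_component_eq Hom_def)

lemma V_ops:
  "zero V = cls 0"
  "p \<in> Hom \<Longrightarrow> q \<in> Hom \<Longrightarrow> add V (cls p) (cls q) = cls (p + q)"
  "p \<in> Hom \<Longrightarrow> smult V a (cls p) = cls (Const a * p)"
  "g \<in> G \<Longrightarrow> p \<in> Hom \<Longrightarrow> act V g (cls p) = cls (rn g p)"
  unfolding G_iff using cls_zero cls_add[of p q] cls_smult[of p a] rn_cls[of g p] Hom_polys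
  by (simp_all add: internal_top_def)

text \<open>The functional \<open>T\<close> on cosets; the choice of representative is immaterial
  because \<open>T\<close> kills \<open>tideal\<close>.\<close>

definition top_val :: "(nat \<times> nat \<Rightarrow> complex) cpoly set set \<Rightarrow> nat list \<Rightarrow> complex" where
  "top_val C = T (SOME p. p \<in> Hom \<and> C = cls p)"

lemma top_val_cls:
  assumes p: "p \<in> Hom"
  shows "top_val (cls p) = T p"
proof -
  define q where "q = (SOME q. q \<in> Hom \<and> cls p = cls q)"
  have q: "q \<in> Hom \<and> cls p = cls q"
    unfolding q_def by (rule someI[of _ p]) (use p in simp)
  then have "p - q \<in> tideal" using cls_eq p Hom_polys by blast
  then have "T p = T q" using T_tideal[of "p - q"] by (simp add: T_diff fun_eq_iff)
  then show ?thesis by (simp only: top_val_def q_def)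
qed

section \<open>The top component plus \<open>Lie n\<close> as a space of functions\<close>

lemma Lie_n_carrier: "carrier (Lie n) = (\<lambda>F. restrict F G) ` long.Z"
proof -
  have "carrier (Lie n) = {F \<in> G \<rightarrow>\<^sub>E UNIV. \<forall>g\<in>G. unit_root n * F (g \<circ> std_cycle n) = F g}"
    by (rule Lie_carrier) (use n3 in simp)
  also have "\<dots> = (\<lambda>F. restrict F G) ` long.Z"
  proof (intro equalityI subsetI)
    fix F assume "F \<in> {F \<in> G \<rightarrow>\<^sub>E UNIV. \<forall>g\<in>G. unit_root n * F (g \<circ> std_cycle n) = F g}"
    then have "F = restrict F G" "F \<in> long.Z"
      by (auto simp: long.Z_def PiE_restrict simp del: sym_group_carrier)
    then show "F \<in> (\<lambda>F. restrict F G) ` long.Z" by (rule image_eqI)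
  next
    fix F' assume "F' \<in> (\<lambda>F. restrict F G) ` long.Z"
    then obtain F where F: "F' = restrict F G" "F \<in> long.Z" by blast
    have e: "unit_root n * restrict F G (g \<circ> std_cycle n) = restrict F G g" if g: "g \<in> G" for g
      using F(2) g G_comp[OF g long.c_G] by (simp only: long.Z_def mem_Collect_eq restrict_apply')
    have "restrict F G \<in> G \<rightarrow>\<^sub>E UNIV" by (simp only: PiE_def restrict_extensional Pi_UNIV Int_UNIV_left)
    then show "F' \<in> {F \<in> G \<rightarrow>\<^sub>E UNIV. \<forall>g\<in>G. unit_root n * F (g \<circ> std_cycle n) = F g}"
      unfolding F(1) by (intro CollectI conjI ballI e)
  qed
  finally show ?thesis .
qed

lemma restrict_eqI: "(\<And>x. x \<in> B \<Longrightarrow> f x = g x) \<Longrightarrow> restrict f B = restrict g B"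
  by (auto simp: restrict_def)

lemma inv_sym_n: "h \<in> G \<Longrightarrow> m_inv (sym_group n) h = iv h"
  unfolding G_iff by (rule sym_group_inv)

lemma Lie_n_ops:
  "zero (Lie n) = restrict (\<lambda>g. 0) G"
  "add (Lie n) (restrict F G) (restrict F' G) = restrict (\<lambda>g. F g + F' g) G"
  "smult (Lie n) a (restrict F G) = restrict (\<lambda>g. a * F g) G"
  "h \<in> G \<Longrightarrow> act (Lie n) h (restrict F G) = restrict (\<lambda>k. F (iv h \<circ> k)) G"
proof -
  show "zero (Lie n) = restrict (\<lambda>g. 0) G"
    by (simp add: Lie_def induced_rep_def character_rep_def)
  show "add (Lie n) (restrict F G) (restrict F' G) = restrict (\<lambda>g. F g + F' g) G"
    "smult (Lie n) a (restrict F G) = restrict (\<lambda>g. a * F g) G"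
    unfolding Lie_def induced_rep_def character_rep_def by (simp_all add: restrict_def fun_eq_iff)
  assume h: "h \<in> G"
  have "act (Lie n) h (restrict F G) = restrict (\<lambda>g. restrict F G (m_inv (sym_group n) h \<circ> g)) G"
    by (simp add: Lie_def induced_rep_def)
  also have "\<dots> = restrict (\<lambda>k. F (iv h \<circ> k)) G"
    by (rule restrict_eqI) (simp only: inv_sym_n[OF h] restrict_apply' G_comp[OF G_inv[OF h]])
  finally show "act (Lie n) h (restrict F G) = restrict (\<lambda>k. F (iv h \<circ> k)) G" .
qed

lemma Phi_restrict: "Phi (restrict F G) = Phi F"
  by (rule Phi_cong) (simp only: restrict_apply')

lemma \<rho>_add: "\<rho> g (\<lambda>b. u b + v b) = (\<lambda>b. \<rho> g u b + \<rho> g v b)"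
  by (rule ext, clarify) (simp add: \<rho>_def)

lemma \<rho>_scale: "\<rho> g (\<lambda>b. a * u b) = (\<lambda>b. a * \<rho> g u b)"
  by (rule ext, clarify) (simp add: \<rho>_def)

lemma lift_T_rename:
  assumes g: "g \<in> G"
  shows "lift (T (rn g p)) = \<rho> g (lift (T p))"
proof (rule ext, clarify)
  fix x i
  have i: "iv g i \<in> A \<longleftrightarrow> i \<in> A"
    using G_inv[OF g] permutes_in_image[of "iv g" A i] unfolding G_iff by blast
  have "T (rn g p) x = T p (map (iv g) x)"
  proof (cases "x \<in> W")
    case True
    then show ?thesis using T_rename g unfolding G_iff by blast
  next
    case False
    then have "map (iv g) x \<notin> W" using map_W[OF g, of "map (iv g) x"] unfolding map_inv_cancel[OF g] by blast
    then show ?thesis using False by (simp only: T_def if_False)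
  qed
  then show "lift (T (rn g p)) (x, i) = \<rho> g (lift (T p)) (x, i)"
    by (simp only: lift_def \<rho>_def prod.case i)
qed

definition sum_val :: "(nat \<times> nat \<Rightarrow> complex) cpoly set set \<times> ((nat \<Rightarrow> nat) \<Rightarrow> complex) \<Rightarrow> nat list \<times> nat \<Rightarrow> complex" where
  "sum_val = (\<lambda>(C, F) b. lift (top_val C) b + Phi F b)"

lemma sum_val_eq: "p \<in> Hom \<Longrightarrow> sum_val (cls p, restrict F G) = (\<lambda>b. lift (T p) b + Phi F b)"
  by (simp only: sum_val_def prod.case top_val_cls Phi_restrict)

abbreviation "VL \<equiv> rep_sum V (Lie n)"

lemma VL_elim:
  assumes "x \<in> carrier VL"
  obtains p F where "x = (cls p, restrict F G)" "p \<in> Hom" "F \<in> long.Z"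
  using assms by (auto simp: rep_sum_def V_carrier Lie_n_carrier simp del: sym_group_carrier)

lemma VL_intro: "p \<in> Hom \<Longrightarrow> F \<in> long.Z \<Longrightarrow> (cls p, restrict F G) \<in> carrier VL"
  by (simp add: rep_sum_def V_carrier Lie_n_carrier del: sym_group_carrier)

lemma VL_ops:
  "zero VL = (cls 0, restrict (\<lambda>g. 0) G)"
  "p \<in> Hom \<Longrightarrow> q \<in> Hom \<Longrightarrow> add VL (cls p, restrict F G) (cls q, restrict F' G) =
    (cls (p + q), restrict (\<lambda>g. F g + F' g) G)"
  "p \<in> Hom \<Longrightarrow> smult VL a (cls p, restrict F G) = (cls (Const a * p), restrict (\<lambda>g. a * F g) G)"
  "h \<in> G \<Longrightarrow> p \<in> Hom \<Longrightarrow> act VL h (cls p, restrict F G) =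
    (cls (rn h p), restrict (\<lambda>k. F (iv h \<circ> k)) G)"
  by (simp_all add: rep_sum_def V_ops Lie_n_ops del: sym_group_carrier)

lemma embedded_VL: "embedded_rep (sym_group n) VL sum_val \<rho>"
proof (rule embedded_rep.intro)
  show "inj_on sum_val (carrier VL)"
  proof (rule inj_onI)
    fix x y assume xy: "x \<in> carrier VL" "y \<in> carrier VL" "sum_val x = sum_val y"
    from xy(1) obtain p F where x: "x = (cls p, restrict F G)" "p \<in> Hom" "F \<in> long.Z" by (rule VL_elim)
    from xy(2) obtain q F' where y: "y = (cls q, restrict F' G)" "q \<in> Hom" "F' \<in> long.Z" by (rule VL_elim)
    have H: "p + Const (- 1) * q \<in> Hom" by (intro Hom_add Hom_scale x y)
    have Z: "(\<lambda>g. F g + (- 1) * F' g) \<in> long.Z" by (intro long.Z_add long.Z_scale x y)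
    have e: "lift (T p) b + Phi F b = lift (T q) b + Phi F' b" for b
      using fun_cong[OF xy(3), of b] unfolding x(1) y(1) sum_val_eq[OF x(2)] sum_val_eq[OF y(2)] .
    have "(\<lambda>b. lift (T (p + Const (- 1) * q)) b + Phi (\<lambda>g. F g + (- 1) * F' g) b) = (\<lambda>b. 0)"
    proof
      fix b
      show "lift (T (p + Const (- 1) * q)) b + Phi (\<lambda>g. F g + (- 1) * F' g) b = 0"
        unfolding T_add T_Const lift_add lift_scale Phi_add Phi_scale using e[of b] by (simp add: algebra_simps)
    qed
    note k = Img_kernel[OF H Z this]
    have "p - q \<in> tideal" using k(1) by (simp add: Const_uminus)
    then have "cls p = cls q" using cls_eq x(2) y(2) Hom_polys by blast
    moreover have "restrict F G = restrict F' G"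
      by (rule restrict_eqI) (use k(2) in \<open>simp del: sym_group_carrier\<close>)
    ultimately show "x = y" by (simp only: x(1) y(1))
  qed
  show "group (sym_group n)" by (rule sym_group_is_group)
  show "zero VL \<in> carrier VL" unfolding VL_ops by (intro VL_intro Hom_zero long.Z_zero_fun)
  show "sum_val (zero VL) = (\<lambda>b. 0)"
    unfolding VL_ops sum_val_eq[OF Hom_zero] T_zero lift_zero Phi_zero by simp
next
  fix x y assume xy: "x \<in> carrier VL" "y \<in> carrier VL"
  from xy(1) obtain p F where x: "x = (cls p, restrict F G)" "p \<in> Hom" "F \<in> long.Z" by (rule VL_elim)
  from xy(2) obtain q F' where y: "y = (cls q, restrict F' G)" "q \<in> Hom" "F' \<in> long.Z" by (rule VL_elim)
  show "add VL x y \<in> carrier VL"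
    unfolding x(1) y(1) VL_ops(2)[OF x(2) y(2)] by (intro VL_intro Hom_add long.Z_add x y)
  show "sum_val (add VL x y) = (\<lambda>b. sum_val x b + sum_val y b)"
    unfolding x(1) y(1) VL_ops(2)[OF x(2) y(2)] sum_val_eq[OF x(2)] sum_val_eq[OF y(2)]
      sum_val_eq[OF Hom_add[OF x(2) y(2)]] T_add lift_add Phi_add by (simp add: algebra_simps)
next
  fix x and a :: complex assume "x \<in> carrier VL"
  then obtain p F where x: "x = (cls p, restrict F G)" "p \<in> Hom" "F \<in> long.Z" by (rule VL_elim)
  show "smult VL a x \<in> carrier VL"
    unfolding x(1) VL_ops(3)[OF x(2)] by (intro VL_intro Hom_scale long.Z_scale x)
  show "sum_val (smult VL a x) = (\<lambda>b. a * sum_val x b)"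
    unfolding x(1) VL_ops(3)[OF x(2)] sum_val_eq[OF x(2)] sum_val_eq[OF Hom_scale[OF x(2)]]
      T_Const lift_scale Phi_scale distrib_left ..
next
  fix h x assume h: "h \<in> G" and "x \<in> carrier VL"
  then obtain p F where x: "x = (cls p, restrict F G)" "p \<in> Hom" "F \<in> long.Z" by (elim VL_elim)
  show "act VL h x \<in> carrier VL"
    unfolding x(1) VL_ops(4)[OF h x(2)] by (intro VL_intro Hom_rn long.Z_translate h x)
  show "sum_val (act VL h x) = \<rho> h (sum_val x)"
    unfolding x(1) VL_ops(4)[OF h x(2)] sum_val_eq[OF x(2)] sum_val_eq[OF Hom_rn[OF h x(2)]]
      lift_T_rename[OF h] Phi_translate[OF h] \<rho>_add ..
next
  fix g h :: "nat \<Rightarrow> nat" and u assume "g \<in> G" "h \<in> G"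
  then show "\<rho> (monoid.mult (sym_group n) g h) u = \<rho> g (\<rho> h u)"
    using \<rho>_comp[of g h u] by simp
qed (simp_all only: \<rho>_add \<rho>_scale sym_group_one \<rho>_id)

lemma sum_val_image: "sum_val ` carrier VL = Y"
  unfolding Img_eq_Y[symmetric]
proof (intro equalityI subsetI)
  fix y assume "y \<in> sum_val ` carrier VL"
  then obtain x where x: "x \<in> carrier VL" "y = sum_val x" by blast
  from x(1) obtain p F where e: "x = (cls p, restrict F G)" "p \<in> Hom" "F \<in> long.Z" by (rule VL_elim)
  show "y \<in> Img" unfolding x(2) e(1) sum_val_eq[OF e(2)] by (rule ImgI[OF e(2,3)])
next
  fix y assume "y \<in> Img"
  then obtain p F where e: "y = (\<lambda>b. lift (T p) b + Phi F b)" "p \<in> Hom" "F \<in> long.Z"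
    unfolding Img_def by blast
  show "y \<in> sum_val ` carrier VL"
    unfolding e(1) sum_val_eq[OF e(2), symmetric] by (intro imageI VL_intro e)
qed

section \<open>The induced representation as a space of functions\<close>

abbreviation "Ind \<equiv> induced_rep (sym_group n) (point_stabilizer n) (Lie (n - 1))"

text \<open>Induction in stages: inducing \<open>Lie (n - 1)\<close> amounts to inducing the
  character directly from the cyclic group generated by the (n-1)-cycle, and \<open>mk\<close> turns
  a function on the group into the corresponding nested function.\<close>

definition mk :: "((nat \<Rightarrow> nat) \<Rightarrow> complex) \<Rightarrow> (nat \<Rightarrow> nat) \<Rightarrow> (nat \<Rightarrow> nat) \<Rightarrow> complex" where
  "mk F = (\<lambda>g\<in>G. \<lambda>x\<in>G'. F (g \<circ> x))"

lemma stabilizer_eq: "point_stabilizer n = G'"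
  by (rule point_stabilizer_eq) (use n3 in simp)

lemma G'_G: "x \<in> G' \<Longrightarrow> x \<in> G"
  unfolding stabilizer_eq[symmetric] point_stabilizer_def by blast

lemma G'_group: "x \<in> G' \<Longrightarrow> y \<in> G' \<Longrightarrow> x \<circ> y \<in> G'" "x \<in> G' \<Longrightarrow> iv x \<in> G'" "id \<in> G'"
  "std_cycle (n - 1) \<in> G'"
  unfolding sym_group_carrier
  by (rule permutes_compose permutes_inv permutes_id std_cycle_permutes; assumption?)+

lemma Lie_short_carrier: "carrier (Lie (n - 1)) = {F \<in> G' \<rightarrow>\<^sub>E UNIV.
    \<forall>g\<in>G'. unit_root (n - 1) * F (g \<circ> std_cycle (n - 1)) = F g}"
  by (rule Lie_carrier) (use n3 in simp)

lemma Lie_short_act: "h \<in> G' \<Longrightarrow> act (Lie (n - 1)) h F = (\<lambda>x\<in>G'. F (iv h \<circ> x))"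
  using sym_group_inv[of h "n - 1"] unfolding sym_group_carrier
  by (simp add: Lie_def induced_rep_def)

lemma mk_apply: "g \<in> G \<Longrightarrow> mk F g = (\<lambda>x\<in>G'. F (g \<circ> x))"
  unfolding mk_def by (rule restrict_apply')

lemma mk_Ind:
  assumes F: "F \<in> short.Z"
  shows "mk F \<in> carrier Ind"
proof -
  have c: "mk F g \<in> carrier (Lie (n - 1))" if g: "g \<in> G" for g
    unfolding Lie_short_carrier mk_apply[OF g]
  proof (intro CollectI conjI ballI)
    fix x assume x: "x \<in> G'"
    have "unit_root (n - 1) * F ((g \<circ> x) \<circ> std_cycle (n - 1)) = F (g \<circ> x)"
      using F G_comp[OF g G'_G[OF x]] unfolding short.Z_def by blast
    then show "unit_root (n - 1) * (\<lambda>x\<in>G'. F (g \<circ> x)) (x \<circ> std_cycle (n - 1)) = (\<lambda>x\<in>G'. F (g \<circ> x)) x"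
      by (simp only: restrict_apply' x G'_group(1)[OF x G'_group(4)] comp_assoc)
  qed (simp only: PiE_def restrict_extensional Pi_UNIV Int_UNIV_left)
  moreover have "act (Lie (n - 1)) h (mk F (g \<circ> h)) = mk F g" if g: "g \<in> G" and h: "h \<in> G'" for g h
    unfolding Lie_short_act[OF h] mk_apply[OF g] mk_apply[OF G_comp[OF g G'_G[OF h]]]
  proof (rule restrict_eqI)
    fix x assume x: "x \<in> G'"
    have "(g \<circ> h) \<circ> (iv h \<circ> x) = g \<circ> ((h \<circ> iv h) \<circ> x)" by (simp only: comp_assoc)
    also have "\<dots> = g \<circ> x" by (simp only: G_inv_o(1)[OF G'_G[OF h]] id_comp)
    finally show "(\<lambda>x\<in>G'. F ((g \<circ> h) \<circ> x)) (iv h \<circ> x) = F (g \<circ> x)"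
      by (simp only: restrict_apply' G'_group(1)[OF G'_group(2)[OF h] x])
  qed
  moreover have "mk F \<in> extensional G" unfolding mk_def by (rule restrict_extensional)
  ultimately show ?thesis
    unfolding induced_rep_def stabilizer_eq
    by (simp add: PiE_def Pi_def del: sym_group_carrier)
qed

lemma Ind_mk:
  assumes \<phi>: "\<phi> \<in> carrier Ind"
  shows "(\<lambda>g. \<phi> g id) \<in> short.Z" "\<phi> = mk (\<lambda>g. \<phi> g id)"
proof -
  have a: "\<phi> \<in> G \<rightarrow>\<^sub>E carrier (Lie (n - 1))"
    and b: "\<And>g h. g \<in> G \<Longrightarrow> h \<in> G' \<Longrightarrow> act (Lie (n - 1)) h (\<phi> (g \<circ> h)) = \<phi> g"
    using \<phi> unfolding induced_rep_def stabilizer_eq by (simp_all del: sym_group_carrier)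
  have L: "\<phi> g \<in> G' \<rightarrow>\<^sub>E UNIV" "\<And>x. x \<in> G' \<Longrightarrow> unit_root (n - 1) * \<phi> g (x \<circ> std_cycle (n - 1)) = \<phi> g x"
    if "g \<in> G" for g
    using PiE_mem[OF a that] unfolding Lie_short_carrier by blast+
  \<comment> \<open>Equivariance under the stabilizer moves the inner argument into the outer one,
    so the values at \<open>id\<close> determine everything.\<close>
  have e: "\<phi> g x = \<phi> (g \<circ> x) id" if g: "g \<in> G" and x: "x \<in> G'" for g x
  proof -
    have "\<phi> g x = (\<lambda>y\<in>G'. \<phi> (g \<circ> x) (iv x \<circ> y)) x" unfolding Lie_short_act[OF x, symmetric] b[OF g x] ..
    also have "\<dots> = \<phi> (g \<circ> x) id" by (simp only: restrict_apply' x G_inv_o(2)[OF G'_G[OF x]])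
    finally show ?thesis .
  qed
  show "(\<lambda>g. \<phi> g id) \<in> short.Z"
    unfolding short.Z_def
  proof (intro CollectI ballI)
    fix g assume g: "g \<in> G"
    show "unit_root (n - 1) * \<phi> (g \<circ> std_cycle (n - 1)) id = \<phi> g id"
      using L(2)[OF g G'_group(3)] unfolding id_comp e[OF g G'_group(4)] .
  qed
  show "\<phi> = mk (\<lambda>g. \<phi> g id)"
  proof
    fix g
    show "\<phi> g = mk (\<lambda>g. \<phi> g id) g"
    proof (cases "g \<in> G")
      case True
      have "\<phi> g = restrict (\<phi> g) G'" using L(1)[OF True] by (simp only: PiE_restrict)
      also have "\<dots> = (\<lambda>x\<in>G'. \<phi> (g \<circ> x) id)" by (rule restrict_eqI) (rule e[OF True])
      finally show ?thesis unfolding mk_apply[OF True] .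
    next
      case False
      then show ?thesis using PiE_arb[OF a False] unfolding mk_def by (simp only: restrict_apply if_False)
    qed
  qed
qed

lemma Ind_elim:
  assumes "\<phi> \<in> carrier Ind"
  obtains F where "\<phi> = mk F" "F \<in> short.Z"
  using Ind_mk[OF assms] that by blast

lemma Lie_short_ops:
  "zero (Lie (n - 1)) = (\<lambda>x\<in>G'. 0)"
  "add (Lie (n - 1)) (\<lambda>x\<in>G'. F x) (\<lambda>x\<in>G'. F' x) = (\<lambda>x\<in>G'. F x + F' x)"
  "smult (Lie (n - 1)) a (\<lambda>x\<in>G'. F x) = (\<lambda>x\<in>G'. a * F x)"
  unfolding Lie_def induced_rep_def character_rep_def by (simp_all add: restrict_def fun_eq_iff)

lemma Ind_ops:
  "zero Ind = mk (\<lambda>g. 0)"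
  "add Ind (mk F) (mk F') = mk (\<lambda>g. F g + F' g)"
  "smult Ind a (mk F) = mk (\<lambda>g. a * F g)"
  "h \<in> G \<Longrightarrow> act Ind h (mk F) = mk (\<lambda>k. F (iv h \<circ> k))"
proof -
  have "zero Ind = (\<lambda>g\<in>G. zero (Lie (n - 1)))" by (simp add: induced_rep_def)
  then show "zero Ind = mk (\<lambda>g. 0)" unfolding Lie_short_ops mk_def .
  have "add Ind (mk F) (mk F') = (\<lambda>g\<in>G. add (Lie (n - 1)) (mk F g) (mk F' g))" by (simp add: induced_rep_def)
  also have "\<dots> = mk (\<lambda>g. F g + F' g)"
    unfolding mk_def[of "\<lambda>g. F g + F' g"] by (rule restrict_eqI) (simp only: mk_apply Lie_short_ops)
  finally show "add Ind (mk F) (mk F') = mk (\<lambda>g. F g + F' g)" .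
  have "smult Ind a (mk F) = (\<lambda>g\<in>G. smult (Lie (n - 1)) a (mk F g))" by (simp add: induced_rep_def)
  also have "\<dots> = mk (\<lambda>g. a * F g)"
    unfolding mk_def[of "\<lambda>g. a * F g"] by (rule restrict_eqI) (simp only: mk_apply Lie_short_ops)
  finally show "smult Ind a (mk F) = mk (\<lambda>g. a * F g)" .
  assume h: "h \<in> G"
  have "act Ind h (mk F) = (\<lambda>g\<in>G. mk F (m_inv (sym_group n) h \<circ> g))" by (simp add: induced_rep_def)
  also have "\<dots> = mk (\<lambda>k. F (iv h \<circ> k))"
    unfolding mk_def[of "\<lambda>k. F (iv h \<circ> k)"]
    by (rule restrict_eqI) (simp only: inv_sym_n[OF h] mk_apply G_comp[OF G_inv[OF h]] comp_assoc)
  finally show "act Ind h (mk F) = mk (\<lambda>k. F (iv h \<circ> k))" .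
qed

definition ind_val :: "((nat \<Rightarrow> nat) \<Rightarrow> (nat \<Rightarrow> nat) \<Rightarrow> complex) \<Rightarrow> nat list \<times> nat \<Rightarrow> complex" where
  "ind_val \<phi> = Phi (\<lambda>g. \<phi> g id)"

lemma ind_val_mk: "ind_val (mk F) = Phi F"
  unfolding ind_val_def
  by (rule Phi_cong) (simp only: mk_apply restrict_apply' G'_group(3) comp_id)

lemma embedded_Ind: "embedded_rep (sym_group n) Ind ind_val \<rho>"
proof (rule embedded_rep.intro)
  show "inj_on ind_val (carrier Ind)"
  proof (rule inj_onI)
    fix x y assume xy: "x \<in> carrier Ind" "y \<in> carrier Ind" "ind_val x = ind_val y"
    from xy(1) obtain F where x: "x = mk F" "F \<in> short.Z" by (rule Ind_elim)
    from xy(2) obtain F' where y: "y = mk F'" "F' \<in> short.Z" by (rule Ind_elim)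
    have Z: "(\<lambda>g. F g + (- 1) * F' g) \<in> short.Z" by (intro short.Z_add short.Z_scale x y)
    have e: "Phi F = Phi F'" using xy(3) unfolding x(1) y(1) ind_val_mk .
    have "Phi (\<lambda>g. F g + (- 1) * F' g) = (\<lambda>b. 0)"
      unfolding Phi_add Phi_scale e by simp
    note k = short_kernel[OF Z this]
    have "F g = F' g" if "g \<in> G" for g using k[OF that] by simp
    then show "x = y"
      unfolding x(1) y(1) mk_def by (intro restrict_eqI) (blast intro: G_comp G'_G)
  qed
  show "group (sym_group n)" by (rule sym_group_is_group)
  show "zero Ind \<in> carrier Ind" unfolding Ind_ops by (rule mk_Ind[OF short.Z_zero_fun])
  show "ind_val (zero Ind) = (\<lambda>b. 0)" unfolding Ind_ops ind_val_mk by (rule Phi_zero)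
next
  fix x y assume xy: "x \<in> carrier Ind" "y \<in> carrier Ind"
  from xy(1) obtain F where x: "x = mk F" "F \<in> short.Z" by (rule Ind_elim)
  from xy(2) obtain F' where y: "y = mk F'" "F' \<in> short.Z" by (rule Ind_elim)
  show "add Ind x y \<in> carrier Ind" unfolding x(1) y(1) Ind_ops by (rule mk_Ind[OF short.Z_add[OF x(2) y(2)]])
  show "ind_val (add Ind x y) = (\<lambda>b. ind_val x b + ind_val y b)"
    unfolding x(1) y(1) Ind_ops ind_val_mk by (rule Phi_add)
next
  fix x and a :: complex assume "x \<in> carrier Ind"
  then obtain F where x: "x = mk F" "F \<in> short.Z" by (rule Ind_elim)
  show "smult Ind a x \<in> carrier Ind" unfolding x(1) Ind_ops by (rule mk_Ind[OF short.Z_scale[OF x(2)]])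
  show "ind_val (smult Ind a x) = (\<lambda>b. a * ind_val x b)"
    unfolding x(1) Ind_ops ind_val_mk by (rule Phi_scale)
next
  fix h x assume h: "h \<in> G" and "x \<in> carrier Ind"
  then obtain F where x: "x = mk F" "F \<in> short.Z" by (elim Ind_elim)
  show "act Ind h x \<in> carrier Ind"
    unfolding x(1) Ind_ops(4)[OF h] by (rule mk_Ind[OF short.Z_translate[OF x(2) h]])
  show "ind_val (act Ind h x) = \<rho> h (ind_val x)"
    unfolding x(1) Ind_ops(4)[OF h] ind_val_mk by (rule Phi_translate[OF h])
next
  fix g h :: "nat \<Rightarrow> nat" and u assume "g \<in> G" "h \<in> G"
  then show "\<rho> (monoid.mult (sym_group n) g h) u = \<rho> g (\<rho> h u)"
    using \<rho>_comp[of g h u] by simp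
qed (simp_all only: \<rho>_add \<rho>_scale sym_group_one \<rho>_id)

lemma ind_val_image: "ind_val ` carrier Ind = Y"
proof (intro equalityI subsetI)
  fix y assume "y \<in> ind_val ` carrier Ind"
  then show "y \<in> Y" using Phi_Y unfolding ind_val_def by blast
next
  fix y assume "y \<in> Y"
  from short_image[OF this] obtain F where F: "F \<in> short.Z" "Phi F = y" by (elim bexE)
  show "y \<in> ind_val ` carrier Ind"
    unfolding F(2)[symmetric] ind_val_mk[symmetric] by (rule imageI[OF mk_Ind[OF F(1)]])
qed

lemma VL_iso_Ind: "rep_iso (sym_group n) VL Ind"
  by (rule rep_iso_embedded[OF embedded_VL embedded_Ind]) (simp only: sum_val_image ind_val_image)

end

theorem theorem8p5:
  fixes n :: nat
  assumes "n \<ge> 3"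
  shows "rep_iso_virtual (sym_group n) (internal_top (braid_kernel n) (braid_dual n)) (Wh n)"
proof -
  interpret braid_words n by unfold_locales (rule assms)
  show ?thesis
    using VL_iso_Ind by (simp only: rep_iso_virtual_def Wh_def fst_conv snd_conv)
qed

end
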